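(* Let $k$ be a field. Let $I(K_4)\subset k[x_1,x_2,x_3,x_4]$ and $I(K_3)\subset k[x_1,x_2,x_3]$ be the edge ideals of the complete graphs on $4$ and $3$ vertices. Let $s\ge 4$ be an integer. Then for all positive integers $i,j$, with the indexing of graded Betti numbers given in the context: (a) $\beta_{i,j}(I(K_4)^{(s)})=6$ if $(i,j)=(1,2s)$ or $(i,j)=(3,2s+2)$; (b) $\beta_{2,2s+1}(I(K_4)^{(s)})=12$; (c) for all other $(i,j)$, $$\beta_{i,j}(I(K_4)^{(s)})=\beta_{i,j-4}(I(K_4)^{(s-3)})+4\,\beta_{i-1,j-4}(I(K_3)^{(s-2)})+4\,\beta_{i,j-3}(I(K_3)^{(s-2)}).$$
   Context: The edge ideal of the complete graph $K_m$ on $\{x_1,\dots,x_m\}$ is $I(K_m)=\langle x_ix_j:1\le i<j\le m\rangle\subset k[x_1,\dots,x_m]$. Indexing convention: for a homogeneous ideal $I$ in a polynomial ring $R$ over $k$, $\beta_{i,j}(I):=\dim_k\mathrm{Tor}^R_{i-1}(k,I)_j$ for $i\ge 1$ (so $i=1$ corresponds to minimal generators; equivalently these are the graded Betti numbers of $R/I$ in homological position $i\ge1$), and $\beta_{0,j}(I):=0$ for all $j$. Also $\beta_{i,j}(I)=0$ for $j<0$. Symbolic powers: for a monomial ideal $I\subset R$ with primary decomposition $I=I_1\cap\dots\cap I_n$, and $Q$ an associated prime of $I$ maximal under inclusion, put $I_{\subseteq Q}=\bigcap_{\sqrt{I_\ell}\subseteq Q}I_\ell$; then $I^{(s)}=\bigcap_{Q}I_{\subseteq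 Q}^s$, the intersection running over all associated primes $Q$ of $I$ that are maximal with respect to inclusion. *)

theory Defs
  imports
    Complex_Main
    "HOL-Library.Poly_Mapping"
    "HOL-Library.Numeral_Type"
    "HOL-Library.Function_Algebras"
begin

section \<open>Ideals and symbolic powers in a commutative ring\<close>

definition is_ideal :: "'a::comm_ring_1 set \<Rightarrow> bool" where
  "is_ideal I \<longleftrightarrow> module.subspace (*) I"

definition ideal_gen :: "'a::comm_ring_1 set \<Rightarrow> 'a set" where
  "ideal_gen B = module.span (*) B"

primrec ideal_power :: "'a::comm_ring_1 set \<Rightarrow> nat \<Rightarrow> 'a set" where
  "ideal_power I 0 = UNIV"
| "ideal_power I (Suc n) = ideal_gen {a * b | a b. a \<in> I \<and> b \<in> ideal_power I n}"

definition ideal_radical :: "'a::comm_ring_1 set \<Rightarrow> 'a set" where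
  "ideal_radical I = {f. \<exists>n. f ^ n \<in> I}"

definition prime_ideal :: "'a::comm_ring_1 set \<Rightarrow> bool" where
  "prime_ideal P \<longleftrightarrow> is_ideal P \<and> P \<noteq> UNIV \<and> (\<forall>a b. a * b \<in> P \<longrightarrow> a \<in> P \<or> b \<in> P)"

definition primary_ideal :: "'a::comm_ring_1 set \<Rightarrow> bool" where
  "primary_ideal J \<longleftrightarrow> is_ideal J \<and> J \<noteq> UNIV \<and>
     (\<forall>a b. a * b \<in> J \<longrightarrow> a \<in> J \<or> b \<in> ideal_radical J)"

definition associated_primes :: "'a::comm_ring_1 set \<Rightarrow> 'a set set" where
  "associated_primes I = {P. prime_ideal P \<and> (\<exists>f. P = {g. g * f \<in> I})}"

definition maximal_associated_primes :: "'a::comm_ring_1 set \<Rightarrow> 'a set set" where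
  "maximal_associated_primes I =
     {Q \<in> associated_primes I. \<forall>P \<in> associated_primes I. Q \<subseteq> P \<longrightarrow> P = Q}"

definition primary_decomposition :: "'a::comm_ring_1 set \<Rightarrow> 'a set set \<Rightarrow> bool" where
  "primary_decomposition I D \<longleftrightarrow> finite D \<and> (\<forall>J \<in> D. primary_ideal J) \<and> I = \<Inter> D"

text \<open>For a fixed associated prime \<open>Q\<close>, the ideal \<open>I\<^sub>\<subseteq>\<^sub>Q\<close>, the intersection of the components
  whose radical lies in \<open>Q\<close>, is the contraction of the localisation of \<open>I\<close> at \<open>Q\<close>. It therefore
  does not depend on the primary decomposition, and the choice below is immaterial.\<close>

definition component_below :: "'a::comm_ring_1 set \<Rightarrow> 'a set \<Rightarrow> 'a set" where
  "component_below I Q =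
     \<Inter> {J \<in> (SOME D. primary_decomposition I D). ideal_radical J \<subseteq> Q}"

definition symbolic_power :: "'a::comm_ring_1 set \<Rightarrow> nat \<Rightarrow> 'a set" where
  "symbolic_power I s =
     (\<Inter>Q \<in> maximal_associated_primes I. ideal_power (component_below I Q) s)"


section \<open>Polynomial rings and edge ideals of complete graphs\<close>

text \<open>The polynomial ring over \<open>'k\<close> whose variables are indexed by the finite type \<open>'n\<close>; with
  \<open>'n = 4\<close> it has exactly four variables. A monomial is its exponent vector.\<close>

type_synonym ('n, 'k) mpoly = "('n \<Rightarrow>\<^sub>0 nat) \<Rightarrow>\<^sub>0 'k"

definition Var :: "'n \<Rightarrow> ('n, 'k::field) mpoly" where
  "Var i = Poly_Mapping.single (Poly_Mapping.single i 1) 1"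

definition Const :: "'k \<Rightarrow> ('n, 'k::field) mpoly" where
  "Const c = Poly_Mapping.single 0 c"

definition const_coeff :: "('n, 'k::field) mpoly \<Rightarrow> 'k" where
  "const_coeff f = Poly_Mapping.lookup f 0"

text \<open>The zero polynomial is homogeneous of every degree, and it is the only polynomial that is
  homogeneous of a negative degree.\<close>

definition homogeneous :: "int \<Rightarrow> ('n::finite, 'k::field) mpoly \<Rightarrow> bool" where
  "homogeneous d f \<longleftrightarrow>
     (\<forall>t \<in> Poly_Mapping.keys f. int (\<Sum>i\<in>UNIV. Poly_Mapping.lookup t i) = d)"

definition complete_edge_ideal :: "('n::finite, 'k::field) mpoly set" where
  "complete_edge_ideal = ideal_gen {Var i * Var j | i j. i \<noteq> j}"


section \<open>Tor and graded Betti numbers\<close>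

text \<open>Data of a complex of finite graded free modules over the polynomial ring \<open>R\<close>, augmented
  to \<open>k\<close>. The \<open>n\<close>-th module \<open>F\<^sub>n\<close> has the basis \<open>e\<^sub>b\<close>, \<open>b < rank F n\<close>, with \<open>e\<^sub>b\<close> in degree
  \<open>shift F n b\<close>; its elements are the functions \<open>nat \<Rightarrow> R\<close> that vanish from \<open>rank F n\<close> on.
  For \<open>n > 0\<close>, \<open>mat F n\<close> is the matrix (row, column) of the differential \<open>F\<^sub>n \<rightarrow> F\<^sub>n\<^sub>-\<^sub>1\<close>, and
  \<open>aug F b\<close> is the image in \<open>k\<close> of the basis element \<open>e\<^sub>b\<close> of \<open>F\<^sub>0\<close>.\<close>

record (overloaded) ('n, 'k) free_complex =
  rank :: "nat \<Rightarrow> nat"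
  shift :: "nat \<Rightarrow> nat \<Rightarrow> int"
  mat :: "nat \<Rightarrow> nat \<Rightarrow> nat \<Rightarrow> ('n, 'k) mpoly"
  aug :: "nat \<Rightarrow> 'k"

definition free_module :: "('n::finite, 'k::field) free_complex \<Rightarrow> nat \<Rightarrow> (nat \<Rightarrow> ('n, 'k) mpoly) set" where
  "free_module F n = {v. \<forall>b \<ge> rank F n. v b = 0}"

definition differential ::
  "('n::finite, 'k::field) free_complex \<Rightarrow> nat \<Rightarrow> (nat \<Rightarrow> ('n, 'k) mpoly) \<Rightarrow> (nat \<Rightarrow> ('n, 'k) mpoly)" where
  "differential F n v = (if n = 0 then 0 else (\<lambda>a. \<Sum>b<rank F n. mat F n a b * v b))"

text \<open>The variables act on \<open>k = R/(x\<^sub>1,\<dots>,x\<^sub>m)\<close> as zero.\<close>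

definition augmentation ::
  "('n::finite, 'k::field) free_complex \<Rightarrow> (nat \<Rightarrow> ('n, 'k) mpoly) \<Rightarrow> 'k" where
  "augmentation F v = (\<Sum>b<rank F 0. const_coeff (v b) * aug F b)"

text \<open>\<open>\<dots> \<rightarrow> F\<^sub>2 \<rightarrow> F\<^sub>1 \<rightarrow> F\<^sub>0 \<rightarrow> k \<rightarrow> 0\<close> is exact and all maps preserve degrees, with \<open>k\<close>
  placed in degree \<open>0\<close>.\<close>

definition graded_free_resolution_of_field :: "('n::finite, 'k::field) free_complex \<Rightarrow> bool" where
  "graded_free_resolution_of_field F \<longleftrightarrow>
     (\<forall>n>0. \<forall>b<rank F n. \<forall>a<rank F (n - 1).
        homogeneous (shift F n b - shift F (n - 1) a) (mat F n a b)) \<and>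
     (\<forall>n>0. \<forall>b<rank F n. \<forall>a\<ge>rank F (n - 1). mat F n a b = 0) \<and>
     (\<forall>b<rank F 0. aug F b \<noteq> 0 \<longrightarrow> shift F 0 b = 0) \<and>
     augmentation F ` free_module F 0 = UNIV \<and>
     {v \<in> free_module F 0. augmentation F v = 0} = differential F 1 ` free_module F 1 \<and>
     (\<forall>n>0. {v \<in> free_module F n. differential F n v = 0} =
        differential F (Suc n) ` free_module F (Suc n))"

text \<open>The degree-\<open>j\<close> part of \<open>F\<^sub>n \<otimes> M\<close>, for a homogeneous ideal \<open>M\<close>: since \<open>F\<^sub>n\<close> is free,
  \<open>F\<^sub>n \<otimes> M\<close> is the direct sum of the shifted copies of \<open>M\<close>, and the differential of \<open>F \<otimes> M\<close>
  is given by the same matrices as that of \<open>F\<close>.\<close>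

definition tensor_piece ::
  "('n::finite, 'k::field) free_complex \<Rightarrow> ('n, 'k) mpoly set \<Rightarrow> nat \<Rightarrow> int \<Rightarrow> (nat \<Rightarrow> ('n, 'k) mpoly) set" where
  "tensor_piece F M n j =
     {v \<in> free_module F n. \<forall>b<rank F n. v b \<in> M \<and> homogeneous (j - shift F n b) (v b)}"

definition tensor_cycles ::
  "('n::finite, 'k::field) free_complex \<Rightarrow> ('n, 'k) mpoly set \<Rightarrow> nat \<Rightarrow> int \<Rightarrow> (nat \<Rightarrow> ('n, 'k) mpoly) set" where
  "tensor_cycles F M n j = {v \<in> tensor_piece F M n j. differential F n v = 0}"

definition tensor_boundaries ::
  "('n::finite, 'k::field) free_complex \<Rightarrow> ('n, 'k) mpoly set \<Rightarrow> nat \<Rightarrow> int \<Rightarrow> (nat \<Rightarrow> ('n, 'k) mpoly) set" where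
  "tensor_boundaries F M n j = differential F (Suc n) ` tensor_piece F M (Suc n) j"

definition vec_scale :: "'k \<Rightarrow> (nat \<Rightarrow> ('n, 'k::field) mpoly) \<Rightarrow> (nat \<Rightarrow> ('n, 'k) mpoly)" where
  "vec_scale c v = (\<lambda>b. Const c * v b)"

text \<open>The dimension over \<open>k\<close> of the degree-\<open>j\<close> part of \<open>Tor\<^sub>n(k, M) = H\<^sub>n(F \<otimes> M)\<close>, for a graded
  free resolution \<open>F\<close> of \<open>k\<close>. Such an \<open>F\<close> exists (for instance the Koszul complex on the variables) and
  the homology does not depend on it. The graded pieces are finite-dimensional and the
  boundaries form a subspace of the cycles, so the dimension of the quotient is the difference.\<close>

definition tor_dim :: "nat \<Rightarrow> ('n::finite, 'k::field) mpoly set \<Rightarrow> int \<Rightarrow> nat" where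
  "tor_dim n M j =
     (let F = (SOME F :: ('n, 'k) free_complex. graded_free_resolution_of_field F)
      in vector_space.dim vec_scale (tensor_cycles F M n j) -
         vector_space.dim vec_scale (tensor_boundaries F M n j))"

text \<open>The homological position is that of \<open>R/I\<close>: \<open>i = 1\<close> counts minimal generators of \<open>I\<close>.\<close>

definition betti :: "nat \<Rightarrow> int \<Rightarrow> ('n::finite, 'k::field) mpoly set \<Rightarrow> nat" where
  "betti i j I = (if i = 0 then 0 else tor_dim (i - 1) I j)"

end

(*
  The symbolic power I(K_m)^(s) is spanned by the monomials x^a with |a| - a_i >= s for every i.
  Stratify these exponents by the set W of vanishing coordinates. For m = 4 the stratum W = {} is
  x1 x2 x3 x4 I(K_4)^(s-3), a stratum with |W| = 1 is a shift of I(K_3)^(s-2) over R/(x_q), and one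
  with |W| = 2 is a shift of R/(x_k, x_l) by 2s. The Betti numbers add up because every Koszul cycle
  of a stratum lifts to the union with the strata of smaller W: if i is the index of the largest
  exponent of a multidegree, T -> T + {i} is a contracting homotopy s, and z - s(d z) is a cycle
  lifting z whenever s(d z) stays in the symbolic power, which the maximality of i ensures.

  The same homotopy shows that the Koszul complex resolves k and that Tor_n of I(K_m)^(s) vanishes
  in degrees above 2s + n, which isolates the three special values. Since the Betti numbers are
  defined by an arbitrary resolution of k, they are moved to the Koszul complex by comparing
  resolutions; this also makes them independent of the order of the variables chosen for the signs.
*)
theory Submission
  imports Defs
begin

text \<open>The strata are differences of ideals, not ideals. Complexes are therefore built on
  arbitrary families of pairs (multidegree, subset), with the boundary tested only inside the
  family. Homology is never formed as a quotient: rank-nullity expresses its dimension by nullities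
  and numbers of basis elements. So it suffices that nullities add up, and for this every single
  cycle, not merely every class, has to lift.

  Origin of the constants: dividing a stratum by the product of its m = 4 - |W| nonvanishing
  variables lowers each exponent by 1 and the degree by m, so the bound s on |a| - a_i drops by m -
  1. This gives s - 3 with shift 4, and s - 2 with shift 3. A variable that kills a stratum tensors
  its Koszul complex with k(-1) -> k with zero map, hence the pair of terms at (i, j - 3) and (i -
  1, j - 4). A stratum on an edge is x^s y^s k[x,y]; its two killing variables give 1, 2, 1 in
  degrees 2s, 2s + 1, 2s + 2, and six edges give 6, 12, 6. Strata with |W| > 2 are empty.\<close>

abbreviation lookup :: "('a \<Rightarrow>\<^sub>0 'b::zero) \<Rightarrow> 'a \<Rightarrow> 'b" where
  "lookup \<equiv> Poly_Mapping.lookup"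

abbreviation keys :: "('a \<Rightarrow>\<^sub>0 'b::zero) \<Rightarrow> 'a set" where
  "keys \<equiv> Poly_Mapping.keys"

abbreviation single :: "'a \<Rightarrow> 'b \<Rightarrow> 'a \<Rightarrow>\<^sub>0 'b::zero" where
  "single \<equiv> Poly_Mapping.single"

section \<open>Dimensions of images and quotients\<close>

text \<open>The ambient function spaces are infinite-dimensional, and \<open>dim\<close> counts a
  basis by \<open>card\<close>, which is 0 on infinite sets. Finiteness is therefore a predicate on
  subsets, carried along as a hypothesis.\<close>

definition finite_dimensional :: "('a::field \<Rightarrow> 'b::ab_group_add \<Rightarrow> 'b) \<Rightarrow> 'b set \<Rightarrow> bool" where
  "finite_dimensional s U \<longleftrightarrow> (\<exists>W. finite W \<and> U \<subseteq> module.span s W)"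

context vector_space
begin

lemma finite_dimensional_subset: "finite_dimensional scale V \<Longrightarrow> U \<subseteq> V \<Longrightarrow> finite_dimensional scale U"
  unfolding finite_dimensional_def by blast

lemma finite_dimensional_basis:
  assumes "finite_dimensional scale U" "subspace U"
  obtains B where "finite B" "B \<subseteq> U" "independent B" "span B = U" "card B = dim U"
proof -
  obtain W where W: "finite W" "U \<subseteq> span W" using assms by (auto simp: finite_dimensional_def)
  obtain B where B: "B \<subseteq> U" "independent B" "U \<subseteq> span B" "card B = dim U"
    using basis_exists by blast
  have "finite B" using independent_span_bound[of W B] W B by auto
  moreover have "span B = U" using B assms(2) by (simp add: span_minimal subset_antisym)
  ultimately show ?thesis using B by (intro that[of B]) simp_all
qed

lemma finite_dimensional_basis_extend:
  assumes "finite_dimensional scale V" "subspace V" "subspace U" "U \<subseteq> V"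
  obtains B C where "finite C" "B \<subseteq> C" "C \<subseteq> V" "independent C" "span B = U" "span C = V"
    "card B = dim U" "card C = dim V"
proof -
  obtain B where B: "finite B" "B \<subseteq> U" "independent B" "span B = U" "card B = dim U"
    by (rule finite_dimensional_basis[OF finite_dimensional_subset[OF assms(1,4)] assms(3)])
  obtain C where C: "B \<subseteq> C" "C \<subseteq> V" "independent C" "V \<subseteq> span C"
    by (rule maximal_independent_subset_extend[of B V]) (use B assms in auto)
  obtain W where W: "finite W" "V \<subseteq> span W" using assms by (auto simp: finite_dimensional_def)
  have "finite C" using independent_span_bound[of W C] W C by auto
  moreover have "span C = V" using C assms by (simp add: span_minimal subset_antisym)
  moreover have "card C = dim V" using C basis_card_eq_dim by blast
  ultimately show ?thesis using B C by (intro that[of C B]) simp_all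
qed

lemma dim_mono_finite_dimensional:
  assumes "finite_dimensional scale V" "subspace V" "U \<subseteq> V"
  shows "dim U \<le> dim V"
proof -
  obtain B where B: "finite B" "B \<subseteq> V" "independent B" "span B = V" "card B = dim V"
    by (rule finite_dimensional_basis[OF assms(1,2)])
  then show ?thesis using dim_le_card[of U B] assms by auto
qed

text \<open>A substitute for the quotient V/U: the image of V under \<open>p\<close> is a copy of it
  that lives in the same type.\<close>

lemma complementary_projection:
  assumes "finite_dimensional scale V" "subspace V" "subspace U" "U \<subseteq> V"
  obtains p where "Vector_Spaces.linear scale scale p" "p ` V \<subseteq> V" "dim V = dim U + dim (p ` V)"
    "\<And>v. v \<in> V \<Longrightarrow> p v = 0 \<longleftrightarrow> v \<in> U"
proof -
  interpret vp: vector_space_pair scale scale by unfold_locales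
  obtain B C where BC: "finite C" "B \<subseteq> C" "C \<subseteq> V" "independent C" "span B = U" "span C = V"
    "card B = dim U" "card C = dim V"
    by (rule finite_dimensional_basis_extend[OF assms])
  \<comment> \<open>A basis of U is sent to 0 and the vectors that extend it to a basis of V are
    kept.\<close>
  define p where "p = vp.construct C (\<lambda>c. if c \<in> B then 0 else c)"
  have lin: "Vector_Spaces.linear scale scale p" unfolding p_def using BC by (intro vp.linear_construct)
  have pb: "p c = (if c \<in> B then 0 else c)" if "c \<in> C" for c
    unfolding p_def using vp.construct_basis[OF BC(4) that] by simp
  have p0: "p x = 0" if "x \<in> span B" for x
    by (rule vp.linear_eq_0_on_span[OF lin _ that]) (use pb BC(2) in auto)
  have linid: "Vector_Spaces.linear scale scale (\<lambda>x. x)" by (rule linear_ident)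
  have p1: "p x = x" if "x \<in> span (C - B)" for x
    by (rule vp.linear_eq_on[OF lin linid that]) (use pb in auto)
  have dec: "\<exists>u w. u \<in> span B \<and> w \<in> span (C - B) \<and> v = u + w" if "v \<in> V" for v
  proof -
    have "v \<in> span (B \<union> (C - B))" using that BC by (metis Un_Diff_cancel Un_absorb1)
    then show ?thesis unfolding span_Un by blast
  qed
  have pim: "p ` V = span (C - B)"
  proof
    show "p ` V \<subseteq> span (C - B)"
    proof
      fix y assume "y \<in> p ` V"
      then obtain x where x: "x \<in> V" "y = p x" by blast
      then obtain u w where uw: "u \<in> span B" "w \<in> span (C - B)" "x = u + w" using dec by blast
      then have "y = w" using x p0 p1 vp.linear_add[OF lin] by simp
      then show "y \<in> span (C - B)" using uw by simp
    qed
    show "span (C - B) \<subseteq> p ` V"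
    proof
      fix x assume x: "x \<in> span (C - B)"
      then have "x \<in> V" using BC(6) span_mono[of "C - B" C] by auto
      then show "x \<in> p ` V" using p1[OF x] by (metis image_eqI)
    qed
  qed
  have "independent (C - B)" using BC(4) independent_mono by blast
  then have "dim (p ` V) = card (C - B)" unfolding pim by (simp add: dim_eq_card_independent)
  moreover have "card (C - B) = card C - card B" using BC by (simp add: card_Diff_subset finite_subset)
  moreover have "card B \<le> card C" by (rule card_mono[OF BC(1,2)])
  ultimately have "dim V = dim U + dim (p ` V)" using BC by simp
  moreover have "p v = 0 \<longleftrightarrow> v \<in> U" if v: "v \<in> V" for v
  proof
    assume "p v = 0"
    obtain u w where uw: "u \<in> span B" "w \<in> span (C - B)" "v = u + w" using dec[OF v] by blast
    have "p v = w" using uw p0 p1 vp.linear_add[OF lin] by simp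
    then show "v \<in> U" using uw BC \<open>p v = 0\<close> by simp
  qed (use p0 BC in auto)
  moreover have "p ` V \<subseteq> V" using pim BC span_mono[of "C - B" C] by auto
  ultimately show ?thesis by (intro that[OF lin]) simp_all
qed

end

context vector_space_pair
begin

lemma finite_dimensional_image:
  assumes "Vector_Spaces.linear s1 s2 f" "finite_dimensional s1 U"
  shows "finite_dimensional s2 (f ` U)"
proof -
  obtain W where W: "finite W" "U \<subseteq> vs1.span W" using assms by (auto simp: finite_dimensional_def)
  then have "f ` U \<subseteq> vs2.span (f ` W)" using linear_span_image[OF assms(1)] by auto
  then show ?thesis using W unfolding finite_dimensional_def by blast
qed

lemma dim_image_inj:
  assumes "Vector_Spaces.linear s1 s2 f" "finite_dimensional s1 U" "vs1.subspace U"
    and "\<And>x. x \<in> U \<Longrightarrow> f x = 0 \<Longrightarrow> x = 0"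
  shows "vs2.dim (f ` U) = vs1.dim U"
proof -
  obtain B where B: "finite B" "B \<subseteq> U" "vs1.independent B" "vs1.span B = U" "card B = vs1.dim U"
    by (rule vs1.finite_dimensional_basis[OF assms(2,3)])
  have inj: "inj_on f (vs1.span B)"
    using linear_inj_on_iff_eq_0[OF assms(1) assms(3)] B(4) assms(4) by simp
  have "vs2.independent (f ` B)" using linear_independent_injective_image[OF assms(1) B(3) inj] .
  moreover have "vs2.span (f ` B) = f ` U" using linear_span_image[OF assms(1)] B by simp
  ultimately have "vs2.dim (f ` U) = card (f ` B)" by (metis vs2.dim_span vs2.dim_eq_card_independent)
  then show ?thesis using B inj by (metis card_image inj_on_subset vs1.span_superset)
qed

lemma rank_nullity:
  assumes "Vector_Spaces.linear s1 s2 f" "finite_dimensional s1 U" "vs1.subspace U"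
  shows "vs1.dim U = vs2.dim (f ` U) + vs1.dim {x \<in> U. f x = 0}"
proof -
  let ?K = "{x \<in> U. f x = 0}"
  have K: "vs1.subspace ?K"
    using vs1.subspace_inter[OF assms(3) linear_subspace_kernel[OF assms(1)]]
    by (simp add: Int_def)
  obtain B C where BC: "finite C" "B \<subseteq> C" "C \<subseteq> U" "vs1.independent C" "vs1.span B = ?K"
    "vs1.span C = U" "card B = vs1.dim ?K" "card C = vs1.dim U"
    by (rule vs1.finite_dimensional_basis_extend[OF assms(2,3) K]) simp_all
  \<comment> \<open>The vectors added to a basis of the kernel span a complement of it. The
    projection \<open>q\<close> onto this complement, introduced below, shows that the complement
    meets the kernel only in 0.\<close>
  let ?E = "vs1.span (C - B)"
  have EU: "?E \<subseteq> U" using BC(6) vs1.span_mono[of "C - B" C] by auto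
  interpret v11: vector_space_pair s1 s1 by unfold_locales
  obtain q where q: "Vector_Spaces.linear s1 s1 q" "\<forall>c\<in>C. q c = (if c \<in> B then 0 else c)"
    using v11.linear_independent_extend[OF BC(4), of "\<lambda>c. if c \<in> B then 0 else c"] by blast
  have q0: "q x = 0" if "x \<in> vs1.span B" for x
    by (rule v11.linear_eq_0_on_span[OF q(1) _ that]) (use q BC(2) in auto)
  have q1: "q x = x" if "x \<in> ?E" for x
    by (rule v11.linear_eq_on[OF q(1) vs1.linear_ident that]) (use q in auto)
  have ker: "x = 0" if "x \<in> ?E" "f x = 0" for x
  proof -
    have "x \<in> vs1.span B" using that EU BC(5) by auto
    then show ?thesis using q0 q1 that by metis
  qed
  have im: "f ` ?E = f ` U"
  proof
    show "f ` ?E \<subseteq> f ` U" using EU by auto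
    show "f ` U \<subseteq> f ` ?E"
    proof
      fix y assume "y \<in> f ` U"
      then obtain x where x: "x \<in> U" "y = f x" by blast
      have "x \<in> vs1.span (B \<union> (C - B))" using x BC by (metis Un_Diff_cancel Un_absorb1)
      then obtain u w where "u \<in> vs1.span B" "w \<in> ?E" "x = u + w" unfolding vs1.span_Un by blast
      moreover from this have "f u = 0" using BC(5) by auto
      ultimately show "y \<in> f ` ?E" using x linear_add[OF assms(1)] by auto
    qed
  qed
  have "finite_dimensional s1 ?E" using EU assms(2) vs1.finite_dimensional_subset by blast
  then have "vs2.dim (f ` ?E) = vs1.dim ?E"
    using dim_image_inj[OF assms(1) _ vs1.subspace_span] ker by blast
  moreover have "vs1.dim ?E = card (C - B)"
    using BC(4) vs1.independent_mono by (metis Diff_subset vs1.dim_span_eq_card_independent)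
  moreover have "card (C - B) = card C - card B" using BC by (simp add: card_Diff_subset finite_subset)
  moreover have "card B \<le> card C" by (rule card_mono[OF BC(1,2)])
  ultimately show ?thesis using BC im by simp
qed

text \<open>The last two hypotheses make \<open>f\<close> induce an injection Z1/B1 -> Z2/B2. With
  the second quotient modelled by a projection \<open>p\<close>, the kernel of \<open>p o f\<close>
  on Z1 is B1, and rank-nullity compares the dimensions.\<close>

lemma dim_quotient_le:
  assumes "Vector_Spaces.linear s1 s2 f"
    and "finite_dimensional s1 Z1" "vs1.subspace Z1" "vs1.subspace B1" "B1 \<subseteq> Z1"
    and "finite_dimensional s2 Z2" "vs2.subspace Z2" "vs2.subspace B2" "B2 \<subseteq> Z2"
    and "f ` Z1 \<subseteq> Z2" "\<And>z. z \<in> Z1 \<Longrightarrow> f z \<in> B2 \<longleftrightarrow> z \<in> B1"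
  shows "vs1.dim Z1 - vs1.dim B1 \<le> vs2.dim Z2 - vs2.dim B2"
proof -
  interpret v22: vector_space_pair s2 s2 by unfold_locales
  obtain p where p: "Vector_Spaces.linear s2 s2 p" "vs2.dim Z2 = vs2.dim B2 + vs2.dim (p ` Z2)"
    "\<And>v. v \<in> Z2 \<Longrightarrow> p v = 0 \<longleftrightarrow> v \<in> B2"
    by (rule vs2.complementary_projection[OF assms(6-9)]) blast
  have lin: "Vector_Spaces.linear s1 s2 (p \<circ> f)" using assms(1) p(1) by (rule Vector_Spaces.linear_compose)
  have "{x \<in> Z1. (p \<circ> f) x = 0} = B1" using p(3) assms(5,10,11) by auto
  then have "vs1.dim Z1 = vs2.dim ((p \<circ> f) ` Z1) + vs1.dim B1"
    using rank_nullity[OF lin assms(2,3)] by simp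
  moreover have "vs2.dim ((p \<circ> f) ` Z1) \<le> vs2.dim (p ` Z2)"
    using assms(10) by (intro vs2.dim_mono_finite_dimensional v22.finite_dimensional_image[OF p(1)]
        assms v22.linear_subspace_image[OF p(1)]) auto
  ultimately show ?thesis using p(2) by simp
qed

end

section \<open>Graded free resolutions of the residue field\<close>

lemma module_ring: "module ((*) :: 'a::comm_ring_1 \<Rightarrow> 'a \<Rightarrow> 'a)"
  by unfold_locales (auto simp: algebra_simps)

lemma is_ideal_iff:
  "is_ideal (I :: 'a::comm_ring_1 set) \<longleftrightarrow>
    0 \<in> I \<and> (\<forall>x\<in>I. \<forall>y\<in>I. x + y \<in> I) \<and> (\<forall>c. \<forall>x\<in>I. c * x \<in> I)"
  unfolding is_ideal_def module.subspace_def[OF module_ring] by blast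

lemma is_ideal_UNIV: "is_ideal UNIV"
  by (simp add: is_ideal_iff)

lemma is_ideal_sum: "is_ideal I \<Longrightarrow> (\<And>x. x \<in> A \<Longrightarrow> f x \<in> I) \<Longrightarrow> sum f A \<in> I"
  by (induction A rule: infinite_finite_induct) (auto simp: is_ideal_iff)

lemma is_ideal_ideal_gen: "is_ideal (ideal_gen B)"
  unfolding is_ideal_def ideal_gen_def by (rule module.subspace_span[OF module_ring])

lemma ideal_gen_superset: "B \<subseteq> ideal_gen B"
  unfolding ideal_gen_def by (rule module.span_superset[OF module_ring])

lemma ideal_gen_minimal: "B \<subseteq> I \<Longrightarrow> is_ideal I \<Longrightarrow> ideal_gen B \<subseteq> I"
  unfolding is_ideal_def ideal_gen_def by (rule module.span_minimal[OF module_ring])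

definition monomial_degree :: "('n::finite \<Rightarrow>\<^sub>0 nat) \<Rightarrow> nat" where
  "monomial_degree t = (\<Sum>i\<in>UNIV. lookup t i)"

lemma monomial_degree_add: "monomial_degree (t + u) = monomial_degree t + monomial_degree u"
  by (simp add: monomial_degree_def lookup_add sum.distrib)

lemma monomial_degree_zero [simp]: "monomial_degree 0 = 0"
  by (simp add: monomial_degree_def)

lemma monomial_degree_single [simp]: "monomial_degree (single i c) = c"
  by (simp add: monomial_degree_def lookup_single when_def)

lemma lookup_le_monomial_degree: "lookup t i \<le> monomial_degree t"
  unfolding monomial_degree_def by (rule member_le_sum) auto

lemma homogeneous_iff:
  "homogeneous d f \<longleftrightarrow> (\<forall>t \<in> keys f. int (monomial_degree t) = d)"
  by (simp add: homogeneous_def monomial_degree_def)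

lemma finite_monomial_degree: "finite {t :: 'n::finite \<Rightarrow>\<^sub>0 nat. int (monomial_degree t) = d}"
proof -
  have "finite {f :: 'n \<Rightarrow> nat. \<forall>i. f i \<in> {..nat d}}"
    using finite_set_of_finite_funs[of "UNIV :: 'n set" "{..nat d}" 0] by simp
  moreover have "lookup ` {t :: 'n \<Rightarrow>\<^sub>0 nat. int (monomial_degree t) = d}
      \<subseteq> {f. \<forall>i. f i \<in> {..nat d}}"
  proof clarsimp
    fix t :: "'n \<Rightarrow>\<^sub>0 nat" and i
    show "lookup t i \<le> monomial_degree t" by (rule lookup_le_monomial_degree)
  qed
  ultimately have "finite (lookup ` {t :: 'n \<Rightarrow>\<^sub>0 nat. int (monomial_degree t) = d})"
    using finite_subset by blast
  then show ?thesis by (rule finite_imageD) (auto simp: inj_on_def poly_mapping_eqI)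
qed

lemma homogeneous_zero [simp]: "homogeneous d 0"
  by (simp add: homogeneous_iff)

lemma homogeneous_one [simp]: "homogeneous 0 1"
  by (auto simp: homogeneous_iff)

lemma homogeneous_add: "homogeneous d f \<Longrightarrow> homogeneous d g \<Longrightarrow> homogeneous d (f + g)"
  using keys_add[of f g] by (auto simp: homogeneous_iff)

lemma homogeneous_uminus: "homogeneous d f \<Longrightarrow> homogeneous d (- f)"
  by (simp add: homogeneous_iff in_keys_iff)

lemma homogeneous_diff: "homogeneous d f \<Longrightarrow> homogeneous d g \<Longrightarrow> homogeneous d (f - g)"
  using homogeneous_add[of d f "- g"] homogeneous_uminus by auto

lemma homogeneous_sum: "(\<And>x. x \<in> A \<Longrightarrow> homogeneous d (f x)) \<Longrightarrow> homogeneous d (sum f A)"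
  by (induction A rule: infinite_finite_induct) (auto intro: homogeneous_add)

lemma homogeneous_mult: "homogeneous d f \<Longrightarrow> homogeneous e g \<Longrightarrow> homogeneous (d + e) (f * g)"
  using keys_mult[of f g] by (fastforce simp: homogeneous_iff monomial_degree_add)

lemma homogeneous_Const [simp]: "homogeneous 0 (Const c)"
  by (auto simp: homogeneous_iff Const_def)

lemma const_coeff_add: "const_coeff (f + g) = const_coeff f + const_coeff g"
  by (simp add: const_coeff_def lookup_add)

text \<open>Exponents are natural numbers, so the trivial monomial factors only trivially. This
  makes the augmentation linear over the polynomial ring, the variables acting as zero on k.\<close>

lemma const_coeff_mult: "const_coeff (f * g) = const_coeff f * const_coeff (g :: ('n, 'k::field) mpoly)"
proof -
  have eq: "(0 :: 'n \<Rightarrow>\<^sub>0 nat) = l + q \<longleftrightarrow> l = 0 \<and> q = 0" for l q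
    by (auto simp: poly_mapping_eq_iff fun_eq_iff lookup_add)
  have "(\<Sum>q. lookup g q when 0 = l + q) = (lookup g 0 when l = 0)" for l
  proof (cases "l = 0")
    case True
    then have "(\<lambda>q. lookup g q when 0 = l + q) = (\<lambda>q. lookup g q when q = 0)"
      by (auto simp: fun_eq_iff when_def)
    then show ?thesis using True by (simp add: Sum_any_when_equal)
  next
    case False
    then show ?thesis unfolding eq by simp
  qed
  then show ?thesis
    by (simp add: const_coeff_def lookup_mult mult_when Sum_any_when_equal)
qed

lemma const_coeff_Const [simp]: "const_coeff (Const c) = c"
  by (simp add: const_coeff_def Const_def)

lemma Const_mult: "Const (c * d) = Const c * Const d"
  by (simp add: Const_def mult_single)

lemma Const_add: "Const (c + d) = Const c + Const d"
  by (simp add: Const_def single_add)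

lemma Const_one [simp]: "Const 1 = 1"
  by (simp add: Const_def)

definition homogeneous_part :: "int \<Rightarrow> ('n::finite, 'k::field) mpoly \<Rightarrow> ('n, 'k) mpoly" where
  "homogeneous_part d f = Poly_Mapping.mapp (\<lambda>t c. if int (monomial_degree t) = d then c else 0) f"

lemma lookup_homogeneous_part:
  "lookup (homogeneous_part d f) t =
    (if int (monomial_degree t) = d then lookup f t else 0)"
  by (simp add: homogeneous_part_def lookup_mapp when_def in_keys_iff)

lemma homogeneous_homogeneous_part: "homogeneous d (homogeneous_part d f)"
  by (auto simp: homogeneous_iff in_keys_iff lookup_homogeneous_part split: if_splits)

lemma homogeneous_part_id: "homogeneous d f \<Longrightarrow> homogeneous_part d f = f"
  by (rule poly_mapping_eqI) (auto simp: homogeneous_iff in_keys_iff lookup_homogeneous_part)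

lemma homogeneous_part_add: "homogeneous_part d (f + g) = homogeneous_part d f + homogeneous_part d g"
  by (rule poly_mapping_eqI) (simp add: lookup_homogeneous_part lookup_add)

lemma homogeneous_part_zero [simp]: "homogeneous_part d 0 = 0"
  by (rule poly_mapping_eqI) (simp add: lookup_homogeneous_part)

lemma homogeneous_part_sum: "homogeneous_part d (sum f A) = (\<Sum>x\<in>A. homogeneous_part d (f x))"
  by (induction A rule: infinite_finite_induct) (auto simp: homogeneous_part_add)

text \<open>Needed to replace an arbitrary preimage under a homogeneous matrix by a homogeneous
  one.\<close>

lemma homogeneous_part_mult:
  assumes "homogeneous d m"
  shows "homogeneous_part e (m * f) = m * homogeneous_part (e - d) f"
proof -
  \<comment> \<open>The components of \<open>f\<close> outside degree e - d; multiplied by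
    \<open>m\<close> they miss degree e.\<close>
  define g where "g = f - homogeneous_part (e - d) f"
  have f: "f = homogeneous_part (e - d) f + g" by (simp add: g_def)
  have "homogeneous_part e (m * homogeneous_part (e - d) f) = m * homogeneous_part (e - d) f"
    using homogeneous_mult[OF assms homogeneous_homogeneous_part, of "e - d" f]
    by (simp add: homogeneous_part_id)
  moreover have "homogeneous_part e (m * g) = 0"
  proof (rule poly_mapping_eqI)
    fix t
    have "t \<notin> keys (m * g)" if "int (monomial_degree t) = e"
    proof
      assume "t \<in> keys (m * g)"
      then obtain u v where uv: "u \<in> keys m" "v \<in> keys g" "t = u + v"
        using keys_mult[of m g] by blast
      then have "int (monomial_degree v) = e - d"
        using assms that by (auto simp: homogeneous_iff monomial_degree_add)
      then show False
        using uv by (simp add: in_keys_iff g_def lookup_minus lookup_homogeneous_part)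
    qed
    then show "lookup (homogeneous_part e (m * g)) t = lookup 0 t"
      by (simp add: lookup_homogeneous_part in_keys_iff)
  qed
  ultimately show ?thesis
    by (subst f) (simp only: distrib_left homogeneous_part_add add_0_right)
qed

lemma const_coeff_homogeneous_part: "const_coeff (homogeneous_part 0 f) = const_coeff f"
  by (simp add: const_coeff_def lookup_homogeneous_part)

section \<open>Linear maps between graded free modules\<close>

type_synonym ('n, 'k) vect = "nat \<Rightarrow> ('n, 'k) mpoly"

definition smul :: "('n, 'k::field) mpoly \<Rightarrow> ('n, 'k) vect \<Rightarrow> ('n, 'k) vect" where
  "smul c v = (\<lambda>b. c * v b)"

definition unit_vec :: "nat \<Rightarrow> ('n, 'k::field) vect" where
  "unit_vec b = (\<lambda>x. if x = b then 1 else 0)"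

text \<open>Linearity is required on all vectors, not only on those of a free module, so composing
  maps needs no membership conditions. \<open>ring_linear_extend\<close> supplies such maps by
  ignoring the coordinates beyond the rank.\<close>

definition ring_linear :: "(('n, 'k::field) vect \<Rightarrow> ('n, 'k) vect) \<Rightarrow> bool" where
  "ring_linear f \<longleftrightarrow> (\<forall>u v. f (u + v) = f u + f v) \<and> (\<forall>c v. f (smul c v) = smul c (f v))"

lemma ring_linear_zero: "ring_linear f \<Longrightarrow> f 0 = 0"
  unfolding ring_linear_def by (metis add_cancel_right_right)

lemma ring_linear_sum: "ring_linear f \<Longrightarrow> f (sum g A) = (\<Sum>x\<in>A. f (g x))"
  by (induction A rule: infinite_finite_induct) (auto simp: ring_linear_zero, auto simp: ring_linear_def)

lemma sum_fun_apply: "(\<Sum>x\<in>A. f x) y = (\<Sum>x\<in>A. f x y)"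
  by (induction A rule: infinite_finite_induct) auto

lemma free_module_expand:
  assumes "v \<in> free_module F n"
  shows "v = (\<Sum>b<rank F n. smul (v b) (unit_vec b))"
proof
  fix x
  show "v x = (\<Sum>b<rank F n. smul (v b) (unit_vec b)) x"
  proof (cases "x < rank F n")
    case True
    then show ?thesis
      by (simp add: sum_fun_apply smul_def unit_vec_def if_distrib[of "\<lambda>y. _ * y"] cong: if_cong)
  next
    case False
    then show ?thesis using assms
      by (auto simp: sum_fun_apply smul_def unit_vec_def free_module_def intro!: sum.neutral)
  qed
qed

lemma ring_linear_expand:
  assumes "ring_linear f" "v \<in> free_module F n"
  shows "f v = (\<Sum>b<rank F n. smul (v b) (f (unit_vec b)))"
proof -
  have "f v = f (\<Sum>b<rank F n. smul (v b) (unit_vec b))"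
    using free_module_expand[OF assms(2)] by simp
  also have "\<dots> = (\<Sum>b<rank F n. f (smul (v b) (unit_vec b)))" by (rule ring_linear_sum[OF assms(1)])
  finally show ?thesis using assms(1) by (simp add: ring_linear_def)
qed

lemma ring_linear_eqI:
  assumes "ring_linear f" "ring_linear g" "\<And>b. b < rank F n \<Longrightarrow> f (unit_vec b) = g (unit_vec b)"
    and "v \<in> free_module F n"
  shows "f v = g v"
  using ring_linear_expand[OF assms(1,4)] ring_linear_expand[OF assms(2,4)] assms(3) by simp

lemma ring_linear_compose: "ring_linear f \<Longrightarrow> ring_linear g \<Longrightarrow> ring_linear (f \<circ> g)"
  by (simp add: ring_linear_def)

lemma ring_linear_diff: "ring_linear f \<Longrightarrow> ring_linear g \<Longrightarrow> ring_linear (f - g)"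
  by (simp add: ring_linear_def smul_def fun_eq_iff algebra_simps)

lemma ring_linear_differential: "ring_linear (differential F n)"
  unfolding ring_linear_def differential_def smul_def
  by (auto simp: fun_eq_iff algebra_simps sum.distrib sum_distrib_left)

lemma unit_vec_free_module: "b < rank F n \<Longrightarrow> unit_vec b \<in> free_module F n"
  by (auto simp: unit_vec_def free_module_def)

lemma unit_vec_tensor_piece: "b < rank F n \<Longrightarrow> unit_vec b \<in> tensor_piece F UNIV n (shift F n b)"
  by (auto simp: unit_vec_def free_module_def tensor_piece_def)

lemma ring_linear_extend:
  fixes c :: "nat \<Rightarrow> ('n, 'k::field) vect"
  obtains f where "ring_linear f" "\<And>b. b < r \<Longrightarrow> f (unit_vec b) = c b"
proof
  let ?f = "\<lambda>v a. \<Sum>b<r. v b * c b a"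
  show "ring_linear ?f"
    unfolding ring_linear_def smul_def
    by (auto simp: fun_eq_iff algebra_simps sum.distrib sum_distrib_left)
  show "?f (unit_vec b) = c b" if "b < r" for b
    using that by (simp add: unit_vec_def fun_eq_iff if_distrib[of "\<lambda>y. y * _"] cong: if_cong)
qed

lemma tensor_piece_zero: "is_ideal M \<Longrightarrow> 0 \<in> tensor_piece F M n j"
  by (auto simp: tensor_piece_def free_module_def is_ideal_iff)

lemma tensor_piece_add:
  "is_ideal M \<Longrightarrow> u \<in> tensor_piece F M n j \<Longrightarrow> v \<in> tensor_piece F M n j \<Longrightarrow> u + v \<in> tensor_piece F M n j"
  by (auto simp: tensor_piece_def free_module_def is_ideal_iff homogeneous_add)

lemma tensor_piece_sum:
  "is_ideal M \<Longrightarrow> (\<And>x. x \<in> A \<Longrightarrow> f x \<in> tensor_piece F M n j) \<Longrightarrow> sum f A \<in> tensor_piece F M n j"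
  by (induction A rule: infinite_finite_induct) (auto intro: tensor_piece_zero tensor_piece_add)

lemma tensor_piece_diff:
  assumes "is_ideal M" "u \<in> tensor_piece F M n j" "v \<in> tensor_piece F M n j"
  shows "u - v \<in> tensor_piece F M n j"
proof -
  have "- x \<in> M" if "x \<in> M" for x
    using assms(1) that unfolding is_ideal_iff by (metis mult_minus1)
  then have "x - y \<in> M" if "x \<in> M" "y \<in> M" for x y
    using assms(1) that unfolding is_ideal_iff by (metis diff_conv_add_uminus)
  then show ?thesis using assms
    by (auto simp: tensor_piece_def free_module_def homogeneous_diff)
qed

lemma tensor_piece_smul:
  assumes "is_ideal M" "c \<in> M" "homogeneous (j - d) c" "v \<in> tensor_piece F UNIV n d"
  shows "smul c v \<in> tensor_piece F M n j"
proof -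
  have "homogeneous (j - shift F n b) (c * v b)" if "b < rank F n" for b
    using homogeneous_mult[OF assms(3), of "d - shift F n b" "v b"] assms(4) that
    by (auto simp: tensor_piece_def)
  moreover have "c * x \<in> M" for x
    using assms(1,2) unfolding is_ideal_iff by (metis mult.commute)
  ultimately show ?thesis using assms
    by (auto simp: tensor_piece_def free_module_def smul_def)
qed

lemma tensor_piece_Const:
  assumes "is_ideal M" "v \<in> tensor_piece F M n j"
  shows "smul (Const c) v \<in> tensor_piece F M n j"
proof -
  have "homogeneous (j - shift F n b) (Const c * v b)" if "b < rank F n" for b
    using homogeneous_mult[OF homogeneous_Const, of "j - shift F n b" "v b" c] assms(2) that
    by (auto simp: tensor_piece_def)
  then show ?thesis using assms
    by (auto simp: tensor_piece_def free_module_def smul_def is_ideal_iff)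
qed

lemma tensor_piece_free_module: "tensor_piece F M n j \<subseteq> free_module F n"
  by (auto simp: tensor_piece_def)

definition graded_map ::
  "('n::finite, 'k::field) free_complex \<Rightarrow> nat \<Rightarrow> ('n, 'k) free_complex \<Rightarrow> nat \<Rightarrow>
    (('n, 'k) vect \<Rightarrow> ('n, 'k) vect) \<Rightarrow> bool" where
  "graded_map F n G m f \<longleftrightarrow>
    ring_linear f \<and> (\<forall>b<rank F n. f (unit_vec b) \<in> tensor_piece G UNIV m (shift F n b))"

text \<open>The map on F tensor M is given by the same homogeneous matrix, and an ideal absorbs the
  matrix entries. Hence a condition on unit vectors alone controls every M and every degree.\<close>

lemma graded_map_tensor_piece:
  assumes "graded_map F n G m f" "is_ideal M" "v \<in> tensor_piece F M n j"
  shows "f v \<in> tensor_piece G M m j"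
proof -
  have "f v = (\<Sum>b<rank F n. smul (v b) (f (unit_vec b)))"
    using assms tensor_piece_free_module[of F M n j] by (intro ring_linear_expand) (auto simp: graded_map_def)
  also have "\<dots> \<in> tensor_piece G M m j"
    using assms by (intro tensor_piece_sum tensor_piece_smul) (auto simp: graded_map_def tensor_piece_def)
  finally show ?thesis .
qed

lemma graded_map_free_module:
  assumes "graded_map F n G m f" "v \<in> free_module F n"
  shows "f v \<in> free_module G m"
proof -
  have "f v = (\<Sum>b<rank F n. smul (v b) (f (unit_vec b)))"
    using assms by (intro ring_linear_expand) (auto simp: graded_map_def)
  moreover have "f (unit_vec b) \<in> free_module G m" if "b < rank F n" for b
    using assms(1) that by (auto simp: graded_map_def tensor_piece_def)
  ultimately show ?thesis
    by (auto simp: free_module_def sum_fun_apply smul_def intro!: sum.neutral)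
qed

lemma graded_map_compose:
  assumes "graded_map F n G m f" "graded_map G m H l g"
  shows "graded_map F n H l (g \<circ> f)"
  using assms graded_map_tensor_piece[OF assms(2) is_ideal_UNIV]
  by (auto simp: graded_map_def ring_linear_def)

lemma graded_map_diff:
  "graded_map F n G m f \<Longrightarrow> graded_map F n G m g \<Longrightarrow> graded_map F n G m (f - g)"
  by (auto simp: graded_map_def ring_linear_diff intro!: tensor_piece_diff is_ideal_UNIV)

lemma graded_map_id: "graded_map F n F n (\<lambda>v. v)"
  by (auto simp: graded_map_def ring_linear_def unit_vec_tensor_piece)

lemma augmentation_add: "augmentation F (u + v) = augmentation F u + augmentation F v"
  by (simp add: augmentation_def const_coeff_add algebra_simps sum.distrib)

lemma augmentation_smul: "augmentation F (smul c v) = const_coeff c * augmentation F v"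
  by (simp add: augmentation_def smul_def const_coeff_mult sum_distrib_left algebra_simps)

lemma augmentation_zero [simp]: "augmentation F 0 = 0"
  by (simp add: augmentation_def const_coeff_def)

lemma augmentation_diff: "augmentation F (u - v) = augmentation F u - augmentation F v"
  using augmentation_add[of F "u - v" v] by simp

lemma augmentation_sum:
  fixes f :: "'b \<Rightarrow> ('n::finite, 'k::field) vect"
  shows "augmentation F (sum f A) = (\<Sum>x\<in>A. augmentation F (f x))"
  using sum_comp_morphism[of "augmentation F" f A, OF augmentation_zero augmentation_add]
  by (simp add: o_def)

section \<open>Lifting through an exact complex\<close>

context
  fixes F :: "('n::finite, 'k::field) free_complex"
  assumes F: "graded_free_resolution_of_field F"
begin

lemma resolution_graded_differential: "graded_map F (Suc n) F n (differential F (Suc n))"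
proof -
  have "differential F (Suc n) (unit_vec b) = (\<lambda>a. mat F (Suc n) a b)" if "b < rank F (Suc n)" for b
    using that by (simp add: differential_def unit_vec_def fun_eq_iff if_distrib[of "\<lambda>y. _ * y"] cong: if_cong)
  moreover have "homogeneous (shift F (Suc n) b - shift F n a) (mat F (Suc n) a b)"
    if "b < rank F (Suc n)" "a < rank F n" for a b
    using F that unfolding graded_free_resolution_of_field_def by (metis diff_Suc_1 zero_less_Suc)
  moreover have "mat F (Suc n) a b = 0" if "b < rank F (Suc n)" "a \<ge> rank F n" for a b
    using F that unfolding graded_free_resolution_of_field_def by (metis diff_Suc_1 zero_less_Suc)
  ultimately show ?thesis
    by (auto simp: graded_map_def ring_linear_differential tensor_piece_def free_module_def)
qed

text \<open>\<open>differential F 0\<close> is zero, so at position 0 the augmentation has to take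
  its place. With this convention exactness is one statement for all positions.\<close>

definition augmented_cycle :: "nat \<Rightarrow> ('n, 'k) vect \<Rightarrow> bool" where
  "augmented_cycle n v \<longleftrightarrow> (if n = 0 then augmentation F v = 0 else differential F n v = 0)"

lemma augmented_cycle_iff:
  "v \<in> free_module F n \<Longrightarrow> augmented_cycle n v \<longleftrightarrow> v \<in> differential F (Suc n) ` free_module F (Suc n)"
proof (cases "n = 0")
  case True
  have "{v \<in> free_module F 0. augmentation F v = 0} = differential F 1 ` free_module F 1"
    using F by (simp only: graded_free_resolution_of_field_def)
  then show "v \<in> free_module F n \<Longrightarrow> ?thesis" using True by (auto simp: augmented_cycle_def)
next
  case False
  then have "{v \<in> free_module F n. differential F n v = 0} = differential F (Suc n) ` free_module F (Suc n)"
    using F by (simp only: graded_free_resolution_of_field_def)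
  then show "v \<in> free_module F n \<Longrightarrow> ?thesis" using False by (auto simp: augmented_cycle_def)
qed

lemma augmented_cycle_differential:
  "v \<in> free_module F (Suc n) \<Longrightarrow> augmented_cycle n (differential F (Suc n) v)"
  using augmented_cycle_iff graded_map_free_module[OF resolution_graded_differential] by blast

text \<open>Exactness gives some preimage. Since the matrix is homogeneous, cutting each coordinate
  down to the degree matching d leaves the image unchanged.\<close>

lemma resolution_lift:
  assumes "w \<in> tensor_piece F UNIV n d" "augmented_cycle n w"
  obtains u where "u \<in> tensor_piece F UNIV (Suc n) d" "differential F (Suc n) u = w"
proof -
  have w: "w \<in> free_module F n" using assms(1) by (auto simp: tensor_piece_def)
  then obtain u where u: "u \<in> free_module F (Suc n)" "w = differential F (Suc n) u"
    using augmented_cycle_iff assms(2) by blast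
  let ?u = "\<lambda>b. homogeneous_part (d - shift F (Suc n) b) (u b)"
  have uf: "?u \<in> tensor_piece F UNIV (Suc n) d"
    using u(1) by (auto simp: tensor_piece_def free_module_def homogeneous_homogeneous_part)
  have "differential F (Suc n) ?u a = w a" for a
  proof (cases "a < rank F n")
    case True
    have "mat F (Suc n) a b * ?u b = homogeneous_part (d - shift F n a) (mat F (Suc n) a b * u b)"
      if "b < rank F (Suc n)" for b
    proof -
      have "homogeneous (shift F (Suc n) b - shift F n a) (mat F (Suc n) a b)"
        using F that True unfolding graded_free_resolution_of_field_def by (metis diff_Suc_1 zero_less_Suc)
      from homogeneous_part_mult[OF this, of "d - shift F n a" "u b"] show ?thesis by simp
    qed
    then have "differential F (Suc n) ?u a = homogeneous_part (d - shift F n a) (w a)"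
      by (simp add: u(2) differential_def homogeneous_part_sum)
    also have "\<dots> = w a"
      using assms(1) True by (intro homogeneous_part_id) (auto simp: tensor_piece_def)
    finally show ?thesis .
  next
    case False
    moreover have "differential F (Suc n) ?u \<in> free_module F n"
      using graded_map_free_module[OF resolution_graded_differential] uf tensor_piece_free_module by blast
    ultimately show ?thesis using w by (simp add: free_module_def)
  qed
  then show ?thesis using that[OF uf] by blast
qed

text \<open>Graded projectivity of free modules: lift the images of the basis elements and extend
  linearly. Both chain maps and homotopies are produced by this one step.\<close>

lemma graded_map_lift:
  fixes G :: "('n, 'k) free_complex"
  assumes "graded_map G m F n f" "\<And>v. v \<in> free_module G m \<Longrightarrow> augmented_cycle n (f v)"
  obtains g where "graded_map G m F (Suc n) g"
    "\<And>v. v \<in> free_module G m \<Longrightarrow> differential F (Suc n) (g v) = f v"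
proof -
  have "\<exists>u. u \<in> tensor_piece F UNIV (Suc n) (shift G m b) \<and> differential F (Suc n) u = f (unit_vec b)"
    if "b < rank G m" for b
  proof -
    have "f (unit_vec b) \<in> tensor_piece F UNIV n (shift G m b)"
      using assms(1) that by (simp add: graded_map_def)
    from resolution_lift[OF this assms(2)[OF unit_vec_free_module[OF that]]] show ?thesis by blast
  qed
  then obtain c where c: "\<And>b. b < rank G m \<Longrightarrow> c b \<in> tensor_piece F UNIV (Suc n) (shift G m b)"
    "\<And>b. b < rank G m \<Longrightarrow> differential F (Suc n) (c b) = f (unit_vec b)" by metis
  obtain g where g: "ring_linear g" "\<And>b. b < rank G m \<Longrightarrow> g (unit_vec b) = c b"
    using ring_linear_extend[of "rank G m" c] by blast
  have d: "(differential F (Suc n) \<circ> g) v = f v" if "v \<in> free_module G m" for v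
    by (rule ring_linear_eqI[OF ring_linear_compose[OF ring_linear_differential g(1)] _ _ that])
      (use assms(1) g c in \<open>auto simp: graded_map_def\<close>)
  show ?thesis
  proof (rule that[of g])
    show "graded_map G m F (Suc n) g" using g c(1) by (simp add: graded_map_def)
    show "differential F (Suc n) (g v) = f v" if "v \<in> free_module G m" for v
      using d[OF that] by simp
  qed
qed

lemma augmentation_unit_vec: "b < rank F 0 \<Longrightarrow> augmentation F (unit_vec b) = aug F b"
proof -
  have "const_coeff (1 :: ('n, 'k) mpoly) = 1" using const_coeff_Const[of 1] by simp
  moreover have "const_coeff (0 :: ('n, 'k) mpoly) = 0" by (simp add: const_coeff_def)
  ultimately show "b < rank F 0 \<Longrightarrow> augmentation F (unit_vec b) = aug F b"
    by (simp add: augmentation_def unit_vec_def if_distrib[of const_coeff] if_distrib[of "\<lambda>y. y * _"] cong: if_cong)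
qed

lemma augmentation_expand:
  "v \<in> free_module F 0 \<Longrightarrow> augmentation F v = (\<Sum>b<rank F 0. const_coeff (v b) * augmentation F (unit_vec b))"
  by (simp add: augmentation_unit_vec) (simp add: augmentation_def)

text \<open>A generator with nonzero augmentation has shift 0, so only constant terms at such
  generators matter. Passing to homogeneous parts keeps these terms exactly when d is 0, which the
  hypothesis grants unless c is 0.\<close>

lemma augmentation_lift:
  assumes "c \<noteq> 0 \<longrightarrow> d = 0"
  obtains u where "u \<in> tensor_piece F UNIV 0 d" "augmentation F u = c"
proof (cases "c = 0")
  case True
  show ?thesis
    by (rule that[of 0]) (simp_all only: tensor_piece_zero[OF is_ideal_UNIV] augmentation_zero True)
next
  case False
  have "augmentation F ` free_module F 0 = UNIV"
    using F by (simp add: graded_free_resolution_of_field_def)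
  then obtain u where u: "u \<in> free_module F 0" "augmentation F u = c" by (metis UNIV_I imageE)
  let ?u = "\<lambda>b. homogeneous_part (- shift F 0 b) (u b)"
  have "?u \<in> tensor_piece F UNIV 0 d"
    using u(1) False assms by (auto simp: tensor_piece_def free_module_def homogeneous_homogeneous_part)
  moreover have "const_coeff (?u b) * aug F b = const_coeff (u b) * aug F b" if "b < rank F 0" for b
  proof (cases "aug F b = 0")
    case False
    then have "shift F 0 b = 0" using F that by (auto simp: graded_free_resolution_of_field_def)
    then show ?thesis by (simp add: const_coeff_homogeneous_part)
  qed auto
  then have "augmentation F ?u = c" unfolding u(2)[symmetric] augmentation_def by (intro sum.cong) auto
  ultimately show ?thesis using that by blast
qed

end

text \<open>The comparison theorem for the identity of k, by dependent choice along the
  resolution.\<close>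

lemma chain_map_exists:
  fixes F G :: "('n::finite, 'k::field) free_complex"
  assumes F: "graded_free_resolution_of_field F" and G: "graded_free_resolution_of_field G"
  obtains f where "\<And>n. graded_map F n G n (f n)"
    "\<And>n v. v \<in> free_module F (Suc n) \<Longrightarrow> differential G (Suc n) (f (Suc n) v) = f n (differential F (Suc n) v)"
    "\<And>v. v \<in> free_module F 0 \<Longrightarrow> augmentation G (f 0 v) = augmentation F v"
proof -
  \<comment> \<open>The invariant records that boundaries are sent to augmented cycles: this is the
    condition under which the next component can be lifted. \<open>?Q\<close> is the chain map
    equation linking consecutive choices.\<close>
  let ?P = "\<lambda>n f. graded_map F n G n f \<and>
    (\<forall>v\<in>free_module F (Suc n). augmented_cycle G n (f (differential F (Suc n) v))) \<and>
    (n = 0 \<longrightarrow> (\<forall>v\<in>free_module F 0. augmentation G (f v) = augmentation F v))"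
  let ?Q = "\<lambda>n f f'. \<forall>v\<in>free_module F (Suc n). differential G (Suc n) (f' v) = f (differential F (Suc n) v)"
  note dF = resolution_graded_differential[OF F]
  have "\<exists>f. ?P 0 f"
  proof -
    have "\<exists>u. u \<in> tensor_piece G UNIV 0 (shift F 0 b) \<and> augmentation G u = aug F b" if "b < rank F 0" for b
    proof -
      have "aug F b \<noteq> 0 \<longrightarrow> shift F 0 b = 0" using F that by (auto simp: graded_free_resolution_of_field_def)
      from augmentation_lift[OF G this] show ?thesis by blast
    qed
    then obtain c where c: "\<And>b. b < rank F 0 \<Longrightarrow> c b \<in> tensor_piece G UNIV 0 (shift F 0 b)"
      "\<And>b. b < rank F 0 \<Longrightarrow> augmentation G (c b) = aug F b" by metis
    obtain f where f: "ring_linear f" "\<And>b. b < rank F 0 \<Longrightarrow> f (unit_vec b) = c b"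
      using ring_linear_extend[of "rank F 0" c] by blast
    have gr: "graded_map F 0 G 0 f" using f c by (simp add: graded_map_def)
    have au: "augmentation G (f v) = augmentation F v" if "v \<in> free_module F 0" for v
      using ring_linear_expand[OF f(1) that] augmentation_expand[OF F that] f(2) c(2)
      by (simp add: augmentation_sum augmentation_smul augmentation_unit_vec[OF F])
    have "augmentation F (differential F (Suc 0) v) = 0" if "v \<in> free_module F (Suc 0)" for v
      using augmented_cycle_differential[OF F that] by (simp add: augmented_cycle_def[OF F])
    then show ?thesis
      using gr au graded_map_free_module[OF dF] by (auto simp: augmented_cycle_def[OF G] intro!: exI[of _ f])
  qed
  moreover have "\<exists>f'. ?P (Suc n) f' \<and> ?Q n f f'" if f: "?P n f" for f n
  proof -
    have comp: "graded_map F (Suc n) G n (f \<circ> differential F (Suc n))"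
      using f dF graded_map_compose by blast
    obtain f' where f': "graded_map F (Suc n) G (Suc n) f'"
      "\<And>v. v \<in> free_module F (Suc n) \<Longrightarrow>
        differential G (Suc n) (f' v) = (f \<circ> differential F (Suc n)) v"
      using graded_map_lift[OF G comp] f by auto
    have "differential F (Suc n) (differential F (Suc (Suc n)) v) = 0"
      if "v \<in> free_module F (Suc (Suc n))" for v
      using augmented_cycle_differential[OF F that] by (simp add: augmented_cycle_def[OF F])
    moreover have "f 0 = 0" using f ring_linear_zero by (auto simp: graded_map_def)
    ultimately show ?thesis
      using f' graded_map_free_module[OF dF] by (intro exI[of _ f']) (auto simp: augmented_cycle_def[OF G])
  qed
  ultimately have "\<exists>f. \<forall>n. ?P n (f n) \<and> ?Q n (f n) (f (Suc n))"
    by (rule dependent_nat_choice)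
  then obtain f where f: "\<forall>n. ?P n (f n) \<and> ?Q n (f n) (f (Suc n))" by blast
  show ?thesis
  proof (rule that[of f])
    show "graded_map F n G n (f n)" for n using f by simp
    show "differential G (Suc n) (f (Suc n) v) = f n (differential F (Suc n) v)"
      if "v \<in> free_module F (Suc n)" for n v using f that by simp
    show "augmentation G (f 0 v) = augmentation F v" if "v \<in> free_module F 0" for v using f that by simp
  qed
qed

text \<open>To be applied to the difference of an endomorphism over k and the identity; such a
  difference is killed by the augmentation.\<close>

lemma null_homotopy_exists:
  fixes F :: "('n::finite, 'k::field) free_complex"
  assumes F: "graded_free_resolution_of_field F"
    and f: "\<And>n. graded_map F n F n (f n)"
    "\<And>n v. v \<in> free_module F (Suc n) \<Longrightarrow> differential F (Suc n) (f (Suc n) v) = f n (differential F (Suc n) v)"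
    "\<And>v. v \<in> free_module F 0 \<Longrightarrow> augmentation F (f 0 v) = 0"
  obtains h where "\<And>n. graded_map F n F (Suc n) (h n)"
    "\<And>v. v \<in> free_module F 0 \<Longrightarrow> differential F (Suc 0) (h 0 v) = f 0 v"
    "\<And>n v. v \<in> free_module F (Suc n) \<Longrightarrow>
      differential F (Suc (Suc n)) (h (Suc n) v) = f (Suc n) v - h n (differential F (Suc n) v)"
proof -
  \<comment> \<open>The invariant is the homotopy equation restricted to boundaries, d h d = f d. It
    makes f - h d land in the cycles one position higher, so that the next h exists.\<close>
  let ?P = "\<lambda>n h. graded_map F n F (Suc n) h \<and>
    (\<forall>v\<in>free_module F (Suc n). differential F (Suc n) (h (differential F (Suc n) v)) =
      f n (differential F (Suc n) v)) \<and>
    (n = 0 \<longrightarrow> (\<forall>v\<in>free_module F 0. differential F (Suc 0) (h v) = f 0 v))"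
  let ?Q = "\<lambda>n h h'. \<forall>v\<in>free_module F (Suc n). differential F (Suc (Suc n)) (h' v) =
    f (Suc n) v - h (differential F (Suc n) v)"
  note dF = resolution_graded_differential[OF F]
  have "\<exists>h. ?P 0 h"
  proof -
    obtain h where "graded_map F 0 F (Suc 0) h"
      "\<And>v. v \<in> free_module F 0 \<Longrightarrow> differential F (Suc 0) (h v) = f 0 v"
      using graded_map_lift[OF F f(1)[of 0]] f(3) by (auto simp: augmented_cycle_def[OF F])
    then show ?thesis using graded_map_free_module[OF dF[of 0]] by (intro exI[of _ h]) auto
  qed
  moreover have "\<exists>h'. ?P (Suc n) h' \<and> ?Q n h h'" if h: "?P n h" for h n
  proof -
    have gr: "graded_map F (Suc n) F (Suc n) (f (Suc n) - (h \<circ> differential F (Suc n)))"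
      using h dF graded_map_compose graded_map_diff f(1) by blast
    have "augmented_cycle F (Suc n) ((f (Suc n) - (h \<circ> differential F (Suc n))) v)"
      if "v \<in> free_module F (Suc n)" for v
    proof -
      have "differential F (Suc n) (x - y) = differential F (Suc n) x - differential F (Suc n) y" for x y
        using ring_linear_differential[of F "Suc n"] unfolding ring_linear_def
        by (metis add_diff_cancel diff_add_cancel)
      then show ?thesis using h f(2)[OF that] that by (simp add: augmented_cycle_def[OF F])
    qed
    from graded_map_lift[OF F gr this]
    obtain h' where h': "graded_map F (Suc n) F (Suc (Suc n)) h'"
      "\<And>v. v \<in> free_module F (Suc n) \<Longrightarrow> differential F (Suc (Suc n)) (h' v) =
        (f (Suc n) - (h \<circ> differential F (Suc n))) v" by blast
    have "differential F (Suc n) (differential F (Suc (Suc n)) v) = 0"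
      if "v \<in> free_module F (Suc (Suc n))" for v
      using augmented_cycle_differential[OF F that] by (simp add: augmented_cycle_def[OF F])
    moreover have "h 0 = 0" using h ring_linear_zero by (auto simp: graded_map_def)
    ultimately show ?thesis
      using h' graded_map_free_module[OF dF] by (intro exI[of _ h']) auto
  qed
  ultimately have "\<exists>h. \<forall>n. ?P n (h n) \<and> ?Q n (h n) (h (Suc n))"
    by (rule dependent_nat_choice)
  then obtain h where h: "\<forall>n. ?P n (h n) \<and> ?Q n (h n) (h (Suc n))" by blast
  show ?thesis
  proof (rule that[of h])
    show "graded_map F n F (Suc n) (h n)" for n using h by simp
    show "differential F (Suc 0) (h 0 v) = f 0 v" if "v \<in> free_module F 0" for v using h that by simp
    show "differential F (Suc (Suc n)) (h (Suc n) v) = f (Suc n) v - h n (differential F (Suc n) v)"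
      if "v \<in> free_module F (Suc n)" for n v using h that by simp
  qed
qed

section \<open>Finite-dimensionality and independence of the resolution\<close>

interpretation vec: vector_space "vec_scale :: 'k::field \<Rightarrow> ('n, 'k) vect \<Rightarrow> ('n, 'k) vect"
  by unfold_locales (auto simp: vec_scale_def fun_eq_iff algebra_simps Const_add Const_mult)

lemma vec_scale_smul: "vec_scale c v = smul (Const c) v"
  by (simp add: vec_scale_def smul_def)

lemma ring_linear_vec_linear: "ring_linear f \<Longrightarrow> Vector_Spaces.linear vec_scale vec_scale f"
  by (auto simp: ring_linear_def vec_scale_smul vec.vector_space_axioms Vector_Spaces.linear_iff)

lemma subspace_tensor_piece: "is_ideal M \<Longrightarrow> vec.subspace (tensor_piece F M n j)"
  by (auto simp: vec.subspace_def vec_scale_smul tensor_piece_zero tensor_piece_add tensor_piece_Const)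

text \<open>Finitely many monomials have the degree prescribed at each basis element. The ideal M
  only cuts out a subset and does not enter the spanning set.\<close>

lemma finite_dimensional_tensor_piece:
  fixes F :: "('n::finite, 'k::field) free_complex"
  shows "finite_dimensional vec_scale (tensor_piece F M n j)"
proof -
  let ?e = "\<lambda>(b::nat, t) x. if x = b then single t (1::'k) else 0"
  let ?X = "\<lambda>b. {t :: 'n \<Rightarrow>\<^sub>0 nat. int (monomial_degree t) = j - shift F n b}"
  let ?I = "Sigma {..<rank F n} ?X"
  have "v \<in> vec.span (?e ` ?I)" if v: "v \<in> tensor_piece F M n j" for v
  proof -
    have "v = (\<Sum>(b, t)\<in>?I. vec_scale (lookup (v b) t) (?e (b, t)))"
    proof
      fix x
      have *: "(\<Sum>(b, t)\<in>?I. vec_scale (lookup (v b) t) (?e (b, t))) x =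
        (\<Sum>b<rank F n. \<Sum>t\<in>?X b. if x = b then single t (lookup (v b) t) else 0)"
        unfolding sum_fun_apply
        by (subst sum.Sigma) (auto simp: finite_monomial_degree vec_scale_def Const_def mult_single intro!: sum.cong)
      show "v x = (\<Sum>(b, t)\<in>?I. vec_scale (lookup (v b) t) (?e (b, t))) x"
      proof (cases "x < rank F n")
        case True
        have "(\<Sum>b<rank F n. \<Sum>t\<in>?X b. if x = b then single t (lookup (v b) t) else 0) =
          (\<Sum>b<rank F n. if x = b then \<Sum>t\<in>?X b. single t (lookup (v b) t) else 0)"
          by (intro sum.cong) auto
        also have "\<dots> = (\<Sum>t\<in>?X x. single t (lookup (v x) t))"
          using True by simp
        also have "\<dots> = v x"
        proof (rule poly_mapping_eqI)
          fix t
          have "int (monomial_degree t) = j - shift F n x" if "lookup (v x) t \<noteq> 0"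
            using v True that by (auto simp: tensor_piece_def homogeneous_iff in_keys_iff)
          then show "lookup (\<Sum>t\<in>?X x. single t (lookup (v x) t)) t =
            lookup (v x) t"
            by (auto simp: lookup_sum lookup_single when_def finite_monomial_degree)
        qed
        finally show ?thesis unfolding * by simp
      next
        case False
        then have "v x = 0" using v by (auto simp: tensor_piece_def free_module_def)
        then show ?thesis unfolding * using False by (auto intro!: sum.neutral)
      qed
    qed
    moreover have "(\<Sum>(b, t)\<in>?I. vec_scale (lookup (v b) t) (?e (b, t))) \<in> vec.span (?e ` ?I)"
      by (intro vec.span_sum) (simp add: case_prod_beta, intro vec.span_scale vec.span_base, force)
    ultimately show ?thesis by (rule ssubst[where P = "\<lambda>u. u \<in> vec.span (?e ` ?I)"])
  qed
  moreover have "finite (?e ` ?I)" by (intro finite_imageI finite_SigmaI finite_monomial_degree) auto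
  ultimately show ?thesis unfolding finite_dimensional_def by blast
qed

lemma subspace_tensor_cycles:
  assumes "is_ideal M"
  shows "vec.subspace (tensor_cycles F M n j)"
proof -
  interpret vector_space_pair vec_scale vec_scale by unfold_locales
  show ?thesis
    using vec.subspace_inter[OF subspace_tensor_piece[OF assms]
        linear_subspace_kernel[OF ring_linear_vec_linear[OF ring_linear_differential]]]
    by (simp add: tensor_cycles_def Int_def)
qed

lemma subspace_tensor_boundaries:
  assumes "is_ideal M"
  shows "vec.subspace (tensor_boundaries F M n j)"
proof -
  interpret vector_space_pair vec_scale vec_scale by unfold_locales
  show ?thesis unfolding tensor_boundaries_def
    using linear_subspace_image[OF ring_linear_vec_linear[OF ring_linear_differential]
        subspace_tensor_piece[OF assms]] .
qed

lemma tensor_boundaries_subset_cycles: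
  assumes "graded_free_resolution_of_field F" "is_ideal M"
  shows "tensor_boundaries F M n j \<subseteq> tensor_cycles F M n j"
proof -
  have "differential F n (differential F (Suc n) v) = 0" if "v \<in> free_module F (Suc n)" for v
    using augmented_cycle_differential[OF assms(1) that]
    by (cases n) (auto simp: augmented_cycle_def[OF assms(1)] differential_def)
  then show ?thesis
    using graded_map_tensor_piece[OF resolution_graded_differential[OF assms(1)] assms(2)]
      tensor_piece_free_module by (fastforce simp: tensor_boundaries_def tensor_cycles_def)
qed

text \<open>The expression inside \<open>tor_dim\<close> with the resolution as a parameter, so that
  two resolutions can be compared.\<close>

definition homology_dim where
  "homology_dim F M n j = vec.dim (tensor_cycles F M n j) - vec.dim (tensor_boundaries F M n j)"

text \<open>The hypotheses are symmetric in F and G, so an inequality is enough. The comparison map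
  f is injective on homology because g f is homotopic to the identity of F.\<close>

lemma homology_dim_le:
  fixes F G :: "('n::finite, 'k::field) free_complex"
  assumes F: "graded_free_resolution_of_field F" and G: "graded_free_resolution_of_field G"
    and M: "is_ideal M"
  shows "homology_dim F M n j \<le> homology_dim G M n j"
proof -
  interpret vector_space_pair "vec_scale :: 'k \<Rightarrow> ('n, 'k) vect \<Rightarrow> ('n, 'k) vect" vec_scale by unfold_locales
  obtain f where f: "\<And>n. graded_map F n G n (f n)"
    "\<And>n v. v \<in> free_module F (Suc n) \<Longrightarrow> differential G (Suc n) (f (Suc n) v) = f n (differential F (Suc n) v)"
    "\<And>v. v \<in> free_module F 0 \<Longrightarrow> augmentation G (f 0 v) = augmentation F v"
    by (rule chain_map_exists[OF F G]) blast
  obtain g where g: "\<And>n. graded_map G n F n (g n)"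
    "\<And>n v. v \<in> free_module G (Suc n) \<Longrightarrow> differential F (Suc n) (g (Suc n) v) = g n (differential G (Suc n) v)"
    "\<And>v. v \<in> free_module G 0 \<Longrightarrow> augmentation F (g 0 v) = augmentation G v"
    by (rule chain_map_exists[OF G F]) blast
  let ?c = "\<lambda>n. (g n \<circ> f n) - (\<lambda>v. v)"
  have dd: "differential F (Suc n) (x - y) = differential F (Suc n) x - differential F (Suc n) y" for n x y
    using ring_linear_differential[of F "Suc n"] unfolding ring_linear_def
    by (metis add_diff_cancel diff_add_cancel)
  note dF = resolution_graded_differential[OF F] and dG = resolution_graded_differential[OF G]
  obtain h where h: "\<And>n. graded_map F n F (Suc n) (h n)"
    "\<And>v. v \<in> free_module F 0 \<Longrightarrow> differential F (Suc 0) (h 0 v) = ?c 0 v"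
    "\<And>n v. v \<in> free_module F (Suc n) \<Longrightarrow>
      differential F (Suc (Suc n)) (h (Suc n) v) = ?c (Suc n) v - h n (differential F (Suc n) v)"
  proof (rule null_homotopy_exists[OF F, of ?c])
    show "graded_map F n F n (?c n)" for n
      by (intro graded_map_diff graded_map_compose[OF f(1) g(1)] graded_map_id)
    show "differential F (Suc n) (?c (Suc n) v) = ?c n (differential F (Suc n) v)"
      if "v \<in> free_module F (Suc n)" for n v
      using f(2)[OF that] g(2)[OF graded_map_free_module[OF f(1) that]] by (simp add: dd)
    show "augmentation F (?c 0 v) = 0" if "v \<in> free_module F 0" for v
      using f(3)[OF that] g(3)[OF graded_map_free_module[OF f(1) that]] by (simp add: augmentation_diff)
  qed blast
  have cyc: "f n z \<in> tensor_cycles G M n j" if "z \<in> tensor_cycles F M n j" for z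
  proof -
    have z: "z \<in> tensor_piece F M n j" "differential F n z = 0" using that by (auto simp: tensor_cycles_def)
    have "differential G n (f n z) = 0"
    proof (cases n)
      case (Suc m)
      then show ?thesis using f(2)[of z m] f(1)[of m] z ring_linear_zero tensor_piece_free_module
        by (fastforce simp: graded_map_def)
    qed (simp add: differential_def)
    then show ?thesis using graded_map_tensor_piece[OF f(1) M z(1)] by (simp add: tensor_cycles_def)
  qed
  have bound: "f n z \<in> tensor_boundaries G M n j" if z: "z \<in> tensor_boundaries F M n j" for z
  proof -
    obtain y where y: "y \<in> tensor_piece F M (Suc n) j" "z = differential F (Suc n) y"
      using z by (auto simp: tensor_boundaries_def)
    then have "f n z = differential G (Suc n) (f (Suc n) y)"
      using f(2)[of y n] tensor_piece_free_module[of F M "Suc n" j] by auto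
    then show ?thesis using graded_map_tensor_piece[OF f(1) M y(1)] by (auto simp: tensor_boundaries_def)
  qed
  have inj: "z \<in> tensor_boundaries F M n j"
    if zc: "z \<in> tensor_cycles F M n j" and fz: "f n z \<in> tensor_boundaries G M n j" for z
  proof -
    have z: "z \<in> tensor_piece F M n j" "differential F n z = 0" using zc by (auto simp: tensor_cycles_def)
    obtain y where y: "y \<in> tensor_piece G M (Suc n) j" "f n z = differential G (Suc n) y"
      using fz by (auto simp: tensor_boundaries_def)
    have "differential F (Suc n) (h n z) = ?c n z"
    proof (cases n)
      case 0
      then show ?thesis using h(2) z tensor_piece_free_module by blast
    next
      case (Suc m)
      then show ?thesis using h(3)[of z m] z tensor_piece_free_module h(1)[of m] ring_linear_zero
        by (fastforce simp: graded_map_def)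
    qed
    \<comment> \<open>On a cycle z the homotopy gives d h z = g f z - z, and f z = d y gives g f z =
      d g y. Therefore z = d (g y - h z).\<close>
    moreover have "g n (f n z) = differential F (Suc n) (g (Suc n) y)"
      using y g(2)[of y n] tensor_piece_free_module[of G M "Suc n" j] by auto
    ultimately have "z = differential F (Suc n) (g (Suc n) y - h n z)"
      by (simp add: dd)
    moreover have "g (Suc n) y - h n z \<in> tensor_piece F M (Suc n) j"
      by (intro tensor_piece_diff M graded_map_tensor_piece[OF g(1) M y(1)]
          graded_map_tensor_piece[OF h(1) M z(1)])
    ultimately show ?thesis unfolding tensor_boundaries_def by blast
  qed
  have fd: "finite_dimensional vec_scale (tensor_cycles H M n j)" for H :: "('n, 'k) free_complex"
    using finite_dimensional_tensor_piece
    by (rule vec.finite_dimensional_subset) (auto simp: tensor_cycles_def)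
  have lin: "ring_linear (f n)" using f(1) by (simp add: graded_map_def)
  have iff: "f n z \<in> tensor_boundaries G M n j \<longleftrightarrow> z \<in> tensor_boundaries F M n j"
    if "z \<in> tensor_cycles F M n j" for z
    using bound inj that by blast
  have "f n ` tensor_cycles F M n j \<subseteq> tensor_cycles G M n j" using cyc by blast
  from dim_quotient_le[OF ring_linear_vec_linear[OF lin] fd subspace_tensor_cycles[OF M]
      subspace_tensor_boundaries[OF M] tensor_boundaries_subset_cycles[OF F M] fd
      subspace_tensor_cycles[OF M] subspace_tensor_boundaries[OF M]
      tensor_boundaries_subset_cycles[OF G M] this iff]
  show ?thesis unfolding homology_dim_def .
qed

text \<open>As soon as one resolution is exhibited, the chosen one is a resolution too, and two
  inequalities identify the dimensions.\<close>

lemma tor_dim_eq_homology_dim: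
  assumes "graded_free_resolution_of_field F" "is_ideal M"
  shows "tor_dim n M j = homology_dim F M n j"
proof -
  have "graded_free_resolution_of_field (SOME F :: ('a, 'b) free_complex. graded_free_resolution_of_field F)"
    using assms(1) by (rule someI)
  then show ?thesis
    using homology_dim_le assms unfolding tor_dim_def Let_def homology_dim_def[symmetric]
    by (metis order_antisym)
qed

section \<open>Koszul homology of families of subsets\<close>

text \<open>The sign of moving e_t to its place among the factors of e_T. The numbering
  \<open>r\<close> is a parameter because the index type is merely finite, and because restriction
  along an embedding e of variables turns \<open>r\<close> into \<open>r o e\<close>.\<close>

definition koszul_sign :: "('n \<Rightarrow> nat) \<Rightarrow> 'n \<Rightarrow> 'n::finite set \<Rightarrow> 'k::field" where
  "koszul_sign r t T = (- 1) ^ card {u \<in> T. r u < r t}"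

lemma koszul_sign_insert:
  "u \<notin> T \<Longrightarrow> koszul_sign r t (insert u T) = (if r u < r t then - koszul_sign r t T else koszul_sign r t T)"
proof -
  assume u: "u \<notin> T"
  have "{v \<in> insert u T. r v < r t} =
      (if r u < r t then insert u {v \<in> T. r v < r t} else {v \<in> T. r v < r t})" by auto
  then show ?thesis using u by (simp add: koszul_sign_def)
qed

lemma koszul_sign_square [simp]: "koszul_sign r t T * (koszul_sign r t T * x) = x"
  by (simp add: koszul_sign_def mult.assoc[symmetric] power_mult_distrib[symmetric])

lemma koszul_sign_nonzero [simp]: "koszul_sign r t T \<noteq> (0 :: 'k::field)"
  by (simp add: koszul_sign_def)

text \<open>Chains are coefficient functions, so the formula is the transpose of the usual one: the
  value at T collects the coefficients of all basis elements whose differential involves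
  e_T.\<close>

definition koszul_boundary ::
  "('n \<Rightarrow> nat) \<Rightarrow> ('p \<times> 'n::finite set \<Rightarrow> 'k::field) \<Rightarrow> 'p \<times> 'n set \<Rightarrow> 'k" where
  "koszul_boundary r g = (\<lambda>(p, T). \<Sum>t\<in>- T. koszul_sign r t T * g (p, insert t T))"

text \<open>Exterior multiplication by one e_i. The direction i may depend on the multidegree but
  not on T, so it is constant on each multigraded summand of the complex.\<close>

definition cone :: "('n \<Rightarrow> nat) \<Rightarrow> ('p \<Rightarrow> 'n) \<Rightarrow> ('p \<times> 'n::finite set \<Rightarrow> 'k::field) \<Rightarrow> 'p \<times> 'n set \<Rightarrow> 'k" where
  "cone r a g = (\<lambda>(p, T). if a p \<in> T then koszul_sign r (a p) (T - {a p}) * g (p, T - {a p}) else 0)"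

lemma koszul_boundary_apply:
  "koszul_boundary r g (p, T) = (\<Sum>t\<in>- T. koszul_sign r t T * g (p, insert t T))"
  by (simp add: koszul_boundary_def)

lemma cone_apply:
  "cone r a g (p, T) = (if a p \<in> T then koszul_sign r (a p) (T - {a p}) * g (p, T - {a p}) else 0)"
  by (simp add: cone_def)

lemma koszul_boundary_boundary:
  assumes "inj r"
  shows "koszul_boundary r (koszul_boundary r g) x = 0"
proof (cases x)
  case (Pair p T)
  let ?F = "\<lambda>(t, u). koszul_sign r t T * (koszul_sign r u (insert t T) * g (p, insert u (insert t T)))"
  \<comment> \<open>The pairs (t, u) and (u, t) reach the same set with opposite signs. Splitting by
    which of the two is numbered first lets one half cancel the other.\<close>
  let ?L = "{(t, u). t \<notin> T \<and> u \<notin> T \<and> r t < r u}" and ?G = "{(t, u). t \<notin> T \<and> u \<notin> T \<and> r u < r t}"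
  have rne: "r t < r u \<or> r u < r t" if "t \<noteq> u" for t u
    using assms that by (metis injD linorder_neqE_nat)
  have S: "(SIGMA t:- T. - insert t T) = ?L \<union> ?G" using rne by auto
  have "koszul_boundary r (koszul_boundary r g) x = sum ?F (SIGMA t:- T. - insert t T)"
    unfolding Pair koszul_boundary_apply sum_distrib_left by (subst sum.Sigma) auto
  also have "\<dots> = sum ?F ?L + sum ?F ?G"
    unfolding S by (rule sum.union_disjoint) auto
  also have "sum ?F ?G = (\<Sum>x\<in>?L. ?F (prod.swap x))"
    by (rule sum.reindex_bij_witness[of _ prod.swap prod.swap]) auto
  also have "\<dots> = (\<Sum>x\<in>?L. - ?F x)"
  proof (rule sum.cong[OF refl])
    fix x assume "x \<in> ?L"
    then obtain t u where *: "x = (t, u)" "t \<notin> T" "u \<notin> T" "r t < r u" by blast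
    then have "t \<noteq> u" by auto
    with * show "?F (prod.swap x) = - ?F x"
      by (simp add: koszul_sign_insert insert_commute)
  qed
  finally show ?thesis by (simp add: sum_negf)
qed

text \<open>In a fixed multidegree the boundary is contraction with the sum of all dual basis
  vectors, and contraction anticommutes with multiplication by e_i up to the scalar 1. The identity
  holds for all functions; whether the cone stays inside a given module is a separate question about
  supports.\<close>

lemma koszul_boundary_cone:
  assumes "inj r"
  shows "koszul_boundary r (cone r a g) x + cone r a (koszul_boundary r g) x = g x"
proof (cases x)
  case (Pair p T)
  let ?i = "a p"
  show ?thesis
  proof (cases "?i \<in> T")
    case False
    have "koszul_boundary r (cone r a g) (p, T) =
      (\<Sum>t\<in>- T. if t = ?i then g (p, T) else 0)"
      unfolding koszul_boundary_apply using False
      by (intro sum.cong) (auto simp: cone_apply)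
    then show ?thesis using False Pair by (simp add: cone_apply)
  next
    case True
    define U where "U = T - {?i}"
    have T: "T = insert ?i U" "?i \<notin> U" using True by (auto simp: U_def)
    have "koszul_boundary r (cone r a g) (p, T) =
      (\<Sum>t\<in>- T. koszul_sign r t T * (koszul_sign r ?i (insert t U) * g (p, insert t U)))"
      unfolding koszul_boundary_apply
    proof (rule sum.cong[OF refl])
      fix t assume "t \<in> - T"
      then have "insert t T - {?i} = insert t U" using True by (auto simp: U_def)
      then show "koszul_sign r t T * cone r a g (p, insert t T) =
        koszul_sign r t T * (koszul_sign r ?i (insert t U) * g (p, insert t U))"
        using True by (simp add: cone_apply)
    qed
    \<comment> \<open>Exactly one of t and i is numbered before the other, so adjoining i to U and
      adjoining t to U flip exactly one of the two signs in total.\<close>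
    also have "\<dots> = (\<Sum>t\<in>- T. - (koszul_sign r ?i U * (koszul_sign r t U * g (p, insert t U))))"
    proof (rule sum.cong[OF refl])
      fix t assume t: "t \<in> - T"
      then have "t \<noteq> ?i" "t \<notin> U" using T by auto
      moreover then have "r t < r ?i \<or> r ?i < r t" using assms by (metis injD linorder_neqE_nat)
      ultimately show "koszul_sign r t T * (koszul_sign r ?i (insert t U) * g (p, insert t U)) =
        - (koszul_sign r ?i U * (koszul_sign r t U * g (p, insert t U)))"
        using T by (auto simp: koszul_sign_insert)
    qed
    finally have A: "koszul_boundary r (cone r a g) (p, T) = \<dots>" .
    have "- U = insert ?i (- T)" using T by auto
    moreover have "?i \<notin> - T" using True by simp
    ultimately have "koszul_boundary r g (p, U) =
      koszul_sign r ?i U * g (p, T) + (\<Sum>t\<in>- T. koszul_sign r t U * g (p, insert t U))"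
      unfolding koszul_boundary_apply by (simp add: T(1)[symmetric])
    then have "cone r a (koszul_boundary r g) (p, T) =
      g (p, T) + (\<Sum>t\<in>- T. koszul_sign r ?i U * (koszul_sign r t U * g (p, insert t U)))"
      using True by (simp add: cone_apply U_def[symmetric] distrib_left sum_distrib_left)
    then show ?thesis using A Pair by (simp add: sum_negf)
  qed
qed

lemma koszul_boundary_add: "koszul_boundary r (f + g) x = koszul_boundary r f x + koszul_boundary r g x"
  by (cases x) (simp add: koszul_boundary_apply algebra_simps sum.distrib)

lemma koszul_boundary_diff: "koszul_boundary r (f - g) x = koszul_boundary r f x - koszul_boundary r g x"
  by (cases x) (simp add: koszul_boundary_apply algebra_simps sum_subtractf)

lemma koszul_boundary_eq_zero: "(\<And>t. t \<notin> T \<Longrightarrow> g (p, insert t T) = 0) \<Longrightarrow> koszul_boundary r g (p, T) = 0"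
  by (simp add: koszul_boundary_apply)

lemma koszul_boundary_cong:
  "(\<And>t. t \<notin> T \<Longrightarrow> f (p, insert t T) = g (p, insert t T)) \<Longrightarrow>
    koszul_boundary r f (p, T) = koszul_boundary r g (p, T)"
  by (simp add: koszul_boundary_apply)

definition fun_scale :: "'k::field \<Rightarrow> ('b \<Rightarrow> 'k) \<Rightarrow> 'b \<Rightarrow> 'k" where
  "fun_scale c g = (\<lambda>x. c * g x)"

interpretation fn: vector_space "fun_scale :: 'k::field \<Rightarrow> ('b \<Rightarrow> 'k) \<Rightarrow> 'b \<Rightarrow> 'k"
  by unfold_locales (auto simp: fun_scale_def fun_eq_iff algebra_simps)

lemma koszul_boundary_scale: "koszul_boundary r (fun_scale c f) x = c * koszul_boundary r f x"
  by (cases x) (simp add: koszul_boundary_apply fun_scale_def sum_distrib_left algebra_simps)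

lemma fun_linearI:
  assumes "\<And>f g x. h (f + g) x = h f x + h g x" "\<And>c f x. h (fun_scale c f) x = c * h f x"
  shows "Vector_Spaces.linear fun_scale fun_scale (h :: ('b \<Rightarrow> 'k::field) \<Rightarrow> 'c \<Rightarrow> 'k)"
  using assms by (simp add: Vector_Spaces.linear_iff fn.vector_space_axioms fun_eq_iff fun_scale_def)

lemma subspace_supported: "fn.subspace {g :: 'b \<Rightarrow> 'k::field. \<forall>x. x \<notin> A \<longrightarrow> g x = 0}"
  by (auto simp: fn.subspace_def fun_scale_def)

lemma
  fixes A :: "'b set"
  assumes "finite A"
  shows dim_supported: "fn.dim {g :: 'b \<Rightarrow> 'k::field. \<forall>x. x \<notin> A \<longrightarrow> g x = 0} = card A" (is "fn.dim ?V = _")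
    and finite_dimensional_supported:
      "finite_dimensional fun_scale {g :: 'b \<Rightarrow> 'k. \<forall>x. x \<notin> A \<longrightarrow> g x = 0}"
proof -
  let ?e = "\<lambda>a x. if x = a then 1 else (0::'k)"
  have exp: "g = (\<Sum>a\<in>A. fun_scale (g a) (?e a))" if "g \<in> ?V" for g
  proof
    fix x
    show "g x = (\<Sum>a\<in>A. fun_scale (g a) (?e a)) x"
      using that assms by (auto simp: sum_fun_apply fun_scale_def if_distrib[of "\<lambda>y. _ * y"] cong: if_cong)
  qed
  have inj: "inj_on ?e A" by (rule inj_onI) (metis one_neq_zero)
  have sp: "?V \<subseteq> fn.span (?e ` A)"
  proof
    fix g assume "g \<in> ?V"
    then have "g = (\<Sum>a\<in>A. fun_scale (g a) (?e a))" by (rule exp)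
    moreover have "(\<Sum>a\<in>A. fun_scale (g a) (?e a)) \<in> fn.span (?e ` A)"
      by (intro fn.span_sum fn.span_scale fn.span_base) auto
    ultimately show "g \<in> fn.span (?e ` A)" by (rule ssubst[where P = "\<lambda>u. u \<in> fn.span (?e ` A)"])
  qed
  have "fn.independent (?e ` A)"
  proof (rule fn.independent_if_scalars_zero)
    show "finite (?e ` A)" using assms by simp
    fix f y assume 0: "(\<Sum>x\<in>?e ` A. fun_scale (f x) x) = 0" and "y \<in> ?e ` A"
    then obtain a where a: "a \<in> A" "y = ?e a" by blast
    have "(\<Sum>x\<in>?e ` A. fun_scale (f x) x) = (\<Sum>b\<in>A. fun_scale (f (?e b)) (?e b))"
      using inj by (simp add: sum.reindex)
    then have "(\<Sum>b\<in>A. fun_scale (f (?e b)) (?e b)) a = 0" using 0 by simp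
    then show "f y = 0" using a assms
      by (simp add: sum_fun_apply fun_scale_def if_distrib[of "\<lambda>y. _ * y"] cong: if_cong)
  qed
  moreover have "?e ` A \<subseteq> ?V" by auto
  ultimately have "fn.dim ?V = card (?e ` A)" using sp fn.basis_card_eq_dim[of "?e ` A" ?V] by simp
  then show "fn.dim ?V = card A" using inj by (simp add: card_image)
  show "finite_dimensional fun_scale ?V"
    unfolding finite_dimensional_def using sp assms by blast
qed

section \<open>Cycles of a family, and when their dimensions add up\<close>

definition level :: "('p \<times> 'n::finite set) set \<Rightarrow> nat \<Rightarrow> ('p \<times> 'n set) set" where
  "level X n = {x \<in> X. card (snd x) = n}"

definition koszul_chains :: "('p \<times> 'n::finite set) set \<Rightarrow> nat \<Rightarrow> ('p \<times> 'n set \<Rightarrow> 'k::field) set" where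
  "koszul_chains X n = {g. \<forall>x. x \<notin> level X n \<longrightarrow> g x = 0}"

text \<open>The boundary is tested only on X. For a difference of two subcomplexes this is the
  complex of the subquotient, in which every term that leaves X counts as zero.\<close>

definition koszul_cycles :: "('n \<Rightarrow> nat) \<Rightarrow> ('p \<times> 'n::finite set) set \<Rightarrow> nat \<Rightarrow> ('p \<times> 'n set \<Rightarrow> 'k::field) set" where
  "koszul_cycles r X n = {g \<in> koszul_chains X n. \<forall>x\<in>X. koszul_boundary r g x = 0}"

text \<open>The type argument makes the field visible, because neither X nor the numerical value
  mentions it.\<close>

definition nullity :: "'k::field itself \<Rightarrow> ('n \<Rightarrow> nat) \<Rightarrow> ('p \<times> 'n::finite set) set \<Rightarrow> nat \<Rightarrow> nat" where
  "nullity _ r X n = fn.dim (koszul_cycles r X n :: ('p \<times> 'n set \<Rightarrow> 'k) set)"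

text \<open>For convex \<open>X\<close> this is the dimension of the homology at level \<open>n\<close>, because the rank of the
  differential from level \<open>n + 1\<close> is the size of that level minus its nullity.\<close>

definition hdim :: "'k::field itself \<Rightarrow> ('n \<Rightarrow> nat) \<Rightarrow> ('p \<times> 'n::finite set) set \<Rightarrow> nat \<Rightarrow> int" where
  "hdim k r X n = int (nullity k r X n) + int (nullity k r X (Suc n)) - int (card (level X (Suc n)))"

text \<open>Says that the span of X is a subcomplex: the differential removes elements from
  T.\<close>

definition downclosed :: "('p \<times> 'n set) set \<Rightarrow> bool" where
  "downclosed X \<longleftrightarrow> (\<forall>p T t. (p, T) \<in> X \<longrightarrow> t \<in> T \<longrightarrow> (p, T - {t}) \<in> X)"

lemma downclosed_insert: "downclosed X \<Longrightarrow> (p, insert t T) \<in> X \<Longrightarrow> t \<notin> T \<Longrightarrow> (p, T) \<in> X"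
  unfolding downclosed_def by (metis Diff_insert_absorb insertI1)

lemma finite_level: "finite X \<Longrightarrow> finite (level X n)"
  by (simp add: level_def)

lemma card_level_Un:
  assumes "finite A" "finite B" "A \<inter> B = {}"
  shows "card (level (A \<union> B) n) = card (level A n) + card (level B n)"
proof -
  have "level (A \<union> B) n = level A n \<union> level B n" by (auto simp: level_def)
  moreover have "level A n \<inter> level B n = {}" using assms(3) by (auto simp: level_def)
  ultimately show ?thesis using assms by (simp add: card_Un_disjoint finite_level)
qed

lemma subspace_chains: "fn.subspace (koszul_chains X n)"
  unfolding koszul_chains_def by (rule subspace_supported)

lemma dim_chains: "finite X \<Longrightarrow> fn.dim (koszul_chains X n :: ('p \<times> 'n::finite set \<Rightarrow> 'k::field) set) = card (level X n)"
  unfolding koszul_chains_def by (rule dim_supported[OF finite_level])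

lemma finite_dimensional_chains: "finite X \<Longrightarrow> finite_dimensional fun_scale (koszul_chains X n)"
  unfolding koszul_chains_def by (rule finite_dimensional_supported[OF finite_level])

lemma chains_outside: "g \<in> koszul_chains X n \<Longrightarrow> x \<notin> X \<Longrightarrow> g x = 0"
  by (cases x) (simp add: koszul_chains_def level_def)

lemma cycles_outside: "g \<in> koszul_cycles r X n \<Longrightarrow> x \<notin> X \<Longrightarrow> g x = 0"
  by (rule chains_outside) (auto simp: koszul_cycles_def)

lemma cycles_subset_chains: "koszul_cycles r X n \<subseteq> koszul_chains X n"
  by (auto simp: koszul_cycles_def)

lemma finite_dimensional_cycles: "finite X \<Longrightarrow> finite_dimensional fun_scale (koszul_cycles r X n)"
  using fn.finite_dimensional_subset[OF finite_dimensional_chains cycles_subset_chains] .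

lemma subspace_cycles:
  fixes X :: "('p \<times> 'n::finite set) set"
  shows "fn.subspace (koszul_cycles r X n)"
proof -
  have "koszul_boundary r 0 x = 0" for x :: "'p \<times> 'n set"
    by (cases x) (simp add: koszul_boundary_apply)
  then show ?thesis
    using subspace_chains[of X n]
    by (auto simp: fn.subspace_def koszul_cycles_def koszul_boundary_add koszul_boundary_scale)
qed

lemma chains_apply: "g \<in> koszul_chains X n \<Longrightarrow> g (p, T) \<noteq> 0 \<Longrightarrow> (p, T) \<in> X \<and> card T = n"
  by (auto simp: koszul_chains_def level_def)

text \<open>By \<open>sub\<close>, A spans a subcomplex of the union. Restricting cycles of the
  union to B has the cycles of A as kernel, \<open>lift\<close> makes the restriction surjective,
  and rank-nullity gives the sum.\<close>

lemma nullity_extension: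
  fixes A B :: "('p \<times> 'n::finite set) set"
  assumes fin: "finite A" "finite B" and disj: "A \<inter> B = {}"
    and sub: "\<And>p T t. (p, T) \<in> B \<Longrightarrow> t \<notin> T \<Longrightarrow> (p, insert t T) \<notin> A"
    and lift: "\<And>g :: 'p \<times> 'n set \<Rightarrow> 'k::field. g \<in> koszul_cycles r B n \<Longrightarrow>
      \<exists>f \<in> koszul_cycles r (A \<union> B) n. \<forall>x\<in>B. f x = g x"
  shows "nullity TYPE('k) r (A \<union> B) n = nullity TYPE('k) r A n + nullity TYPE('k) r B n"
proof -
  interpret vector_space_pair "fun_scale :: 'k \<Rightarrow> ('p \<times> 'n set \<Rightarrow> 'k) \<Rightarrow> _" "fun_scale :: 'k \<Rightarrow> ('p \<times> 'n set \<Rightarrow> 'k) \<Rightarrow> _"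
    by unfold_locales
  let ?r = "\<lambda>(g :: 'p \<times> 'n set \<Rightarrow> 'k) x. if x \<in> B then g x else 0"
  have lin: "Vector_Spaces.linear fun_scale fun_scale ?r"
    by (rule fun_linearI) (auto simp: fun_scale_def)
  have "?r ` koszul_cycles r (A \<union> B) n = koszul_cycles r B n"
  proof
    show "?r ` koszul_cycles r (A \<union> B) n \<subseteq> koszul_cycles r B n"
    proof clarify
      fix g :: "'p \<times> 'n set \<Rightarrow> 'k" assume g: "g \<in> koszul_cycles r (A \<union> B) n"
      then have gc: "g \<in> koszul_chains (A \<union> B) n" by (simp add: koszul_cycles_def)
      have "koszul_boundary r (?r g) (p, T) = 0" if "(p, T) \<in> B" for p T
      proof -
        have "koszul_boundary r (?r g) (p, T) = koszul_boundary r g (p, T)"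
          using sub[OF that] chains_apply[OF gc] by (intro koszul_boundary_cong) fastforce
        then show ?thesis using g that by (simp add: koszul_cycles_def)
      qed
      then show "?r g \<in> koszul_cycles r B n" using gc by (auto simp: koszul_cycles_def koszul_chains_def level_def)
    qed
    show "koszul_cycles r B n \<subseteq> ?r ` koszul_cycles r (A \<union> B) n"
    proof
      fix g :: "'p \<times> 'n set \<Rightarrow> 'k" assume g: "g \<in> koszul_cycles r B n"
      from lift[OF g] obtain f where "f \<in> koszul_cycles r (A \<union> B) n" "\<forall>x\<in>B. f x = g x" by blast
      moreover have "g x = 0" if "x \<notin> B" for x using cycles_outside[OF g that] .
      ultimately have "g = ?r f" by (auto simp: fun_eq_iff)
      then show "g \<in> ?r ` koszul_cycles r (A \<union> B) n" using \<open>f \<in> _\<close> by blast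
    qed
  qed
  moreover have "{g \<in> koszul_cycles r (A \<union> B) n. ?r g = 0} = koszul_cycles r A n"
  proof (intro equalityI subsetI)
    fix g :: "'p \<times> 'n set \<Rightarrow> 'k" assume "g \<in> {g \<in> koszul_cycles r (A \<union> B) n. ?r g = 0}"
    then show "g \<in> koszul_cycles r A n"
      by (auto simp: koszul_cycles_def koszul_chains_def level_def fun_eq_iff) metis
  next
    fix g :: "'p \<times> 'n set \<Rightarrow> 'k" assume g: "g \<in> koszul_cycles r A n"
    then have gc: "g \<in> koszul_chains A n" by (simp add: koszul_cycles_def)
    have "koszul_boundary r g (p, T) = 0" if "(p, T) \<in> B" for p T
      using sub[OF that] chains_apply[OF gc] by (intro koszul_boundary_eq_zero) blast
    moreover have "g x = 0" if "x \<in> B" for x using cycles_outside[OF g] disj that by blast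
    ultimately show "g \<in> {g \<in> koszul_cycles r (A \<union> B) n. ?r g = 0}"
      using g \<open>\<And>x. x \<in> B \<Longrightarrow> g x = 0\<close>
      by (auto simp: koszul_cycles_def koszul_chains_def level_def fun_eq_iff)
  qed
  ultimately show ?thesis
    using rank_nullity[OF lin finite_dimensional_cycles subspace_cycles, of "A \<union> B" r n] fin
    by (simp add: nullity_def)
qed

text \<open>The differential preserves the multidegree, so families without a common multidegree do
  not interact.\<close>

lemma nullity_disjoint:
  assumes "finite A" "finite B" "fst ` A \<inter> fst ` B = {}"
  shows "nullity TYPE('k::field) r (A \<union> B) n = nullity TYPE('k) r A n + nullity TYPE('k) r B n"
proof (rule nullity_extension)
  show "(p, insert t T) \<notin> A" if "(p, T) \<in> B" for p T t using assms(3) that by force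
  fix g :: "_ \<Rightarrow> 'k" assume g: "g \<in> koszul_cycles r B n"
  have "koszul_boundary r g (p, T) = 0" if "(p, T) \<in> A" for p T
  proof (rule koszul_boundary_eq_zero)
    fix t assume "t \<notin> T"
    have "(p, insert t T) \<notin> B" using assms(3) that by force
    then show "g (p, insert t T) = 0" by (rule cycles_outside[OF g])
  qed
  then have "g \<in> koszul_cycles r (A \<union> B) n" using g by (auto simp: koszul_cycles_def koszul_chains_def level_def)
  then show "\<exists>f\<in>koszul_cycles r (A \<union> B) n. \<forall>x\<in>B. f x = g x" by blast
qed (use assms in auto)

text \<open>The lift of a cycle \<open>g\<close> of \<open>B\<close> is \<open>g - cone (\<partial> g)\<close>: by \<open>\<partial> cone + cone \<partial> = id\<close> and
  \<open>\<partial> \<partial> = 0\<close> its boundary vanishes.\<close>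

lemma nullity_cone:
  fixes A B :: "('p \<times> 'n::finite set) set"
  assumes "inj r" "finite A" "finite B" "A \<inter> B = {}" and A: "downclosed A" and AB: "downclosed (A \<union> B)"
    and cone: "\<And>p T t. (p, T) \<in> A \<Longrightarrow> t \<notin> T \<Longrightarrow> (p, insert t T) \<in> B \<Longrightarrow> a p \<notin> T \<Longrightarrow>
      (p, insert (a p) T) \<in> A"
  shows "nullity TYPE('k::field) r (A \<union> B) n = nullity TYPE('k) r A n + nullity TYPE('k) r B n"
proof (rule nullity_extension)
  show "(p, insert t T) \<notin> A" if "(p, T) \<in> B" "t \<notin> T" for p T t
    using downclosed_insert[OF A _ that(2)] that(1) assms(4) by blast
  fix g :: "'p \<times> 'n set \<Rightarrow> 'k" assume g: "g \<in> koszul_cycles r B n"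
  then have gc: "g \<in> koszul_chains B n" by (simp add: koszul_cycles_def)
  let ?w = "koszul_boundary r g"
  \<comment> \<open>The boundary of \<open>g\<close> vanishes on B, hence what is left of it lies in
    A, directly below elements of B.\<close>
  have w: "(p, T) \<in> A \<and> (\<exists>t. t \<notin> T \<and> (p, insert t T) \<in> B \<and> card (insert t T) = n)"
    if nz: "?w (p, T) \<noteq> 0" for p T
  proof -
    obtain t where t: "t \<notin> T" "g (p, insert t T) \<noteq> 0"
      using nz koszul_boundary_eq_zero by metis
    then have "(p, insert t T) \<in> B" "card (insert t T) = n" using chains_apply[OF gc] by auto
    moreover from this have "(p, T) \<in> A \<union> B" using downclosed_insert[OF AB] t by blast
    ultimately show ?thesis using g nz t by (auto simp: koszul_cycles_def)
  qed
  let ?f = "g - cone r a ?w"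
  \<comment> \<open>By the hypothesis on \<open>a\<close> the correction term is supported in A, so
    subtracting it does not alter \<open>g\<close> on B.\<close>
  have cw: "(p, T) \<in> A \<and> card T = n" if nz: "cone r a ?w (p, T) \<noteq> 0" for p T
  proof -
    let ?U = "T - {a p}"
    have aT: "a p \<in> T" and "?w (p, ?U) \<noteq> 0" using nz by (auto simp: cone_apply split: if_splits)
    then obtain t where t: "(p, ?U) \<in> A" "t \<notin> ?U" "(p, insert t ?U) \<in> B" "card (insert t ?U) = n"
      using w by blast
    have "a p \<notin> ?U" by simp
    then have "(p, insert (a p) ?U) \<in> A" by (rule cone[OF t(1-3)])
    moreover have "card T = n"
      unfolding card.remove[OF finite aT] t(4)[symmetric] card_insert_disjoint[OF finite t(2)] ..
    ultimately show ?thesis using aT by (simp add: insert_absorb)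
  qed
  have "?f x = g x" if "x \<in> B" for x
  proof (cases x)
    case (Pair p T)
    then have "cone r a ?w (p, T) = 0" using cw[of p T] that assms(4) by blast
    then show ?thesis using Pair by simp
  qed
  moreover have "koszul_boundary r ?f x = 0" for x
  proof -
    have "cone r a (koszul_boundary r ?w) x = 0"
      using koszul_boundary_boundary[OF assms(1), of g] by (cases x) (simp add: cone_apply)
    then show ?thesis
      using koszul_boundary_cone[OF assms(1), of a ?w x] by (simp add: koszul_boundary_diff)
  qed
  moreover have "?f \<in> koszul_chains (A \<union> B) n"
  proof -
    have "?f (p, T) = 0" if "(p, T) \<notin> level (A \<union> B) n" for p T
    proof -
      have "cone r a ?w (p, T) = 0" using cw[of p T] that by (auto simp: level_def)
      moreover have "g (p, T) = 0" using chains_apply[OF gc, of p T] that by (auto simp: level_def)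
      ultimately show ?thesis by simp
    qed
    then show ?thesis by (simp add: koszul_chains_def)
  qed
  ultimately show "\<exists>f\<in>koszul_cycles r (A \<union> B) n. \<forall>x\<in>B. f x = g x" by (auto simp: koszul_cycles_def)
qed (use assms in auto)

text \<open>If adjoining and removing \<open>a p\<close> stays in X at level n, the cone is a
  contracting homotopy there and each cycle is the boundary of its cone. Convexity ensures that the
  boundary cut down to X still squares to zero.\<close>

lemma hdim_acyclic:
  fixes X :: "('p \<times> 'n::finite set) set"
  assumes r: "inj r" and fin: "finite X"
    and ins: "\<And>p T. (p, T) \<in> level X n \<Longrightarrow> a p \<notin> T \<Longrightarrow> (p, insert (a p) T) \<in> X"
    and del: "\<And>p T. (p, T) \<in> level X n \<Longrightarrow> a p \<in> T \<Longrightarrow> (p, T - {a p}) \<in> X"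
    and conv: "\<And>p T t u. (p, T) \<in> X \<Longrightarrow> (p, insert u (insert t T)) \<in> X \<Longrightarrow> (p, insert t T) \<in> X"
  shows "hdim TYPE('k::field) r X n = 0"
proof -
  interpret vector_space_pair "fun_scale :: 'k \<Rightarrow> ('p \<times> 'n set \<Rightarrow> 'k) \<Rightarrow> _" "fun_scale :: 'k \<Rightarrow> ('p \<times> 'n set \<Rightarrow> 'k) \<Rightarrow> _"
    by unfold_locales
  let ?d = "\<lambda>(g :: 'p \<times> 'n set \<Rightarrow> 'k) x. if x \<in> X then koszul_boundary r g x else 0"
  have lin: "Vector_Spaces.linear fun_scale fun_scale ?d"
    by (rule fun_linearI) (auto simp: koszul_boundary_add koszul_boundary_scale)
  have ker: "{g \<in> koszul_chains X (Suc n). ?d g = 0} = koszul_cycles r X (Suc n)"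
    by (auto simp: koszul_cycles_def fun_eq_iff)
  have "?d ` koszul_chains X (Suc n) = koszul_cycles r X n"
  proof
    show "?d ` koszul_chains X (Suc n) \<subseteq> koszul_cycles r X n"
    proof clarify
      fix g :: "'p \<times> 'n set \<Rightarrow> 'k" assume g: "g \<in> koszul_chains X (Suc n)"
      have "?d g (p, T) = 0" if "(p, T) \<notin> level X n" for p T
      proof -
        have "koszul_boundary r g (p, T) = 0" if "(p, T) \<in> X"
        proof (rule koszul_boundary_eq_zero)
          fix t assume "t \<notin> T"
          then have "card (insert t T) = Suc (card T)" by simp
          then show "g (p, insert t T) = 0"
            using chains_apply[OF g, of p "insert t T"] that \<open>(p, T) \<notin> level X n\<close> by (auto simp: level_def)
        qed
        then show ?thesis by simp
      qed
      moreover have "koszul_boundary r (?d g) (p, T) = 0" if "(p, T) \<in> X" for p T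
      proof -
        have "koszul_boundary r (?d g) (p, T) = koszul_boundary r (koszul_boundary r g) (p, T)"
        proof (rule koszul_boundary_cong)
          fix t
          have "koszul_boundary r g (p, insert t T) = 0" if "(p, insert t T) \<notin> X"
            using conv[OF \<open>(p, T) \<in> X\<close>] chains_apply[OF g] that by (intro koszul_boundary_eq_zero) blast
          then show "?d g (p, insert t T) = koszul_boundary r g (p, insert t T)" by simp
        qed
        then show ?thesis using koszul_boundary_boundary[OF r] by simp
      qed
      ultimately show "?d g \<in> koszul_cycles r X n" by (auto simp: koszul_cycles_def koszul_chains_def)
    qed
    show "koszul_cycles r X n \<subseteq> ?d ` koszul_chains X (Suc n)"
    proof
      fix g :: "'p \<times> 'n set \<Rightarrow> 'k" assume g: "g \<in> koszul_cycles r X n"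
      then have gc: "g \<in> koszul_chains X n" by (simp add: koszul_cycles_def)
      have "(p, T) \<in> level X (Suc n)" if nz: "cone r a g (p, T) \<noteq> 0" for p T
      proof -
        have aT: "a p \<in> T" and "g (p, T - {a p}) \<noteq> 0" using nz by (auto simp: cone_apply split: if_splits)
        then have "(p, T - {a p}) \<in> X" "card (T - {a p}) = n" using chains_apply[OF gc] by auto
        then have "(p, insert (a p) (T - {a p})) \<in> X"
          by (intro ins) (simp_all add: level_def)
        moreover have "card T = Suc n"
          unfolding card.remove[OF finite aT] using \<open>card (T - {a p}) = n\<close> by (rule arg_cong)
        ultimately show ?thesis using aT by (simp add: insert_absorb level_def)
      qed
      then have "cone r a g \<in> koszul_chains X (Suc n)" by (auto simp: koszul_chains_def)
      moreover have "?d (cone r a g) x = g x" for x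
      proof (cases "x \<in> X")
        case False
        then show ?thesis using chains_outside[OF gc] by simp
      next
        case True
        obtain p T where x: "x = (p, T)" by (cases x)
        \<comment> \<open>Without this term the homotopy identity says that the boundary of the cone
          is \<open>g\<close>. For T of size n the smaller set is in X, where the cycle condition
          applies; for other sizes no element of level n lies above it.\<close>
        have "cone r a (koszul_boundary r g) (p, T) = 0"
        proof (cases "a p \<in> T")
          case aT: True
          have "koszul_boundary r g (p, T - {a p}) = 0"
          proof (cases "card T = n")
            case True
            then have "(p, T - {a p}) \<in> X" using del aT \<open>x \<in> X\<close> x by (auto simp: level_def)
            then show ?thesis using g by (simp add: koszul_cycles_def)
          next
            case False
            have "card (insert t (T - {a p})) \<noteq> n" if "t \<notin> T - {a p}" for t
              unfolding card_insert_disjoint[OF finite that] card.remove[OF finite aT, symmetric] by (rule False)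
            then show ?thesis using chains_apply[OF gc] by (intro koszul_boundary_eq_zero) blast
          qed
          then show ?thesis by (simp add: cone_apply)
        qed (simp add: cone_apply)
        then show ?thesis using koszul_boundary_cone[OF r, of a g x] True x by simp
      qed
      ultimately show "g \<in> ?d ` koszul_chains X (Suc n)" by (intro image_eqI[of _ _ "cone r a g"]) (auto simp: fun_eq_iff)
    qed
  qed
  then show ?thesis
    using rank_nullity[OF lin finite_dimensional_chains[OF fin] subspace_chains, of "Suc n"] ker
    by (simp add: hdim_def nullity_def dim_chains[OF fin])
qed

text \<open>The differential out of level n is zero within X, so every chain there is a cycle. Level
  0 is always of this kind.\<close>

lemma nullity_discrete:
  assumes "finite X" "\<And>p T t. (p, T) \<in> X \<Longrightarrow> t \<notin> T \<Longrightarrow> (p, insert t T) \<notin> level X n"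
  shows "nullity TYPE('k::field) r X n = card (level X n)"
proof -
  have "koszul_boundary r g (p, T) = 0" if "g \<in> koszul_chains X n" "(p, T) \<in> X" for g :: "_ \<Rightarrow> 'k" and p T
    using assms(2)[OF that(2)] that(1) by (intro koszul_boundary_eq_zero) (auto simp: koszul_chains_def)
  then have "(koszul_cycles r X n :: (_ \<Rightarrow> 'k) set) = koszul_chains X n" by (auto simp: koszul_cycles_def)
  then show ?thesis using dim_chains[OF assms(1), of n] by (simp add: nullity_def)
qed

text \<open>\<open>sg\<close> absorbs the difference between the signs of the two complexes.\<close>

lemma nullity_reindex:
  fixes X :: "('p \<times> 'n::finite set) set" and Y :: "('q \<times> 'm::finite set) set"
    and sg :: "'p \<times> 'n set \<Rightarrow> 'k::field"
  assumes "finite X" "bij_betw f X Y" "\<And>x. x \<in> X \<Longrightarrow> sg x \<noteq> 0"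
    and card: "\<And>x. x \<in> X \<Longrightarrow> card (snd x) + d = card (snd (f x)) + c"
    and bd: "\<And>g x. x \<in> X \<Longrightarrow> (\<And>y. y \<notin> Y \<Longrightarrow> g y = 0) \<Longrightarrow>
      koszul_boundary r (\<lambda>y. if y \<in> X then sg y * g (f y) else 0) x = sg x * koszul_boundary r' g (f x)"
  shows "nullity TYPE('k) r X (n + c) = nullity TYPE('k) r' Y (n + d)"
    and "card (level X (n + c)) = card (level Y (n + d))"
proof -
  interpret vector_space_pair "fun_scale :: 'k \<Rightarrow> ('q \<times> 'm set \<Rightarrow> 'k) \<Rightarrow> _" "fun_scale :: 'k \<Rightarrow> ('p \<times> 'n set \<Rightarrow> 'k) \<Rightarrow> _"
    by unfold_locales
  let ?h = "\<lambda>(g :: 'q \<times> 'm set \<Rightarrow> 'k) y. if y \<in> X then sg y * g (f y) else 0"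
  have lin: "Vector_Spaces.linear fun_scale fun_scale ?h"
    by (rule fun_linearI) (auto simp: fun_scale_def algebra_simps)
  have fY: "f x \<in> Y" if "x \<in> X" for x using assms(2) that by (auto simp: bij_betw_def)
  have finY: "finite Y" using assms(1,2) bij_betw_finite by blast
  have lev: "x \<in> level X (n + c) \<longleftrightarrow> f x \<in> level Y (n + d)" if "x \<in> X" for x
    using card[OF that] fY[OF that] that by (auto simp: level_def)
  have im: "?h ` koszul_cycles r' Y (n + d) = koszul_cycles r X (n + c)"
  proof
    show "?h ` koszul_cycles r' Y (n + d) \<subseteq> koszul_cycles r X (n + c)"
    proof clarify
      fix g :: "'q \<times> 'm set \<Rightarrow> 'k" assume g: "g \<in> koszul_cycles r' Y (n + d)"
      then have "g y = 0" if "y \<notin> Y" for y using cycles_outside that by blast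
      then have "koszul_boundary r (?h g) x = 0" if "x \<in> X" for x
        using bd[OF that] g fY[OF that] by (simp add: koszul_cycles_def)
      moreover have "?h g x = 0" if "x \<notin> level X (n + c)" for x
      proof (cases "x \<in> X")
        case True
        then have "f x \<notin> level Y (n + d)" using lev that by blast
        then show ?thesis using g by (cases "f x") (simp add: koszul_cycles_def koszul_chains_def)
      qed simp
      ultimately show "?h g \<in> koszul_cycles r X (n + c)" by (simp add: koszul_cycles_def koszul_chains_def)
    qed
    show "koszul_cycles r X (n + c) \<subseteq> ?h ` koszul_cycles r' Y (n + d)"
    proof
      fix g :: "'p \<times> 'n set \<Rightarrow> 'k" assume g: "g \<in> koszul_cycles r X (n + c)"
      define g' where "g' = (\<lambda>y. if y \<in> Y then g (the_inv_into X f y) / sg (the_inv_into X f y) else 0)"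
      have inv: "the_inv_into X f (f x) = x" if "x \<in> X" for x
        using assms(2) that by (auto simp: bij_betw_def the_inv_into_f_f)
      have g0: "g x = 0" if "x \<notin> X" for x using cycles_outside[OF g that] .
      have eq: "?h g' = g"
        using inv g0 fY assms(3) by (auto simp: g'_def fun_eq_iff)
      have ex: "\<exists>x\<in>X. y = f x" if "y \<in> Y" for y using assms(2) that by (auto simp: bij_betw_def)
      have g'0: "g' y = 0" if "y \<notin> Y" for y using that by (simp add: g'_def)
      have "koszul_boundary r' g' y = 0" if "y \<in> Y" for y
      proof -
        obtain x where x: "x \<in> X" "y = f x" using ex \<open>y \<in> Y\<close> by blast
        have "sg x * koszul_boundary r' g' (f x) = koszul_boundary r g x"
          using bd[of x g', OF x(1) g'0] eq by simp
        then show ?thesis using x g assms(3) by (simp add: koszul_cycles_def)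
      qed
      moreover have "g' y = 0" if "y \<notin> level Y (n + d)" for y
      proof (cases "y \<in> Y")
        case True
        then obtain x where x: "x \<in> X" "y = f x" using ex by blast
        then have "x \<notin> level X (n + c)" using lev that by blast
        then have "g x = 0" using g by (cases x) (simp add: koszul_cycles_def koszul_chains_def)
        then show ?thesis using x inv by (simp add: g'_def)
      qed (simp add: g'0)
      ultimately have "g' \<in> koszul_cycles r' Y (n + d)" by (simp add: koszul_cycles_def koszul_chains_def)
      then show "g \<in> ?h ` koszul_cycles r' Y (n + d)" by (rule image_eqI[where f = ?h and x = g', OF eq[symmetric]])
    qed
  qed
  have ker: "g = 0" if g: "g \<in> koszul_cycles r' Y (n + d)" "?h g = 0" for g
  proof -
    have "g y = 0" for y
    proof (cases "y \<in> Y")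
      case True
      then obtain x where "x \<in> X" "y = f x" using assms(2) by (auto simp: bij_betw_def)
      then show ?thesis using fun_cong[OF g(2), of x] assms(3)[of x] by simp
    next
      case False
      then show ?thesis using cycles_outside[OF g(1)] by blast
    qed
    then show ?thesis by auto
  qed
  show "nullity TYPE('k) r X (n + c) = nullity TYPE('k) r' Y (n + d)"
    unfolding nullity_def im[symmetric]
    by (rule dim_image_inj[OF lin finite_dimensional_cycles[OF finY] subspace_cycles]) (rule ker)
  have "bij_betw f (level X (n + c)) (level Y (n + d))"
    using assms(2) lev unfolding bij_betw_def
    by (auto simp: inj_on_def level_def image_iff) metis+
  then show "card (level X (n + c)) = card (level Y (n + d))" by (rule bij_betw_same_card)
qed

section \<open>Betti numbers of monomial ideals\<close>

definition indicator_exp :: "'n::finite set \<Rightarrow> 'n \<Rightarrow>\<^sub>0 nat" where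
  "indicator_exp T = (\<Sum>t\<in>T. single t 1)"

lemma lookup_indicator_exp: "lookup (indicator_exp T) i = (if i \<in> T then 1 else 0)"
  by (simp add: indicator_exp_def lookup_sum lookup_single when_def)

lemma indicator_exp_insert:
  "t \<notin> T \<Longrightarrow> indicator_exp (insert t T) = indicator_exp T + single t 1"
  by (rule poly_mapping_eqI) (auto simp: lookup_indicator_exp lookup_add lookup_single when_def)

lemma indicator_exp_empty [simp]: "indicator_exp {} = 0"
  by (simp add: indicator_exp_def)

lemma monomial_degree_indicator_exp [simp]: "monomial_degree (indicator_exp T) = card T"
  by (simp add: monomial_degree_def lookup_indicator_exp sum.If_cases)

lemma exponent_split:
  "(\<exists>a. p = a + q) \<longleftrightarrow> (\<forall>i. lookup q i \<le> lookup p i)" for p q :: "'n \<Rightarrow>\<^sub>0 nat"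
proof
  assume "\<forall>i. lookup q i \<le> lookup p i"
  then have "p = (p - q) + q" by (intro poly_mapping_eqI) (simp add: lookup_add lookup_minus)
  then show "\<exists>a. p = a + q" by blast
qed (auto simp: lookup_add)

lemma exponent_split_indicator:
  "(\<exists>a. p = a + indicator_exp T) \<longleftrightarrow> (\<forall>t\<in>T. lookup p t > 0)"
  unfolding exponent_split lookup_indicator_exp by (auto simp: Suc_le_eq)

lemma lookup_single_mult:
  fixes f :: "('n, 'k::field) mpoly"
  shows "lookup (single s c * f) (b + s) = c * lookup f b"
proof -
  have "lookup (single s c * f) (b + s) =
    (\<Sum>l. (c when s = l) * (\<Sum>q. lookup f q when b + s = l + q))"
    by (simp add: lookup_mult lookup_single)
  also have "\<dots> = (\<Sum>l. c * (\<Sum>q. lookup f q when b + s = l + q) when s = l)"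
    by (simp add: when_mult)
  also have "\<dots> = c * (\<Sum>q. lookup f q when b + s = s + q)"
    by (simp add: Sum_any_when_equal')
  also have "(\<Sum>q. lookup f q when b + s = s + q) = (\<Sum>q. lookup f q when b = q)"
    by (simp add: add.commute[of s])
  finally show ?thesis by (simp add: Sum_any_when_equal')
qed

lemma lookup_single_mult_zero:
  fixes f :: "('n, 'k::field) mpoly"
  assumes "\<nexists>b. t = b + s"
  shows "lookup (single s c * f) t = 0"
proof -
  have "t \<notin> keys (single s c * f)"
    using keys_mult[of "single s c" f] assms
    by (auto split: if_splits simp: add.commute[of s])
  then show ?thesis by (simp add: in_keys_iff)
qed

text \<open>The pair \<open>(p, T)\<close> stands for \<open>x\<^sup>a e\<^sub>T\<close>, where \<open>a\<close> is \<open>p\<close> minus the indicator of \<open>T\<close>. Recording the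
  multidegree \<open>p\<close> instead of \<open>a\<close> makes the Koszul differential act on \<open>T\<close> only.\<close>

definition koszul_basis :: "('n::finite \<Rightarrow>\<^sub>0 nat) set \<Rightarrow> int \<Rightarrow> (('n \<Rightarrow>\<^sub>0 nat) \<times> 'n set) set" where
  "koszul_basis S j = {(p, T). int (monomial_degree p) = j \<and> (\<exists>a\<in>S. p = a + indicator_exp T)}"

definition up_closed :: "('n \<Rightarrow>\<^sub>0 nat) set \<Rightarrow> bool" where
  "up_closed S \<longleftrightarrow> (\<forall>a\<in>S. \<forall>b. a + b \<in> S)"

lemma finite_koszul_basis: "finite (koszul_basis S j)"
proof -
  have "koszul_basis S j \<subseteq> {p. int (monomial_degree p) = j} \<times> UNIV"
    by (auto simp: koszul_basis_def)
  then show ?thesis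
    by (rule finite_subset) (intro finite_cartesian_product finite_monomial_degree finite)
qed

text \<open>Removing t from T moves the factor x_t into the coefficient, which an up-closed exponent
  set allows.\<close>

lemma downclosed_koszul_basis:
  assumes "up_closed S"
  shows "downclosed (koszul_basis S j)"
  unfolding downclosed_def
proof (intro allI impI)
  fix p T t assume *: "(p, T) \<in> koszul_basis S j" "t \<in> T"
  then obtain a where a: "a \<in> S" "p = a + indicator_exp T" by (auto simp: koszul_basis_def)
  have "indicator_exp T = indicator_exp (T - {t}) + single t 1"
    using indicator_exp_insert[of t "T - {t}"] *(2) by (simp add: insert_absorb)
  then have "p = (a + single t 1) + indicator_exp (T - {t})" using a by (simp add: ac_simps)
  moreover have "a + single t 1 \<in> S" using assms a by (simp add: up_closed_def)
  ultimately show "(p, T - {t}) \<in> koszul_basis S j" using * by (auto simp: koszul_basis_def)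
qed

section \<open>The Koszul complex on all variables and its exactness\<close>

definition subset_enum :: "nat \<Rightarrow> nat \<Rightarrow> 'n::finite set" where
  "subset_enum n = (SOME h. bij_betw h {..<card {T::'n set. card T = n}} {T. card T = n})"

lemma bij_betw_subset_enum:
  "bij_betw (subset_enum n) {..<card {T::'n::finite set. card T = n}} {T::'n set. card T = n}"
proof -
  have "\<exists>h. bij_betw h {..<card {T::'n set. card T = n}} {T::'n set. card T = n}"
    using ex_bij_betw_nat_finite[of "{T::'n set. card T = n}"] by (simp add: atLeast0LessThan)
  then show ?thesis unfolding subset_enum_def by (rule someI_ex)
qed

definition subset_pos :: "nat \<Rightarrow> 'n::finite set \<Rightarrow> nat" where
  "subset_pos n = the_inv_into {..<card {T::'n set. card T = n}} (subset_enum n)"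

lemma subset_pos_enum: "b < card {T::'n::finite set. card T = n} \<Longrightarrow> subset_pos n (subset_enum n b :: 'n set) = b"
  using bij_betw_subset_enum[where 'n = 'n, of n] by (simp add: subset_pos_def bij_betw_def the_inv_into_f_f)

lemma card_subset_enum: "b < card {T::'n::finite set. card T = n} \<Longrightarrow> card (subset_enum n b :: 'n set) = n"
  using bij_betw_subset_enum[where 'n = 'n, of n] by (auto simp: bij_betw_def)

lemma subset_enum_pos:
  fixes T :: "'n::finite set"
  assumes "card T = n"
  shows "subset_enum n (subset_pos n T) = T" "subset_pos n T < card {T::'n set. card T = n}"
proof -
  obtain b where "b < card {T::'n set. card T = n}" "T = subset_enum n b"
    using bij_betw_subset_enum[where 'n = 'n, of n] assms by (auto simp: bij_betw_def image_iff set_eq_iff)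
  then show "subset_enum n (subset_pos n T) = T" "subset_pos n T < card {T::'n set. card T = n}"
    by (simp_all add: subset_pos_enum)
qed

text \<open>Bases in a \<open>free_complex\<close> are initial segments of the naturals, so the
  n-subsets enter through an arbitrary enumeration, which disappears again in
  \<open>koszul_coords\<close>. The entry for sets U and V is the signed variable x_t if V is U with
  t adjoined. The guard on \<open>a\<close> makes the rows beyond the rank vanish.\<close>

definition koszul_complex :: "('n::finite \<Rightarrow> nat) \<Rightarrow> ('n, 'k::field) free_complex" where
  "koszul_complex r = \<lparr>rank = (\<lambda>n. card {T::'n set. card T = n}),
     shift = (\<lambda>n b. int n),
     mat = (\<lambda>n a b. if a < card {T::'n set. card T = n - 1}
       then \<Sum>t\<in>- subset_enum (n - 1) a. if insert t (subset_enum (n - 1) a) = subset_enum n b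
         then single (single t 1) (koszul_sign r t (subset_enum (n - 1) a)) else 0
       else 0),
     aug = (\<lambda>b. 1)\<rparr>"

lemma koszul_complex_simps [simp]:
  "rank (koszul_complex r :: ('n::finite, 'k::field) free_complex) n = card {T::'n set. card T = n}"
  "shift (koszul_complex r :: ('n, 'k) free_complex) n b = int n"
  "aug (koszul_complex r :: ('n, 'k) free_complex) b = 1"
  by (simp_all add: koszul_complex_def)

lemma koszul_differential:
  fixes v :: "('n::finite, 'k::field) vect"
  shows "differential (koszul_complex r) (Suc n) v a = (if a < card {T::'n set. card T = n}
    then \<Sum>t\<in>- subset_enum n a. single (single t 1) (koszul_sign r t (subset_enum n a))
      * v (subset_pos (Suc n) (insert t (subset_enum n a))) else 0)"
proof (cases "a < card {T::'n set. card T = n}")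
  case True
  let ?U = "subset_enum n a :: 'n set" and ?N = "card {T::'n set. card T = Suc n}"
  let ?c = "\<lambda>t. single (single t 1) (koszul_sign r t ?U)"
  have "differential (koszul_complex r) (Suc n) v a =
      (\<Sum>b<?N. (\<Sum>t\<in>- ?U. if insert t ?U = subset_enum (Suc n) b then ?c t else 0) * v b)"
    using True by (simp add: differential_def koszul_complex_def cong: if_cong)
  also have "\<dots> = (\<Sum>b<?N. \<Sum>t\<in>- ?U. if insert t ?U = subset_enum (Suc n) b then ?c t * v b else 0)"
    by (simp add: sum_distrib_right if_distrib[of "\<lambda>x. x * _"] cong: if_cong)
  also have "\<dots> = (\<Sum>t\<in>- ?U. \<Sum>b<?N. if insert t ?U = subset_enum (Suc n) b then ?c t * v b else 0)"
    by (rule sum.swap)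
  also have "\<dots> = (\<Sum>t\<in>- ?U. ?c t * v (subset_pos (Suc n) (insert t ?U)))"
  proof (rule sum.cong[OF refl])
    fix t assume "t \<in> - ?U"
    then have card: "card (insert t ?U) = Suc n" using card_subset_enum[OF True] by simp
    have "(insert t ?U = subset_enum (Suc n) b) = (b = subset_pos (Suc n) (insert t ?U))" if "b < ?N" for b
      using subset_pos_enum[OF that] subset_enum_pos(1)[OF card] by metis
    then have "(\<Sum>b<?N. if insert t ?U = subset_enum (Suc n) b then ?c t * v b else 0) =
      (\<Sum>b<?N. if b = subset_pos (Suc n) (insert t ?U) then ?c t * v b else 0)"
      by (intro sum.cong) auto
    then show "(\<Sum>b<?N. if insert t ?U = subset_enum (Suc n) b then ?c t * v b else 0) =
      ?c t * v (subset_pos (Suc n) (insert t ?U))"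
      using subset_enum_pos(2)[OF card] by simp
  qed
  finally show ?thesis using True by simp
qed (simp add: differential_def koszul_complex_def)

lemma koszul_differential_free:
  "differential (koszul_complex r) (Suc n) v \<in> free_module (koszul_complex r) n"
  by (simp add: free_module_def koszul_differential)

text \<open>The bridge from vectors of polynomials to coefficient functions: the coefficient of x^a
  e_T is stored at multidegree a plus the indicator of T.\<close>

definition koszul_coords ::
  "nat \<Rightarrow> ('n::finite, 'k::field) vect \<Rightarrow> ('n \<Rightarrow>\<^sub>0 nat) \<times> 'n set \<Rightarrow> 'k" where
  "koszul_coords n v = (\<lambda>(p, T). if card T = n \<and> (\<exists>a. p = a + indicator_exp T)
     then lookup (v (subset_pos n T)) (p - indicator_exp T) else 0)"

lemma koszul_coords_apply:
  "card T = n \<Longrightarrow> koszul_coords n v (a + indicator_exp T, T) = lookup (v (subset_pos n T)) a"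
  by (auto simp: koszul_coords_def)

lemma koszul_coords_zero:
  "\<not> (card T = n \<and> (\<exists>a. p = a + indicator_exp T)) \<Longrightarrow> koszul_coords n v (p, T) = 0"
  by (auto simp: koszul_coords_def)

lemma koszul_coords_linear:
  "Vector_Spaces.linear vec_scale fun_scale (koszul_coords n :: ('n::finite, 'k::field) vect \<Rightarrow> _)"
proof -
  have "lookup (Const c * f) a = c * lookup f a" for c and f :: "('n, 'k) mpoly" and a
    using lookup_single_mult[of 0 c f a] by (simp add: Const_def)
  then show ?thesis
    by (auto simp: Vector_Spaces.linear_iff vec.vector_space_axioms fn.vector_space_axioms fun_eq_iff
        koszul_coords_def lookup_add vec_scale_def fun_scale_def)
qed

lemma koszul_coords_inj:
  fixes v :: "('n::finite, 'k::field) vect"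
  assumes "v \<in> free_module (koszul_complex r) n" "w \<in> free_module (koszul_complex r) n"
    and "koszul_coords n v = koszul_coords n w"
  shows "v = w"
proof
  fix b
  show "v b = w b"
  proof (cases "b < card {T::'n set. card T = n}")
    case True
    show ?thesis
    proof (rule poly_mapping_eqI)
      fix a
      have "koszul_coords n u (a + indicator_exp (subset_enum n b), subset_enum n b) = lookup (u b) a"
        for u :: "('n, 'k) vect"
        using koszul_coords_apply[OF card_subset_enum[OF True], of u a] subset_pos_enum[OF True] by simp
      then show "lookup (v b) a = lookup (w b) a" using assms(3) by metis
    qed
  next
    case False
    then show ?thesis using assms(1,2) by (simp add: free_module_def)
  qed
qed

lemma koszul_coords_surj:
  fixes g :: "('n::finite \<Rightarrow>\<^sub>0 nat) \<times> 'n set \<Rightarrow> 'k::field"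
  assumes "finite {x. g x \<noteq> 0}"
    and "\<And>p T. g (p, T) \<noteq> 0 \<Longrightarrow> card T = n \<and> (\<exists>a. p = a + indicator_exp T)"
  obtains v where "v \<in> free_module (koszul_complex r) n" "koszul_coords n v = g"
proof
  let ?v = "\<lambda>b. if b < card {T::'n set. card T = n}
    then Poly_Mapping.Abs_poly_mapping (\<lambda>a. g (a + indicator_exp (subset_enum n b), subset_enum n b)) else 0"
  show "?v \<in> free_module (koszul_complex r) n" by (simp add: free_module_def)
  have fin: "finite {a. g (a + indicator_exp T, T) \<noteq> 0}" for T
  proof (rule finite_imageD)
    show "finite ((\<lambda>a. (a + indicator_exp T, T)) ` {a. g (a + indicator_exp T, T) \<noteq> 0})"
      by (rule finite_subset[OF _ assms(1)]) auto
  qed (simp add: inj_on_def)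
  have "koszul_coords n ?v (p, T) = g (p, T)" for p T
  proof (cases "card T = n \<and> (\<exists>a. p = a + indicator_exp T)")
    case True
    then obtain a where "p = a + indicator_exp T" by blast
    then show ?thesis using True subset_enum_pos[of T n] fin[of T] by (simp add: koszul_coords_apply)
  next
    case False
    then show ?thesis using assms(2)[of p T] koszul_coords_zero[OF False, of ?v] by argo
  qed
  then show "koszul_coords n ?v = g" by auto
qed

lemma finite_koszul_coords: "finite {x. koszul_coords n v x \<noteq> 0}"
proof (rule finite_subset)
  show "{x. koszul_coords n v x \<noteq> 0} \<subseteq>
    (\<Union>T. (\<lambda>a. (a + indicator_exp T, T)) ` keys (v (subset_pos n T)))"
    by (auto simp: koszul_coords_def in_keys_iff image_iff split: if_splits)
  show "finite (\<Union>T. (\<lambda>a. (a + indicator_exp T, T)) ` keys (v (subset_pos n T)))"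
    by auto
qed

text \<open>Multiplying by x_t while deleting t from the set preserves the multidegree, so the
  variables of the matrix disappear and only signs remain.\<close>

lemma koszul_coords_differential:
  fixes v :: "('n::finite, 'k::field) vect"
  shows "koszul_coords n (differential (koszul_complex r) (Suc n) v) = koszul_boundary r (koszul_coords (Suc n) v)"
proof (rule ext, clarify)
  fix p and U :: "'n set"
  show "koszul_coords n (differential (koszul_complex r) (Suc n) v) (p, U) =
    koszul_boundary r (koszul_coords (Suc n) v) (p, U)"
  proof (cases "card U = n \<and> (\<exists>a. p = a + indicator_exp U)")
    case True
    then obtain a where p: "p = a + indicator_exp U" by blast
    have U: "subset_enum n (subset_pos n U) = U" "subset_pos n U < card {T::'n set. card T = n}"
      using subset_enum_pos True by blast+
    have "koszul_coords n (differential (koszul_complex r) (Suc n) v) (p, U) =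
      (\<Sum>t\<in>- U. lookup (single (single t 1) (koszul_sign r t U)
        * v (subset_pos (Suc n) (insert t U))) a)"
      using True U by (simp add: p koszul_coords_apply koszul_differential lookup_sum)
    also have "\<dots> = (\<Sum>t\<in>- U. koszul_sign r t U * koszul_coords (Suc n) v (p, insert t U))"
    proof (rule sum.cong[OF refl])
      fix t assume t: "t \<in> - U"
      show "lookup (single (single t 1) (koszul_sign r t U)
        * v (subset_pos (Suc n) (insert t U))) a = koszul_sign r t U * koszul_coords (Suc n) v (p, insert t U)"
      \<comment> \<open>If x_t does not divide x^a, then e_T with t adjoined does not occur in this
        multidegree, and both sides are zero.\<close>
      proof (cases "\<exists>b. a = b + single t 1")
        case b: True
        then obtain b where "a = b + single t 1" by blast
        moreover from this have "p = b + indicator_exp (insert t U)"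
          using t by (simp add: p indicator_exp_insert ac_simps)
        ultimately show ?thesis
          using t True koszul_coords_apply[of "insert t U" "Suc n" v b] by (simp add: lookup_single_mult)
      next
        case False
        have "\<nexists>b. p = b + indicator_exp (insert t U)"
        proof
          assume "\<exists>b. p = b + indicator_exp (insert t U)"
          then obtain b where "p = (b + single t 1) + indicator_exp U"
            using t by (auto simp: indicator_exp_insert ac_simps)
          then show False using False unfolding p by simp
        qed
        then show ?thesis using False by (simp add: lookup_single_mult_zero koszul_coords_zero)
      qed
    qed
    finally show ?thesis by (simp add: koszul_boundary_apply)
  next
    case False
    have "koszul_boundary r (koszul_coords (Suc n) v) (p, U) = 0"
    proof (rule koszul_boundary_eq_zero, rule koszul_coords_zero)
      fix t assume "t \<notin> U"
      then show "\<not> (card (insert t U) = Suc n \<and> (\<exists>a. p = a + indicator_exp (insert t U)))"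
        using False unfolding exponent_split_indicator by auto
    qed
    then show ?thesis using False by (simp add: koszul_coords_zero)
  qed
qed

text \<open>Chosen from the multidegree rather than from a coefficient, so it is one fixed direction
  for the whole complex in that multidegree and can be used in \<open>cone\<close>.\<close>

definition argmax_exp :: "('n::finite \<Rightarrow>\<^sub>0 nat) \<Rightarrow> 'n" where
  "argmax_exp p = (SOME i. \<forall>l. lookup p l \<le> lookup p i)"

lemma lookup_argmax_exp: "lookup p l \<le> lookup p (argmax_exp p)"
proof -
  have "Max (range (lookup p)) \<in> range (lookup p)" by (intro Max_in) auto
  then obtain i where i: "lookup p i = Max (range (lookup p))" by force
  have "\<forall>l. lookup p l \<le> lookup p i" unfolding i by simp
  then have "\<forall>l. lookup p l \<le> lookup p (argmax_exp p)"
    unfolding argmax_exp_def by (rule someI)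
  then show ?thesis by simp
qed

lemma lookup_argmax_exp_pos: "p \<noteq> 0 \<Longrightarrow> lookup p (argmax_exp p) > 0"
  using lookup_argmax_exp[of p] by (metis gr0I le_zero_eq lookup_zero poly_mapping_eqI)

text \<open>The cone on a cycle is a preimage provided it stays in the Koszul complex, that is, i
  may be adjoined to T. This needs p_i > 0, which the largest exponent satisfies unless p = 0. In
  multidegree 0 only the empty set occurs, and its coefficient is zero by assumption.\<close>

lemma koszul_exact:
  fixes v :: "('n::finite, 'k::field) vect"
  assumes r: "inj r" and v: "v \<in> free_module (koszul_complex r) n"
    and bd: "koszul_boundary r (koszul_coords n v) = 0" and 0: "koszul_coords n v (0, {}) = 0"
  shows "v \<in> differential (koszul_complex r) (Suc n) ` free_module (koszul_complex r) (Suc n)"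
proof -
  let ?g = "koszul_coords n v" and ?c = "cone r argmax_exp (koszul_coords n v)"
  have c: "argmax_exp p \<in> T \<and> ?g (p, T - {argmax_exp p}) \<noteq> 0" if "?c (p, T) \<noteq> 0" for p T
    using that by (auto simp: cone_apply split: if_splits)
  have "finite {x. ?c x \<noteq> 0}"
  proof (rule finite_subset)
    show "{x. ?c x \<noteq> 0} \<subseteq> (\<lambda>(p, T). (p, insert (argmax_exp p) T)) ` {x. ?g x \<noteq> 0}"
    proof clarify
      fix p T assume "?c (p, T) \<noteq> 0"
      then have "argmax_exp p \<in> T" "(p, T - {argmax_exp p}) \<in> {x. ?g x \<noteq> 0}" using c by auto
      then show "(p, T) \<in> (\<lambda>(p, T). (p, insert (argmax_exp p) T)) ` {x. ?g x \<noteq> 0}"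
        by (intro image_eqI[of _ _ "(p, T - {argmax_exp p})"]) (auto simp: insert_absorb)
    qed
  qed (intro finite_imageI finite_koszul_coords)
  moreover have "card T = Suc n \<and> (\<exists>a. p = a + indicator_exp T)" if "?c (p, T) \<noteq> 0" for p T
  proof -
    have aT: "argmax_exp p \<in> T" and g: "?g (p, T - {argmax_exp p}) \<noteq> 0" using c[OF that] by auto
    then have *: "card (T - {argmax_exp p}) = n" "\<exists>a. p = a + indicator_exp (T - {argmax_exp p})"
      using koszul_coords_zero by metis+
    have "p \<noteq> 0"
    proof
      assume p: "p = 0"
      then have e: "T - {argmax_exp p} = {}" using *(2) unfolding exponent_split_indicator by auto
      show False using g 0 unfolding e unfolding p by simp
    qed
    then have "lookup p (argmax_exp p) > 0" by (rule lookup_argmax_exp_pos)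
    then have "\<exists>a. p = a + indicator_exp T"
      using *(2) unfolding exponent_split_indicator by blast
    moreover have "card T = Suc n" unfolding card.remove[OF finite aT] *(1) ..
    ultimately show ?thesis by blast
  qed
  ultimately obtain w where w: "w \<in> free_module (koszul_complex r) (Suc n)" "koszul_coords (Suc n) w = ?c"
    by (rule koszul_coords_surj[of ?c "Suc n" r])
  have "koszul_boundary r ?c x = ?g x" for x
  proof -
    have "cone r argmax_exp (koszul_boundary r ?g) x = 0" unfolding bd by (cases x) (simp add: cone_apply)
    then show ?thesis using koszul_boundary_cone[OF r, of argmax_exp ?g x] by simp
  qed
  then have "koszul_coords n (differential (koszul_complex r) (Suc n) w) = ?g"
    by (auto simp: koszul_coords_differential w(2))
  then have "differential (koszul_complex r) (Suc n) w = v"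
    by (rule koszul_coords_inj[OF koszul_differential_free v])
  then show ?thesis using w(1) by blast
qed

lemma koszul_augmentation:
  fixes v :: "('n::finite, 'k::field) vect"
  shows "augmentation (koszul_complex r) v = koszul_coords 0 v (0, {})"
proof -
  have "{T::'n set. card T = 0} = {{}}" by auto
  then have *: "card {T::'n set. card T = 0} = 1" by simp
  then have "subset_pos 0 ({}::'n set) = 0" using subset_enum_pos(2)[of "{}::'n set" 0] by simp
  then show ?thesis
    using koszul_coords_apply[of "{}" 0 v 0] *
    by (simp add: augmentation_def const_coeff_def)
qed

lemma koszul_complex_resolution:
  assumes r: "inj r"
  shows "graded_free_resolution_of_field (koszul_complex r :: ('n::finite, 'k::field) free_complex)"
proof -
  let ?K = "koszul_complex r :: ('n, 'k) free_complex"
  have "homogeneous (shift ?K n b - shift ?K (n - 1) a) (mat ?K n a b)"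
    if "n > 0" "a < rank ?K (n - 1)" for n a b
  proof -
    have "homogeneous 1 (if P then single (single t 1) (c::'k) else 0)"
      for P and t :: 'n and c
      by (auto simp: homogeneous_iff)
    then have "homogeneous 1 (mat ?K n a b)"
      unfolding koszul_complex_def by (auto intro!: homogeneous_sum)
    then show ?thesis using that by (simp add: of_nat_diff)
  qed
  moreover have "mat ?K n a b = 0" if "a \<ge> rank ?K (n - 1)" for n a b
    using that by (simp add: koszul_complex_def)
  moreover have "augmentation ?K ` free_module ?K 0 = UNIV"
  proof -
    have "c \<in> augmentation ?K ` free_module ?K 0" for c
    proof -
      let ?g = "\<lambda>x::('n \<Rightarrow>\<^sub>0 nat) \<times> 'n set. if x = (0, {}) then c else 0"
      obtain v where "v \<in> free_module ?K 0" "koszul_coords 0 v = ?g"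
        by (rule koszul_coords_surj[of ?g 0 r]) (auto split: if_splits)
      then show ?thesis by (intro image_eqI[of _ _ v]) (simp_all add: koszul_augmentation)
    qed
    then show ?thesis by blast
  qed
  moreover have "{v \<in> free_module ?K 0. augmentation ?K v = 0} = differential ?K (Suc 0) ` free_module ?K (Suc 0)"
  proof (intro equalityI subsetI)
    fix v assume "v \<in> {v \<in> free_module ?K 0. augmentation ?K v = 0}"
    then have v: "v \<in> free_module ?K 0" "koszul_coords 0 v (0, {}) = 0" by (simp_all add: koszul_augmentation)
    have "koszul_boundary r (koszul_coords 0 v) (p, T) = 0" for p T
      by (rule koszul_boundary_eq_zero, rule koszul_coords_zero) simp
    then show "v \<in> differential ?K (Suc 0) ` free_module ?K (Suc 0)"
      using v by (intro koszul_exact[OF r]) auto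
  next
    fix v assume "v \<in> differential ?K (Suc 0) ` free_module ?K (Suc 0)"
    then obtain w where w: "v = differential ?K (Suc 0) w" by blast
    have "koszul_boundary r (koszul_coords (Suc 0) w) (0, {}) = 0"
      by (rule koszul_boundary_eq_zero, rule koszul_coords_zero) (simp only: exponent_split_indicator, simp)
    then show "v \<in> {v \<in> free_module ?K 0. augmentation ?K v = 0}"
      using w by (simp add: koszul_differential_free koszul_augmentation koszul_coords_differential)
  qed
  moreover have "{v \<in> free_module ?K n. differential ?K n v = 0} = differential ?K (Suc n) ` free_module ?K (Suc n)"
    if n: "n > 0" for n
  proof -
    obtain m where m: "n = Suc m" using n by (cases n) auto
    have 0: "koszul_coords k (0 :: ('n, 'k) vect) = 0" for k
      by (auto simp: koszul_coords_def fun_eq_iff)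
    show ?thesis
    proof (intro equalityI subsetI)
      fix v assume "v \<in> {v \<in> free_module ?K n. differential ?K n v = 0}"
      then have v: "v \<in> free_module ?K n" "differential ?K n v = 0" by simp_all
      have "koszul_boundary r (koszul_coords n v) = 0"
        using koszul_coords_differential[of m r v] v(2) 0 by (simp add: m)
      moreover have "koszul_coords n v (0, {}) = 0" using n by (intro koszul_coords_zero) simp
      ultimately show "v \<in> differential ?K (Suc n) ` free_module ?K (Suc n)"
        using v by (intro koszul_exact[OF r])
    next
      fix v assume "v \<in> differential ?K (Suc n) ` free_module ?K (Suc n)"
      then obtain w where w: "v = differential ?K (Suc n) w" by blast
      have "koszul_coords m (differential ?K n v) = koszul_coords m 0"
        using koszul_boundary_boundary[OF r, of "koszul_coords (Suc n) w"]
        by (simp add: m w koszul_coords_differential 0 fun_eq_iff)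
      then have "differential ?K n v = 0"
        unfolding m by (rule koszul_coords_inj[OF koszul_differential_free, rotated]) (simp add: free_module_def)
      then show "v \<in> {v \<in> free_module ?K n. differential ?K n v = 0}"
        using w by (simp add: koszul_differential_free)
    qed
  qed
  ultimately show ?thesis
    unfolding graded_free_resolution_of_field_def by simp
qed

section \<open>Tor of a monomial ideal as a dimension count\<close>

definition monomial_ideal :: "('n \<Rightarrow>\<^sub>0 nat) set \<Rightarrow> ('n, 'k::field) mpoly set" where
  "monomial_ideal S = {f. keys f \<subseteq> S}"

lemma is_ideal_monomial_ideal:
  assumes "up_closed S"
  shows "is_ideal (monomial_ideal S)"
proof -
  have "keys (c * f) \<subseteq> S" if "keys f \<subseteq> S" for c f :: "('a, 'b) mpoly"
  proof
    fix t assume "t \<in> keys (c * f)"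
    then obtain u v where "t = u + v" "v \<in> keys f" using keys_mult[of c f] by blast
    then show "t \<in> S" using assms that by (auto simp: up_closed_def add.commute[of u])
  qed
  moreover have "keys (f + g) \<subseteq> S" if "keys f \<subseteq> S" "keys g \<subseteq> S"
    for f g :: "('a, 'b) mpoly"
    using keys_add[of f g] that by blast
  ultimately show ?thesis by (simp add: is_ideal_iff monomial_ideal_def)
qed

lemma koszul_coords_tensor_piece:
  fixes S :: "('n::finite \<Rightarrow>\<^sub>0 nat) set"
  shows "koszul_coords n ` tensor_piece (koszul_complex r) (monomial_ideal S) n j =
    (koszul_chains (koszul_basis S j) n :: (_ \<Rightarrow> 'k::field) set)"
proof (intro equalityI subsetI)
  fix g :: "('n \<Rightarrow>\<^sub>0 nat) \<times> 'n set \<Rightarrow> 'k"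
  assume "g \<in> koszul_coords n ` tensor_piece (koszul_complex r) (monomial_ideal S) n j"
  then obtain v where v: "v \<in> tensor_piece (koszul_complex r) (monomial_ideal S) n j" "g = koszul_coords n v"
    by blast
  have "(p, T) \<in> level (koszul_basis S j) n" if nz: "g (p, T) \<noteq> 0" for p T
  proof -
    obtain a where a: "card T = n" "p = a + indicator_exp T" using nz v(2) koszul_coords_zero by metis
    then have "a \<in> keys (v (subset_pos n T))"
      using nz v(2) by (simp add: koszul_coords_apply in_keys_iff)
    then have "a \<in> S" "int (monomial_degree a) = j - int n"
      using v(1) subset_enum_pos(2)[OF a(1)]
      by (auto simp: tensor_piece_def monomial_ideal_def homogeneous_iff)
    then show ?thesis using a by (auto simp: level_def koszul_basis_def monomial_degree_add)
  qed
  then show "g \<in> koszul_chains (koszul_basis S j) n" by (auto simp: koszul_chains_def)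
next
  fix g :: "('n \<Rightarrow>\<^sub>0 nat) \<times> 'n set \<Rightarrow> 'k"
  assume g: "g \<in> koszul_chains (koszul_basis S j) n"
  have "finite {x. g x \<noteq> 0}"
    by (rule finite_subset[OF _ finite_koszul_basis[of S j]]) (use chains_outside[OF g] in blast)
  moreover have "card T = n \<and> (\<exists>a. p = a + indicator_exp T)" if "g (p, T) \<noteq> 0" for p T
    using chains_apply[OF g that] by (auto simp: koszul_basis_def)
  ultimately obtain v where v: "v \<in> free_module (koszul_complex r) n" "koszul_coords n v = g"
    by (rule koszul_coords_surj[of g n r])
  have "a \<in> S \<and> int (monomial_degree a) = j - int n"
    if b: "b < card {T::'n set. card T = n}" and a: "a \<in> keys (v b)" for a b
  proof -
    let ?T = "subset_enum n b :: 'n set"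
    have "g (a + indicator_exp ?T, ?T) \<noteq> 0"
      using a v(2) koszul_coords_apply[OF card_subset_enum[OF b], of v a] subset_pos_enum[OF b]
      by (simp add: in_keys_iff)
    then have "(a + indicator_exp ?T, ?T) \<in> koszul_basis S j" using chains_apply[OF g] by blast
    then show ?thesis using card_subset_enum[OF b]
      by (auto simp: koszul_basis_def monomial_degree_add)
  qed
  then have "v \<in> tensor_piece (koszul_complex r) (monomial_ideal S) n j"
    using v(1) by (auto simp: tensor_piece_def monomial_ideal_def homogeneous_iff)
  then show "g \<in> koszul_coords n ` tensor_piece (koszul_complex r) (monomial_ideal S) n j"
    using v(2) by blast
qed

lemma koszul_boundary_downclosed:
  assumes "downclosed X" "g \<in> koszul_chains X n" "koszul_boundary r g (p, T) \<noteq> 0"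
  shows "(p, T) \<in> X \<and> Suc (card T) = n"
proof -
  obtain t where t: "t \<notin> T" "g (p, insert t T) \<noteq> 0" using assms(3) koszul_boundary_eq_zero by metis
  then show ?thesis
    using chains_apply[OF assms(2) t(2)] downclosed_insert[OF assms(1), of p t T] by auto
qed

text \<open>The boundary of a chain on a subcomplex cannot leave it, so testing on X is testing
  everywhere.\<close>

lemma koszul_cycles_downclosed:
  assumes "downclosed X"
  shows "koszul_cycles r X n = {g \<in> koszul_chains X n. koszul_boundary r g = 0}"
proof -
  have "koszul_boundary r g = 0" if "g \<in> koszul_cycles r X n" for g
  proof -
    have "koszul_boundary r g (p, T) = 0" for p T
      using koszul_boundary_downclosed[OF assms, of g n r p T] that by (auto simp: koszul_cycles_def)
    then show ?thesis by auto
  qed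
  then show ?thesis by (auto simp: koszul_cycles_def)
qed

text \<open>Coordinates carry cycles to cycles and boundaries to boundaries. Rank-nullity then
  writes the dimension of the boundaries as the size of level n + 1 minus its nullity. The right
  side is an integer, which avoids truncated subtraction.\<close>

lemma tor_dim_monomial_ideal:
  fixes S :: "('n::finite \<Rightarrow>\<^sub>0 nat) set"
  assumes r: "inj r" and S: "up_closed S"
  shows "int (tor_dim n (monomial_ideal S :: ('n, 'k::field) mpoly set) j) = hdim TYPE('k) r (koszul_basis S j) n"
proof -
  interpret vp: vector_space_pair "vec_scale :: 'k \<Rightarrow> ('n, 'k) vect \<Rightarrow> ('n, 'k) vect"
    "fun_scale :: 'k \<Rightarrow> (('n \<Rightarrow>\<^sub>0 nat) \<times> 'n set \<Rightarrow> 'k) \<Rightarrow> _" by unfold_locales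
  interpret fp: vector_space_pair "fun_scale :: 'k \<Rightarrow> (('n \<Rightarrow>\<^sub>0 nat) \<times> 'n set \<Rightarrow> 'k) \<Rightarrow> _"
    "fun_scale :: 'k \<Rightarrow> (('n \<Rightarrow>\<^sub>0 nat) \<times> 'n set \<Rightarrow> 'k) \<Rightarrow> _" by unfold_locales
  let ?K = "koszul_complex r :: ('n, 'k) free_complex" and ?M = "monomial_ideal S :: ('n, 'k) mpoly set"
  let ?X = "koszul_basis S j"
  note K = koszul_complex_resolution[OF r, where 'k = 'k] and M = is_ideal_monomial_ideal[OF S, where 'b = 'k]
  note X = downclosed_koszul_basis[OF S, of j]
  have ker: "x = 0" if "x \<in> free_module ?K n" "koszul_coords n x = 0" for x
    by (rule koszul_coords_inj[OF that(1)])
      (use that(2) in \<open>auto simp: free_module_def koszul_coords_def fun_eq_iff\<close>)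
  have bim: "koszul_coords n ` tensor_boundaries ?K ?M n j = koszul_boundary r ` koszul_chains ?X (Suc n)"
    unfolding koszul_coords_tensor_piece[of "Suc n" r S j, symmetric] tensor_boundaries_def image_image
    by (simp add: koszul_coords_differential)
  have cim: "koszul_coords n ` tensor_cycles ?K ?M n j = koszul_cycles r ?X n"
  proof -
    have "differential ?K n v = 0 \<longleftrightarrow> koszul_boundary r (koszul_coords n v) = 0" for v
    proof (cases n)
      case 0
      have "koszul_boundary r (koszul_coords 0 v) (p, T) = 0" for p T
        by (rule koszul_boundary_eq_zero, rule koszul_coords_zero) simp
      then show ?thesis by (auto simp: 0 differential_def)
    next
      case (Suc m)
      have "differential ?K n v = 0 \<longleftrightarrow> koszul_coords m (differential ?K n v) = koszul_coords m 0"
        unfolding Suc using koszul_coords_inj[OF koszul_differential_free, of 0 r m v]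
        by (auto simp: free_module_def)
      also have "koszul_coords m (0 :: ('n, 'k) vect) = 0" by (auto simp: koszul_coords_def fun_eq_iff)
      finally show ?thesis unfolding Suc koszul_coords_differential .
    qed
    then show ?thesis
      unfolding koszul_cycles_downclosed[OF X] koszul_coords_tensor_piece[of n r S j, symmetric] tensor_cycles_def
      by auto
  qed
  have fdc: "finite_dimensional vec_scale (tensor_cycles ?K ?M n j)"
    using finite_dimensional_tensor_piece
    by (rule vec.finite_dimensional_subset) (auto simp: tensor_cycles_def)
  note sub = tensor_boundaries_subset_cycles[OF K M]
  have cf: "tensor_cycles ?K ?M n j \<subseteq> free_module ?K n" by (auto simp: tensor_cycles_def tensor_piece_def)
  have fdb: "finite_dimensional vec_scale (tensor_boundaries ?K ?M n j)"
    by (rule vec.finite_dimensional_subset[OF fdc sub])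
  have c: "vec.dim (tensor_cycles ?K ?M n j) = nullity TYPE('k) r ?X n"
    unfolding nullity_def cim[symmetric]
    by (rule vp.dim_image_inj[OF koszul_coords_linear fdc subspace_tensor_cycles[OF M], symmetric])
      (use ker cf in blast)
  have b: "vec.dim (tensor_boundaries ?K ?M n j) =
      fn.dim (koszul_boundary r ` koszul_chains ?X (Suc n) :: (_ \<Rightarrow> 'k) set)"
    unfolding bim[symmetric]
    by (rule vp.dim_image_inj[OF koszul_coords_linear fdb subspace_tensor_boundaries[OF M], symmetric])
      (use ker cf sub in blast)
  have lin: "Vector_Spaces.linear fun_scale fun_scale
      (koszul_boundary r :: (('n \<Rightarrow>\<^sub>0 nat) \<times> 'n set \<Rightarrow> 'k) \<Rightarrow> _)"
    by (rule fun_linearI) (simp_all add: koszul_boundary_add koszul_boundary_scale)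
  have rn: "card (level ?X (Suc n)) =
    fn.dim (koszul_boundary r ` koszul_chains ?X (Suc n) :: (_ \<Rightarrow> 'k) set) + nullity TYPE('k) r ?X (Suc n)"
    unfolding nullity_def koszul_cycles_downclosed[OF X] dim_chains[OF finite_koszul_basis, where 'k = 'k, symmetric]
    by (rule fp.rank_nullity[OF lin finite_dimensional_chains[OF finite_koszul_basis] subspace_chains])
  have "vec.dim (tensor_boundaries ?K ?M n j) \<le> vec.dim (tensor_cycles ?K ?M n j)"
    by (rule vec.dim_mono_finite_dimensional[OF fdc subspace_tensor_cycles[OF M] sub])
  then show ?thesis
    using b c rn unfolding tor_dim_eq_homology_dim[OF K M] homology_dim_def hdim_def by simp
qed

section \<open>Symbolic powers of the edge ideal\<close>

lemma is_ideal_mult: "is_ideal I \<Longrightarrow> x \<in> I \<Longrightarrow> c * x \<in> I"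
  by (simp add: is_ideal_iff)

lemma monomial_ideal_subsetI:
  fixes I :: "('n, 'k::field) mpoly set"
  assumes "is_ideal I" "\<And>t c. t \<in> S \<Longrightarrow> single t c \<in> I"
  shows "monomial_ideal S \<subseteq> I"
proof
  fix f :: "('n, 'k) mpoly" assume f: "f \<in> monomial_ideal S"
  have "f = (\<Sum>t\<in>keys f. single t (lookup f t))"
    by (rule poly_mapping_eqI) (auto simp: lookup_sum lookup_single when_def in_keys_iff)
  moreover have "(\<Sum>t\<in>keys f. single t (lookup f t)) \<in> I"
    using f assms by (intro is_ideal_sum) (auto simp: monomial_ideal_def)
  ultimately show "f \<in> I" by simp
qed

lemma Var_single: "Var i * single t c = single (t + single i 1) c"
  by (simp add: Var_def mult_single add.commute)

lemma exponent_split_single: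
  "(\<exists>b. t = b + single i 1) \<longleftrightarrow> lookup t i > 0" for t :: "'n \<Rightarrow>\<^sub>0 nat"
  unfolding exponent_split by (auto simp: lookup_single when_def Suc_le_eq)

lemma monomial_degree_remove:
  "monomial_degree t = lookup t i + (\<Sum>l\<in>-{i}. lookup t l)"
  unfolding monomial_degree_def Compl_eq_Diff_UNIV by (rule sum.remove) auto

lemma lookup_less_monomial_degree_iff:
  "lookup t i < monomial_degree t \<longleftrightarrow> (\<exists>j. j \<noteq> i \<and> lookup t j > 0)"
proof -
  have "lookup t i < monomial_degree t \<longleftrightarrow> (\<Sum>l\<in>-{i}. lookup t l) \<noteq> 0"
    unfolding monomial_degree_remove[of t i] by linarith
  then show ?thesis by auto
qed

section \<open>Minimal primes of the edge ideal and their powers\<close>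

definition off_axis :: "'n \<Rightarrow> ('n::finite \<Rightarrow>\<^sub>0 nat) set" where
  "off_axis i = {t. \<exists>j. j \<noteq> i \<and> lookup t j > 0}"

text \<open>The prime generated by all variables except x_i; these variables form a minimal vertex
  cover of the complete graph when there are at least two vertices. The description by exponents
  makes membership combinatorial.\<close>

definition vertex_ideal :: "'n::finite \<Rightarrow> ('n, 'k::field) mpoly set" where
  "vertex_ideal i = monomial_ideal (off_axis i)"

lemma up_closed_off_axis: "up_closed (off_axis i)"
  by (force simp: up_closed_def off_axis_def lookup_add)

lemma is_ideal_vertex_ideal: "is_ideal (vertex_ideal i :: ('n::finite, 'k::field) mpoly set)"
  unfolding vertex_ideal_def by (rule is_ideal_monomial_ideal[OF up_closed_off_axis])

lemma monomial_ideal_Inter: "monomial_ideal (\<Inter>i\<in>A. S i) = (\<Inter>i\<in>A. monomial_ideal (S i))"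
  by (auto simp: monomial_ideal_def)

lemma edge_exponent_iff:
  "(\<exists>i j. i \<noteq> j \<and> lookup t i > 0 \<and> lookup t j > 0) \<longleftrightarrow> (\<forall>i. t \<in> off_axis i)"
proof
  assume off: "\<forall>i. t \<in> off_axis i"
  \<comment> \<open>The condition at any index gives a first variable in the support; the condition
    at that variable gives a second.\<close>
  then obtain i where "lookup t i > 0" by (auto simp: off_axis_def)
  moreover obtain j where "j \<noteq> i" "lookup t j > 0" using off by (auto simp: off_axis_def)
  ultimately show "\<exists>i j. i \<noteq> j \<and> lookup t i > 0 \<and> lookup t j > 0" by blast
next
  assume "\<exists>i j. i \<noteq> j \<and> lookup t i > 0 \<and> lookup t j > 0"
  then obtain i j where ij: "i \<noteq> j" "lookup t i > 0" "lookup t j > 0" by blast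
  have "t \<in> off_axis k" for k
    unfolding off_axis_def using ij by (cases "k = i") auto
  then show "\<forall>i. t \<in> off_axis i" by blast
qed

lemma complete_edge_ideal_eq:
  "(complete_edge_ideal :: ('n::finite, 'k::field) mpoly set) = (\<Inter>i. vertex_ideal i)"
proof -
  have e: "(\<Inter>i. vertex_ideal i) = (monomial_ideal (\<Inter>i. off_axis i) :: ('n, 'k) mpoly set)"
    by (simp add: vertex_ideal_def monomial_ideal_Inter)
  have "up_closed (\<Inter>i. off_axis i :: ('n \<Rightarrow>\<^sub>0 nat) set)"
    using up_closed_off_axis by (auto simp: up_closed_def)
  note ideal = is_ideal_monomial_ideal[OF this, where 'b = 'k]
  have "(complete_edge_ideal :: ('n, 'k) mpoly set) \<subseteq> monomial_ideal (\<Inter>i. off_axis i)"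
    unfolding complete_edge_ideal_def
  proof (rule ideal_gen_minimal[OF _ ideal], clarify)
    fix i j :: 'n assume "i \<noteq> j"
    then show "(Var i * Var j :: ('n, 'k) mpoly) \<in> monomial_ideal (\<Inter>i. off_axis i)"
    proof -
      let ?t = "single j 1 + single i (1::nat)"
      have "\<forall>l. ?t \<in> off_axis l"
        unfolding edge_exponent_iff[symmetric] using \<open>i \<noteq> j\<close>
        by (intro exI[of _ i] exI[of _ j]) (simp add: lookup_add)
      then show ?thesis unfolding Var_def[of j] Var_single by (simp add: monomial_ideal_def)
    qed
  qed
  moreover have "monomial_ideal (\<Inter>i. off_axis i) \<subseteq> (complete_edge_ideal :: ('n, 'k) mpoly set)"
  proof (rule monomial_ideal_subsetI)
    show "is_ideal complete_edge_ideal" unfolding complete_edge_ideal_def by (rule is_ideal_ideal_gen)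
    fix t :: "'n \<Rightarrow>\<^sub>0 nat" and c :: 'k assume "t \<in> (\<Inter>i. off_axis i)"
    then obtain i j where ij: "i \<noteq> j" "lookup t i > 0" "lookup t j > 0"
      using edge_exponent_iff[of t] by auto
    then obtain b where b: "t = b + single i 1" using exponent_split_single[of t i] ij(2) by auto
    have "lookup b j > 0" using ij by (simp add: b lookup_add lookup_single)
    then obtain d where d: "b = d + single j 1" using exponent_split_single[of b j] by auto
    have "single t c = single d c * (Var i * Var j)"
      using Var_single[of j d c] Var_single[of i b c] by (simp add: b d ac_simps)
    moreover have "Var i * Var j \<in> (complete_edge_ideal :: ('n, 'k) mpoly set)"
      unfolding complete_edge_ideal_def by (rule subsetD[OF ideal_gen_superset]) (use ij in auto)
    ultimately show "single t c \<in> complete_edge_ideal"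
      using is_ideal_ideal_gen[of "{Var i * Var j :: ('n, 'k) mpoly | i j. i \<noteq> j}"]
      by (simp add: complete_edge_ideal_def is_ideal_iff)
  qed
  ultimately show ?thesis unfolding e by blast
qed

lemma not_off_axis_iff: "t \<notin> off_axis i \<longleftrightarrow> t = single i (lookup t i)"
proof
  assume "t \<notin> off_axis i"
  then show "t = single i (lookup t i)"
    by (intro poly_mapping_eqI) (auto simp: off_axis_def lookup_single when_def)
next
  assume "t = single i (lookup t i)"
  then have "lookup t j = 0" if "j \<noteq> i" for j
    using that by (metis lookup_single_not_eq)
  then show "t \<notin> off_axis i" by (fastforce simp: off_axis_def)
qed

text \<open>The coefficients at the smallest pure powers of \<open>x\<^sub>i\<close> in \<open>f\<close> and \<open>g\<close> survive in \<open>f * g\<close>.\<close>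

lemma prime_ideal_vertex_ideal: "prime_ideal (vertex_ideal i :: ('n::finite, 'k::field) mpoly set)"
proof -
  have "f * g \<notin> vertex_ideal i" if f: "f \<notin> vertex_ideal i" and g: "g \<notin> vertex_ideal i"
    for f g :: "('n, 'k) mpoly"
  proof -
    let ?s = "\<lambda>n. single i (n::nat)"
    have ex: "\<exists>n. ?s n \<in> keys h" if "h \<notin> vertex_ideal i" for h :: "('n, 'k) mpoly"
      using that not_off_axis_iff[of _ i] unfolding vertex_ideal_def monomial_ideal_def
      by (metis (no_types, lifting) mem_Collect_eq subsetI)
    obtain a where a: "?s a \<in> keys f" "\<And>n. ?s n \<in> keys f \<Longrightarrow> a \<le> n"
      using exists_least_iff[of "\<lambda>n. ?s n \<in> keys f"] ex[OF f] by (metis not_less)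
    obtain b where b: "?s b \<in> keys g" "\<And>n. ?s n \<in> keys g \<Longrightarrow> b \<le> n"
      using exists_least_iff[of "\<lambda>n. ?s n \<in> keys g"] ex[OF g] by (metis not_less)
    let ?t = "?s (a + b)"
    have "f * g = (\<Sum>u\<in>keys f. single u (lookup f u)) * g"
      by (rule arg_cong[where f = "\<lambda>x. x * g"], rule poly_mapping_eqI)
        (auto simp: lookup_sum lookup_single when_def in_keys_iff)
    then have "lookup (f * g) ?t =
      (\<Sum>u\<in>keys f. lookup (single u (lookup f u) * g) ?t)"
      by (simp add: sum_distrib_right lookup_sum)
    also have "\<dots> = (\<Sum>u\<in>keys f. if u = ?s a then lookup f (?s a) * lookup g (?s b) else 0)"
    proof (rule sum.cong[OF refl])
      fix u assume u: "u \<in> keys f"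
      show "lookup (single u (lookup f u) * g) ?t =
        (if u = ?s a then lookup f (?s a) * lookup g (?s b) else 0)"
      proof (cases "\<exists>v. ?t = v + u")
        case True
        then obtain v where v: "?t = v + u" by blast
        have "lookup v l + lookup u l = (a + b when i = l)" for l
          using arg_cong[OF v, of "\<lambda>x. lookup x l"]
          by (simp add: lookup_add lookup_single)
        note l = this
        have *: "lookup v i + lookup u i = a + b"
          "\<And>l. l \<noteq> i \<Longrightarrow> lookup v l = 0 \<and> lookup u l = 0"
        proof -
          show "lookup v i + lookup u i = a + b" using l[of i] by simp
          show "lookup v k = 0 \<and> lookup u k = 0" if "k \<noteq> i" for k
            using l[of k] that by simp
        qed
        have u': "u = ?s (lookup u i)" and v': "v = ?s (lookup v i)"
          using *(2) by (intro poly_mapping_eqI; auto simp: lookup_single when_def)+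
        have L: "lookup (single u (lookup f u) * g) ?t =
          lookup f u * lookup g v"
          unfolding v by (rule lookup_single_mult)
        show ?thesis
        proof (cases "u = ?s a")
          case True
          then have "lookup v i = b" using *(1) by simp
          then show ?thesis using L True v' by simp
        next
          case False
          \<comment> \<open>By minimality of a, the pure power u has a larger exponent. Then v is a
            pure power with exponent below b and cannot occur in \<open>g\<close>.\<close>
          then have "lookup u i > a" using a(2)[of "lookup u i"] u u' by (metis le_neq_implies_less)
          then have "v \<notin> keys g" using b(2)[of "lookup v i"] v' *(1) by auto
          then show ?thesis using L False by (simp add: in_keys_iff)
        qed
      next
        case False
        moreover have "u \<noteq> ?s a" using False by (metis single_add add.commute)
        ultimately show ?thesis by (simp add: lookup_single_mult_zero)
      qed
    qed
    also have "\<dots> = lookup f (?s a) * lookup g (?s b)" using a(1) by simp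
    finally have "?t \<in> keys (f * g)" using a(1) b(1) by (simp add: in_keys_iff)
    moreover have "?t \<notin> off_axis i" by (simp add: not_off_axis_iff)
    ultimately show ?thesis by (auto simp: vertex_ideal_def monomial_ideal_def)
  qed
  moreover have "(1 :: ('n, 'k) mpoly) \<notin> vertex_ideal i"
    by (auto simp: vertex_ideal_def monomial_ideal_def off_axis_def)
  ultimately show ?thesis unfolding prime_ideal_def using is_ideal_vertex_ideal by blast
qed

lemma Var_in_vertex_ideal_iff: "(Var j :: ('n::finite, 'k::field) mpoly) \<in> vertex_ideal i \<longleftrightarrow> i \<noteq> j"
  by (auto simp: Var_def vertex_ideal_def monomial_ideal_def off_axis_def lookup_single when_def)

text \<open>The colon ideal (I : x_i) is P_i, because x_i lies in every P_l except P_i. It shows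
  that P_i is associated, and x_i later serves as a multiplier outside P_i that carries P_i into
  I.\<close>

lemma times_Var_in_complete_edge_ideal_iff:
  "g * Var i \<in> (complete_edge_ideal :: ('n::finite, 'k::field) mpoly set) \<longleftrightarrow> g \<in> vertex_ideal i"
proof
  assume "g * Var i \<in> complete_edge_ideal"
  then have "g * Var i \<in> vertex_ideal i" by (simp add: complete_edge_ideal_eq)
  then show "g \<in> vertex_ideal i"
    using prime_ideal_vertex_ideal[of i, where 'k = 'k] Var_in_vertex_ideal_iff[of i i]
    unfolding prime_ideal_def by blast
next
  assume g: "g \<in> vertex_ideal i"
  have "g * Var i \<in> vertex_ideal l" for l
  proof (cases "l = i")
    case True
    then show ?thesis using is_ideal_mult[OF is_ideal_vertex_ideal g, of "Var i"] by (simp add: mult.commute)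
  next
    case False
    then have "Var i \<in> (vertex_ideal l :: ('n, 'k) mpoly set)" by (simp add: Var_in_vertex_ideal_iff)
    then show ?thesis by (rule is_ideal_mult[OF is_ideal_vertex_ideal])
  qed
  then show "g * Var i \<in> complete_edge_ideal" by (simp add: complete_edge_ideal_eq)
qed

lemma vertex_ideal_subset_iff: "vertex_ideal i \<subseteq> (vertex_ideal j :: ('n::finite, 'k::field) mpoly set) \<longleftrightarrow> i = j"
  using Var_in_vertex_ideal_iff[of j, where 'k = 'k] by blast

lemma maximal_associated_primes_complete_edge_ideal:
  "maximal_associated_primes (complete_edge_ideal :: ('n::finite, 'k::field) mpoly set) = range vertex_ideal"
proof -
  let ?I = "complete_edge_ideal :: ('n, 'k) mpoly set"
  have assoc: "vertex_ideal i \<in> associated_primes ?I" for i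
    using prime_ideal_vertex_ideal times_Var_in_complete_edge_ideal_iff[of _ i, where 'k = 'k]
    unfolding associated_primes_def by blast
  \<comment> \<open>An f outside I avoids some P_i; then g f in I, hence in P_i, forces g into
    P_i.\<close>
  have below: "\<exists>i. Q \<subseteq> vertex_ideal i" if assoc_Q: "Q \<in> associated_primes ?I" for Q
  proof -
    obtain f where Q: "prime_ideal Q" "Q = {g. g * f \<in> ?I}"
      using assoc_Q unfolding associated_primes_def by blast
    have "f \<notin> ?I"
    proof
      assume "f \<in> ?I"
      then have "g * f \<in> ?I" for g
        unfolding complete_edge_ideal_def by (rule is_ideal_mult[OF is_ideal_ideal_gen])
      then show False using Q unfolding prime_ideal_def by blast
    qed
    then obtain i where i: "f \<notin> vertex_ideal i" by (auto simp: complete_edge_ideal_eq)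
    have "g \<in> vertex_ideal i" if "g \<in> Q" for g
    proof -
      have "g * f \<in> vertex_ideal i" using that Q(2) by (simp add: complete_edge_ideal_eq)
      then show ?thesis using i prime_ideal_vertex_ideal[of i, where 'k = 'k] unfolding prime_ideal_def by blast
    qed
    then show ?thesis by blast
  qed
  show ?thesis
  proof (intro equalityI subsetI)
    fix Q assume "Q \<in> maximal_associated_primes ?I"
    then have Q: "Q \<in> associated_primes ?I" "\<And>P. P \<in> associated_primes ?I \<Longrightarrow> Q \<subseteq> P \<Longrightarrow> P = Q"
      by (auto simp: maximal_associated_primes_def)
    from below[OF Q(1)] obtain i where "Q \<subseteq> vertex_ideal i" by blast
    then have "vertex_ideal i = Q" by (rule Q(2)[OF assoc])
    then show "Q \<in> range vertex_ideal" by blast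
  next
    fix Q :: "('n, 'k) mpoly set" assume "Q \<in> range vertex_ideal"
    then obtain i where Q: "Q = vertex_ideal i" by blast
    have "P = Q" if P: "P \<in> associated_primes ?I" "Q \<subseteq> P" for P
    proof -
      from below[OF P(1)] obtain k where k: "P \<subseteq> vertex_ideal k" by blast
      then have "vertex_ideal i \<subseteq> (vertex_ideal k :: ('n, 'k) mpoly set)" using P Q by simp
      then have "i = k" by (simp only: vertex_ideal_subset_iff)
      then show ?thesis using P Q k by simp
    qed
    then show "Q \<in> maximal_associated_primes ?I"
      using assoc Q by (simp add: maximal_associated_primes_def)
  qed
qed

lemma prime_ideal_imp_primary_ideal: "prime_ideal J \<Longrightarrow> primary_ideal J"
  unfolding prime_ideal_def primary_ideal_def ideal_radical_def
  by (metis mem_Collect_eq power_one_right)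

lemma prime_ideal_one: "prime_ideal P \<Longrightarrow> 1 \<notin> P"
proof
  assume P: "prime_ideal P" "1 \<in> P"
  then have "c * 1 \<in> P" for c unfolding prime_ideal_def is_ideal_iff by blast
  then show False using P(1) unfolding prime_ideal_def by auto
qed

lemma prime_ideal_power: "prime_ideal P \<Longrightarrow> x \<notin> P \<Longrightarrow> x ^ n \<notin> P"
  by (induction n) (auto simp: prime_ideal_one, auto simp: prime_ideal_def)

lemma prime_ideal_prod:
  assumes "prime_ideal P" "finite A" "\<And>x. x \<in> A \<Longrightarrow> f x \<notin> P"
  shows "prod f A \<notin> P"
  using assms(2,3)
proof (induction A rule: finite_induct)
  case (insert x A)
  then have "prod f A \<notin> P" "f x \<notin> P" by simp_all
  then show ?case using insert(1,2) assms(1) by (auto simp: prime_ideal_def)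
qed (simp add: prime_ideal_one[OF assms(1)])

text \<open>The primary decomposition is an unspecified choice, so nothing can be read off from it.
  Both inclusions are localisation arguments: elements outside P_i may be cancelled.\<close>

lemma component_below_complete_edge_ideal:
  "component_below complete_edge_ideal (vertex_ideal i) = (vertex_ideal i :: ('n::finite, 'k::field) mpoly set)"
proof -
  let ?I = "complete_edge_ideal :: ('n, 'k) mpoly set" and ?P = "vertex_ideal i :: ('n, 'k) mpoly set"
  define D where "D = (SOME D. primary_decomposition ?I D)"
  have "primary_decomposition ?I (range vertex_ideal)"
    unfolding primary_decomposition_def complete_edge_ideal_eq
    by (simp add: prime_ideal_imp_primary_ideal[OF prime_ideal_vertex_ideal])
  then have "primary_decomposition ?I D" unfolding D_def by (rule someI)
  then have D: "finite D" "\<And>J. J \<in> D \<Longrightarrow> primary_ideal J" "?I = \<Inter>D"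
    by (auto simp: primary_decomposition_def)
  have P: "prime_ideal ?P" by (rule prime_ideal_vertex_ideal)
  have "f \<in> ?P" if f: "f \<in> \<Inter>{J \<in> D. ideal_radical J \<subseteq> ?P}" for f
  proof -
    let ?D = "{J \<in> D. \<not> ideal_radical J \<subseteq> ?P}"
    have "\<exists>g. g \<in> J \<and> g \<notin> ?P" if J: "J \<in> ?D" for J
    proof -
      obtain x n where "x \<notin> ?P" "x ^ n \<in> J" using J by (auto simp: ideal_radical_def)
      then show ?thesis using prime_ideal_power[OF P] by blast
    qed
    then have "\<forall>J\<in>?D. \<exists>g. g \<in> J \<and> g \<notin> ?P" by blast
    \<comment> \<open>One element outside P_i from each component that is not below P_i. Their
      product stays outside P_i and carries f into every component, hence into I.\<close>
    from bchoice[OF this] obtain g where "\<forall>J\<in>?D. g J \<in> J \<and> g J \<notin> ?P" by blast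
    then have g: "\<And>J. J \<in> ?D \<Longrightarrow> g J \<in> J" "\<And>J. J \<in> ?D \<Longrightarrow> g J \<notin> ?P" by simp_all
    have fin: "finite ?D" using D(1) by simp
    have np: "prod g ?D \<notin> ?P" by (rule prime_ideal_prod[OF P fin g(2)])
    have "prod g ?D * f \<in> J" if J: "J \<in> D" for J
    proof -
      have id: "is_ideal J" using D(2)[OF J] by (simp add: primary_ideal_def)
      show ?thesis
      proof (cases "ideal_radical J \<subseteq> ?P")
        case True
        then have "f \<in> J" using f J by blast
        then show ?thesis by (rule is_ideal_mult[OF id])
      next
        case False
        then have JD: "J \<in> ?D" using J by blast
        have "prod g ?D * f = (f * prod g (?D - {J})) * g J"
          unfolding prod.remove[OF fin JD] by (simp only: ac_simps)
        then show ?thesis using is_ideal_mult[OF id g(1)[OF JD]] by (simp only:)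
      qed
    qed
    then have "prod g ?D * f \<in> ?P" using D(3) by (auto simp: complete_edge_ideal_eq)
    then show ?thesis using P np unfolding prime_ideal_def by blast
  qed
  moreover have "f \<in> J" if "f \<in> ?P" "J \<in> D" "ideal_radical J \<subseteq> ?P" for f J
  proof -
    \<comment> \<open>Here x_i is outside P_i, hence outside the radical of J, and f x_i lies in I;
      primariness of J then gives f.\<close>
    have "f * Var i \<in> J" using times_Var_in_complete_edge_ideal_iff that(1,2) D(3) by blast
    moreover have "Var i \<notin> ideal_radical J" using that(3) Var_in_vertex_ideal_iff by blast
    ultimately show ?thesis using D(2)[OF that(2)] unfolding primary_ideal_def by blast
  qed
  ultimately show ?thesis unfolding component_below_def D_def[symmetric] by blast
qed

text \<open>The monomials with at least s factors other than x_i, that is |t| - t_i >= s, written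
  additively to avoid truncated subtraction. One such factor is split off in each step of the
  induction.\<close>

lemma ideal_power_vertex_ideal:
  "ideal_power (vertex_ideal i) s =
    (monomial_ideal {t. s + lookup t i \<le> monomial_degree t} :: ('n::finite, 'k::field) mpoly set)"
proof (induction s)
  case 0
  then show ?case by (simp add: monomial_ideal_def lookup_le_monomial_degree)
next
  case (Suc s)
  let ?S = "\<lambda>s. {t :: 'n \<Rightarrow>\<^sub>0 nat. s + lookup t i \<le> monomial_degree t}"
  let ?G = "{a * b | a b. a \<in> vertex_ideal i \<and> b \<in> (monomial_ideal (?S s) :: ('n, 'k) mpoly set)}"
  have "up_closed (?S (Suc s))"
    unfolding up_closed_def
  proof clarify
    fix a b :: "'n \<Rightarrow>\<^sub>0 nat" assume "Suc s + lookup a i \<le> monomial_degree a"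
    then show "Suc s + lookup (a + b) i \<le> monomial_degree (a + b)"
      using lookup_le_monomial_degree[of b i] by (simp add: lookup_add monomial_degree_add)
  qed
  note ideal = is_ideal_monomial_ideal[OF this, where 'b = 'k]
  have "?G \<subseteq> monomial_ideal (?S (Suc s))"
  proof clarify
    fix a b :: "('n, 'k) mpoly" assume a: "a \<in> vertex_ideal i" and b: "b \<in> monomial_ideal (?S s)"
    have "t \<in> ?S (Suc s)" if t: "t \<in> keys (a * b)" for t
    proof -
      obtain u v where uv: "u \<in> keys a" "v \<in> keys b" "t = u + v"
        using keys_mult[of a b] t by blast
      have "lookup u i < monomial_degree u"
        using uv(1) a unfolding lookup_less_monomial_degree_iff
        by (auto simp: vertex_ideal_def monomial_ideal_def off_axis_def)
      moreover have "s + lookup v i \<le> monomial_degree v"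
        using uv(2) b by (auto simp: monomial_ideal_def)
      ultimately show ?thesis by (simp add: uv(3) lookup_add monomial_degree_add)
    qed
    then show "a * b \<in> monomial_ideal (?S (Suc s))" by (auto simp: monomial_ideal_def)
  qed
  then have "ideal_gen ?G \<subseteq> monomial_ideal (?S (Suc s))" by (rule ideal_gen_minimal[OF _ ideal])
  moreover have "monomial_ideal (?S (Suc s)) \<subseteq> ideal_gen ?G"
  proof (rule monomial_ideal_subsetI[OF is_ideal_ideal_gen])
    fix t and c :: 'k assume t: "t \<in> ?S (Suc s)"
    then have "lookup t i < monomial_degree t" by simp
    then obtain j where j: "j \<noteq> i" "lookup t j > 0"
      unfolding lookup_less_monomial_degree_iff by blast
    then obtain b where b: "t = b + single j 1" using exponent_split_single[of t j] by auto
    have "b \<in> ?S s" using t j by (simp add: b lookup_add monomial_degree_add lookup_single)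
    then have "single b c \<in> monomial_ideal (?S s)" by (simp add: monomial_ideal_def)
    moreover have "Var j \<in> (vertex_ideal i :: ('n, 'k) mpoly set)" using j Var_in_vertex_ideal_iff by blast
    ultimately have "Var j * single b c \<in> ?G" by blast
    then have "Var j * single b c \<in> ideal_gen ?G" by (rule subsetD[OF ideal_gen_superset])
    then show "single t c \<in> ideal_gen ?G" by (simp only: Var_single b)
  qed
  ultimately show ?case by (simp add: Suc)
qed

definition symbolic_exponents :: "nat \<Rightarrow> ('n::finite \<Rightarrow>\<^sub>0 nat) set" where
  "symbolic_exponents s = {a. \<forall>l. s + lookup a l \<le> monomial_degree a}"

lemma symbolic_power_complete_edge_ideal:
  "symbolic_power complete_edge_ideal s =
    (monomial_ideal (symbolic_exponents s) :: ('n::finite, 'k::field) mpoly set)"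
proof -
  have *: "(symbolic_exponents s :: ('n \<Rightarrow>\<^sub>0 nat) set) =
      (\<Inter>i. {t. s + lookup t i \<le> monomial_degree t})"
    by (auto simp: symbolic_exponents_def)
  show ?thesis
    unfolding symbolic_power_def maximal_associated_primes_complete_edge_ideal * monomial_ideal_Inter
    by (simp add: component_below_complete_edge_ideal ideal_power_vertex_ideal)
qed

lemma up_closed_symbolic_exponents: "up_closed (symbolic_exponents s)"
proof -
  have "s + lookup (a + b) l \<le> monomial_degree (a + b)"
    if "s + lookup a l \<le> monomial_degree a" for a b :: "'a \<Rightarrow>\<^sub>0 nat" and l
    using that lookup_le_monomial_degree[of b l] by (simp add: lookup_add monomial_degree_add)
  then show ?thesis by (auto simp: up_closed_def symbolic_exponents_def)
qed

section \<open>Stratification by the vanishing exponents\<close>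

definition koszul_hdim :: "'k::field itself \<Rightarrow> ('n::finite \<Rightarrow> nat) \<Rightarrow> ('n \<Rightarrow>\<^sub>0 nat) set \<Rightarrow> nat \<Rightarrow> int \<Rightarrow> int" where
  "koszul_hdim k r S n j = hdim k r (koszul_basis S j) n"

lemma koszul_basis_iff:
  "(p, T) \<in> koszul_basis S j \<longleftrightarrow> int (monomial_degree p) = j \<and> (\<exists>a\<in>S. p = a + indicator_exp T)"
  by (simp add: koszul_basis_def)

lemma koszul_basis_Un: "koszul_basis (A \<union> B) j = koszul_basis A j \<union> koszul_basis B j"
  by (auto simp: koszul_basis_def)

lemma koszul_basis_disjoint: "A \<inter> B = {} \<Longrightarrow> koszul_basis A j \<inter> koszul_basis B j = {}"
  by (auto simp: koszul_basis_def)

lemma koszul_basis_empty [simp]: "koszul_basis {} j = {}"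
  by (auto simp: koszul_basis_def)

lemma koszul_basis_insert_iff:
  assumes "t \<notin> T"
  shows "(p, insert t T) \<in> koszul_basis S j \<longleftrightarrow>
    int (monomial_degree p) = j \<and> (\<exists>a\<in>S. p = a + single t 1 + indicator_exp T)"
  using assms by (simp add: koszul_basis_iff indicator_exp_insert ac_simps)

lemma nullity_empty [simp]: "nullity TYPE('k::field) r {} n = 0"
  by (subst nullity_discrete) (auto simp: level_def)

lemma koszul_hdim_empty [simp]: "koszul_hdim TYPE('k::field) r {} n j = 0"
  by (simp add: koszul_hdim_def hdim_def level_def)

section \<open>Strata and the additivity of their homology\<close>

definition zero_set :: "('n::finite \<Rightarrow>\<^sub>0 nat) \<Rightarrow> 'n set" where
  "zero_set a = {l. lookup a l = 0}"

lemma zero_set_iff [simp]: "l \<in> zero_set a \<longleftrightarrow> lookup a l = 0"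
  by (simp add: zero_set_def)

definition stratum :: "nat \<Rightarrow> 'n::finite set \<Rightarrow> ('n \<Rightarrow>\<^sub>0 nat) set" where
  "stratum s W = {a \<in> symbolic_exponents s. zero_set a = W}"

definition strata :: "nat \<Rightarrow> 'n::finite set set \<Rightarrow> ('n \<Rightarrow>\<^sub>0 nat) set" where
  "strata s J = {a \<in> symbolic_exponents s. zero_set a \<in> J}"

lemma strata_insert: "strata s (insert W J) = strata s J \<union> stratum s W"
  by (auto simp: strata_def stratum_def)

lemma zero_set_add: "zero_set (a + b) = zero_set a \<inter> zero_set b"
  by (auto simp: lookup_add)

text \<open>Multiplying by a monomial can only shrink the set of vanishing exponents, so
  subset-closed collections J correspond to ideals.\<close>

lemma up_closed_strata:
  assumes "\<And>U V. U \<in> J \<Longrightarrow> V \<subseteq> U \<Longrightarrow> V \<in> J"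
  shows "up_closed (strata s J)"
  unfolding up_closed_def
proof clarify
  fix a b :: "'a \<Rightarrow>\<^sub>0 nat" assume "a \<in> strata s J"
  then have a: "a \<in> symbolic_exponents s" "zero_set a \<in> J" by (simp_all add: strata_def)
  have "a + b \<in> symbolic_exponents s" using a up_closed_symbolic_exponents by (auto simp: up_closed_def)
  moreover have "zero_set (a + b) \<in> J" by (rule assms[OF a(2)]) (auto simp: zero_set_add)
  ultimately show "a + b \<in> strata s J" by (simp add: strata_def)
qed

lemma symbolic_exponents_iff: "a \<in> symbolic_exponents s \<longleftrightarrow> (\<forall>l. s + lookup a l \<le> monomial_degree a)"
  by (simp add: symbolic_exponents_def)

text \<open>Otherwise all exponents are at most 1 and one is 0, so |b| is at most CARD('n) - 1,
  hence at most s. Then s + b_l <= |b| makes every b_l zero, contradicting s >= 1. This is the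
  source of the bound CARD('n) <= s + 1.\<close>

lemma symbolic_exponent_large:
  fixes b :: "'n::finite \<Rightarrow>\<^sub>0 nat"
  assumes s: "1 \<le> s" "CARD('n) \<le> s + 1" and b: "b \<in> symbolic_exponents s" and t: "lookup b t = 0"
  shows "\<exists>l. lookup b l \<ge> 2"
proof (rule ccontr)
  assume "\<not> ?thesis"
  then have le: "lookup b l \<le> 1" for l by (simp add: not_le) (metis less_2_cases le_SucI not_less_eq_eq numeral_2_eq_2)
  have "monomial_degree b = (\<Sum>l\<in>-{t}. lookup b l)" using monomial_degree_remove[of b t] t by simp
  also have "\<dots> \<le> (\<Sum>l\<in>-{t}. 1)" using le by (intro sum_mono) simp
  also have "\<dots> = CARD('n) - 1" by (simp add: Compl_eq_Diff_UNIV card_Diff_subset)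
  finally have deg: "monomial_degree b \<le> s" using s by simp
  have "s + lookup b l \<le> monomial_degree b" for l using b by (simp add: symbolic_exponents_iff)
  then have "lookup b l = 0" for l using deg by (metis add_leE le_antisym le_add1 add_cancel_right_right order_trans)
  then have "monomial_degree b = 0" by (simp add: monomial_degree_def)
  then show False using b s by (auto simp: symbolic_exponents_iff)
qed

text \<open>The cone points in the direction of the largest exponent of the multidegree. That exponent is at
  least 2 here, so lowering it by one neither creates a zero nor leaves the symbolic power.\<close>

lemma nullity_stratum:
  fixes J :: "'n::finite set set"
  assumes r: "inj r" and s: "1 \<le> s" "CARD('n) \<le> s + 1"
    and J: "\<And>U V. U \<in> J \<Longrightarrow> V \<subseteq> U \<Longrightarrow> V \<in> J" and W: "W \<notin> J" "\<And>V. V \<subset> W \<Longrightarrow> V \<in> J"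
  shows "nullity TYPE('k::field) r (koszul_basis (strata s (insert W J)) j) n =
    nullity TYPE('k) r (koszul_basis (strata s J) j) n + nullity TYPE('k) r (koszul_basis (stratum s W) j) n"
  unfolding strata_insert koszul_basis_Un
proof (rule nullity_cone[OF r, where a = argmax_exp])
  show "koszul_basis (strata s J) j \<inter> koszul_basis (stratum s W) j = {}"
    using W by (intro koszul_basis_disjoint) (auto simp: strata_def stratum_def)
  show "downclosed (koszul_basis (strata s J) j)"
    by (intro downclosed_koszul_basis up_closed_strata) (rule J)
  show "downclosed (koszul_basis (strata s J) j \<union> koszul_basis (stratum s W) j)"
    unfolding koszul_basis_Un[symmetric] strata_insert[symmetric]
    by (intro downclosed_koszul_basis up_closed_strata) (use J W in blast)
  fix p :: "'n \<Rightarrow>\<^sub>0 nat" and T :: "'n set" and t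
  let ?i = "argmax_exp p"
  assume A: "(p, T) \<in> koszul_basis (strata s J) j" and t: "t \<notin> T"
    and B: "(p, insert t T) \<in> koszul_basis (stratum s W) j" and i: "?i \<notin> T"
  obtain b where b: "b \<in> symbolic_exponents s" "zero_set b = W" "p = b + single t 1 + indicator_exp T"
    using B unfolding koszul_basis_insert_iff[OF t] by (auto simp: stratum_def)
  let ?a = "b + single t 1"
  have a: "?a \<in> symbolic_exponents s" "zero_set ?a \<in> J"
    using A b(3) by (auto simp: koszul_basis_iff strata_def)
  have p: "lookup p l = lookup b l + (if l = t then 1 else 0) + (if l \<in> T then 1 else 0)" for l
    by (simp add: b(3) lookup_add lookup_single when_def lookup_indicator_exp)
  \<comment> \<open>Multiplying by x_t has moved b into a stratum of J, so it must have filled a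
    zero.\<close>
  have tW: "lookup b t = 0"
  proof (rule ccontr)
    assume "lookup b t \<noteq> 0"
    then have "zero_set ?a = zero_set b" by (auto simp: zero_set_add lookup_single when_def)
    then show False using a b W by simp
  qed
  obtain l where "lookup b l \<ge> 2" using symbolic_exponent_large[OF s b(1) tW] by blast
  then have pi: "lookup p ?i \<ge> 2" using lookup_argmax_exp[of p l] p[of l] by simp
  \<comment> \<open>The exponent of p at t is exactly 1, since b_t = 0 and t is not in T; the
    largest exponent is at least 2.\<close>
  have it: "?i \<noteq> t" using pi p[of t] tW t by auto
  then have bi: "lookup b ?i \<ge> 2" using pi p[of ?i] i by simp
  then obtain c where c: "b = c + single ?i 1" using exponent_split_single[of b ?i] by auto
  let ?a' = "c + single t 1"
  have bl: "lookup b l = lookup c l + (if l = ?i then 1 else 0)" for l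
    by (subst c) (simp add: lookup_add lookup_single when_def)
  have degb: "monomial_degree b = monomial_degree c + 1" by (subst c) (simp add: monomial_degree_add)
  have sb: "s + lookup b l \<le> monomial_degree b" for l using b(1) by (simp add: symbolic_exponents_iff)
  \<comment> \<open>Trading one factor x_i of b for x_t keeps the degree. Only the exponent at t
    grows, and only to 1, which does not exceed b_i, so the bound for b at i covers it.\<close>
  have "s + lookup ?a' l \<le> monomial_degree ?a'" for l
    using sb[of l] sb[of ?i] bl[of l] degb bi tW it
    by (auto simp: lookup_add lookup_single when_def monomial_degree_add split: if_splits)
  moreover have "zero_set ?a' = zero_set ?a"
  proof -
    have "lookup c l = 0 \<longleftrightarrow> lookup b l = 0" for l using bl[of l] bi by (cases "l = ?i") auto
    then show ?thesis by (auto simp: zero_set_add)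
  qed
  ultimately have a': "?a' \<in> strata s J" using a by (simp add: strata_def symbolic_exponents_iff)
  have "p = ?a' + single ?i 1 + indicator_exp T" by (subst b(3), subst c) (simp add: ac_simps)
  then show "(p, insert ?i T) \<in> koszul_basis (strata s J) j"
    unfolding koszul_basis_insert_iff[OF i] using a' A by (auto simp: koszul_basis_iff)
qed (rule finite_koszul_basis)+

text \<open>Strata are added in order of size: a member W of largest cardinality is removed, so that
  the rest is still closed under subsets and contains every proper subset of W.\<close>

lemma koszul_hdim_strata:
  fixes J :: "'n::finite set set"
  assumes r: "inj r" and s: "1 \<le> s" "CARD('n) \<le> s + 1"
    and J: "\<And>U V. U \<in> J \<Longrightarrow> V \<subseteq> U \<Longrightarrow> V \<in> J"
  shows "koszul_hdim TYPE('k::field) r (strata s J) n j = (\<Sum>W\<in>J. koszul_hdim TYPE('k) r (stratum s W) n j)"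
  using J
proof (induction "card J" arbitrary: J)
  case 0
  then have "J = {}" by simp
  then show ?case by (simp add: strata_def)
next
  case (Suc m)
  then have ne: "J \<noteq> {}" by auto
  have "Max (card ` J) \<in> card ` J" using ne by (intro Max_in) auto
  then obtain W where W: "W \<in> J" "card W = Max (card ` J)" by auto
  let ?J = "J - {W}"
  have J': "V \<in> ?J" if "U \<in> ?J" "V \<subseteq> U" for U V
  proof -
    have "card U \<le> card W" using that(1) by (simp add: W(2))
    then have "V \<noteq> W" using that by (metis Diff_iff card_seteq finite insertI1)
    then show ?thesis using Suc(3)[of U V] that by blast
  qed
  have WJ: "V \<in> ?J" if "V \<subset> W" for V using Suc(3)[OF W(1), of V] that by blast
  have JW: "insert W ?J = J" using W(1) by blast
  have nul: "nullity TYPE('k) r (koszul_basis (strata s J) j) m =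
    nullity TYPE('k) r (koszul_basis (strata s ?J) j) m + nullity TYPE('k) r (koszul_basis (stratum s W) j) m" for m
    using nullity_stratum[OF r s J', where W = W and j = j and n = m and 'k = 'k] WJ unfolding JW by simp
  have lev: "card (level (koszul_basis (strata s J) j) m) =
    card (level (koszul_basis (strata s ?J) j) m) + card (level (koszul_basis (stratum s W) j) m)" for m
  proof -
    have "koszul_basis (strata s J) j = koszul_basis (strata s ?J) j \<union> koszul_basis (stratum s W) j"
      using koszul_basis_Un[of "strata s ?J" "stratum s W" j] strata_insert[of s W ?J] unfolding JW by simp
    moreover have "koszul_basis (strata s ?J) j \<inter> koszul_basis (stratum s W) j = {}"
      by (intro koszul_basis_disjoint) (auto simp: strata_def stratum_def)
    ultimately show ?thesis by (simp add: card_level_Un finite_koszul_basis)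
  qed
  have "card ?J = m" using Suc(2) W(1) by simp
  then have "koszul_hdim TYPE('k) r (strata s ?J) n j = (\<Sum>W\<in>?J. koszul_hdim TYPE('k) r (stratum s W) n j)"
    using Suc(1)[of ?J] J' by blast
  moreover have "koszul_hdim TYPE('k) r (strata s J) n j =
    koszul_hdim TYPE('k) r (strata s ?J) n j + koszul_hdim TYPE('k) r (stratum s W) n j"
    by (simp add: koszul_hdim_def hdim_def nul lev)
  ultimately show ?case
    using sum.remove[of J W "\<lambda>W. koszul_hdim TYPE('k) r (stratum s W) n j"] W(1) by simp
qed

lemma koszul_hdim_symbolic_exponents:
  fixes r :: "'n::finite \<Rightarrow> nat"
  assumes "inj r" "1 \<le> s" "CARD('n) \<le> s + 1"
  shows "koszul_hdim TYPE('k::field) r (symbolic_exponents s) n j =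
    (\<Sum>W\<in>UNIV. koszul_hdim TYPE('k) r (stratum s W) n j)"
  using koszul_hdim_strata[OF assms, of UNIV, where 'k = 'k] by (simp add: strata_def)

section \<open>Strata as shifts of smaller symbolic powers\<close>

lemma koszul_hdim_translate:
  "koszul_hdim TYPE('k::field) r ((\<lambda>a. a + q) ` S) n j = koszul_hdim TYPE('k) r S n (j - int (monomial_degree q))"
proof -
  let ?X = "koszul_basis S (j - int (monomial_degree q))" and ?Y = "koszul_basis ((\<lambda>a. a + q) ` S) j"
  let ?f = "\<lambda>(p, T). (p + q, T)"
  have bij: "bij_betw ?f ?X ?Y"
  proof (rule bij_betw_imageI)
    show "inj_on ?f ?X" by (auto simp: inj_on_def)
    show "?f ` ?X = ?Y"
    proof (intro equalityI subsetI)
      fix y assume "y \<in> ?f ` ?X"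
      then show "y \<in> ?Y"
        by (force simp: koszul_basis_def monomial_degree_add ac_simps)
    next
      fix y assume "y \<in> ?Y"
      then obtain a T where a: "a \<in> S" "y = (a + q + indicator_exp T, T)"
        "int (monomial_degree (a + q + indicator_exp T)) = j"
        by (auto simp: koszul_basis_def)
      then have "(a + indicator_exp T, T) \<in> ?X" by (auto simp: koszul_basis_iff monomial_degree_add)
      then show "y \<in> ?f ` ?X" by (rule image_eqI[rotated]) (simp add: a ac_simps)
    qed
  qed
  have mem: "(p + q, T) \<in> ?Y \<longleftrightarrow> (p, T) \<in> ?X" for p T
  proof -
    have "inj ?f" by (auto simp: inj_def)
    then show ?thesis
      using inj_image_mem_iff[of ?f "(p, T)" ?X] unfolding bij_betw_imp_surj_on[OF bij] by simp
  qed
  have bd: "koszul_boundary r (\<lambda>y. if y \<in> ?X then 1 * g (?f y) else 0) x = 1 * koszul_boundary r g (?f x)"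
    if g: "\<And>y. y \<notin> ?Y \<Longrightarrow> g y = 0" for g :: "_ \<Rightarrow> 'k" and x
  proof (cases x)
    case (Pair p T)
    have "(if (p, insert t T) \<in> ?X then g (p + q, insert t T) else 0) = g (p + q, insert t T)" for t
      using g mem by auto
    then show ?thesis by (simp add: Pair koszul_boundary_apply cong: if_cong)
  qed
  have "nullity TYPE('k) r ?X (m + 0) = nullity TYPE('k) r ?Y (m + 0)"
    "card (level ?X (m + 0)) = card (level ?Y (m + 0))" for m
    by (rule nullity_reindex[OF finite_koszul_basis bij _ _ bd, where d = 0]; simp add: case_prod_beta)+
  then show ?thesis by (simp add: koszul_hdim_def hdim_def)
qed

text \<open>Dividing by the product of all variables lowers |a| by CARD('n) and each exponent by 1,
  so the bound on |a| - a_l drops by CARD('n) - 1.\<close>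

lemma koszul_hdim_stratum_empty:
  assumes "CARD('n::finite) \<le> s + 1"
  shows "koszul_hdim TYPE('k::field) r (stratum s ({} :: 'n set)) n j =
    koszul_hdim TYPE('k) r (symbolic_exponents (s + 1 - CARD('n))) n (j - int CARD('n))"
proof -
  let ?q = "indicator_exp (UNIV :: 'n set)"
  have "stratum s ({} :: 'n set) = (\<lambda>a. a + ?q) ` symbolic_exponents (s + 1 - CARD('n))"
  proof (intro equalityI subsetI)
    fix a :: "'n \<Rightarrow>\<^sub>0 nat" assume a: "a \<in> stratum s {}"
    then have "lookup a l > 0" for l by (auto simp: stratum_def set_eq_iff)
    then obtain b where b: "a = b + ?q" using exponent_split_indicator[of a UNIV] by auto
    have "s + 1 - CARD('n) + lookup b l \<le> monomial_degree b" for l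
    proof -
      have "s + lookup a l \<le> monomial_degree a" using a by (simp add: stratum_def symbolic_exponents_iff)
      then show ?thesis using assms by (simp add: b lookup_add lookup_indicator_exp monomial_degree_add)
    qed
    then have "b \<in> symbolic_exponents (s + 1 - CARD('n))" by (simp add: symbolic_exponents_iff)
    then show "a \<in> (\<lambda>a. a + ?q) ` symbolic_exponents (s + 1 - CARD('n))" using b by blast
  next
    fix a assume "a \<in> (\<lambda>a. a + ?q) ` symbolic_exponents (s + 1 - CARD('n))"
    then obtain b where b: "a = b + ?q" "b \<in> symbolic_exponents (s + 1 - CARD('n))" by blast
    have "s + lookup a l \<le> monomial_degree a" for l
    proof -
      have "s + 1 - CARD('n) + lookup b l \<le> monomial_degree b" using b(2) by (simp add: symbolic_exponents_iff)
      then show ?thesis using assms by (simp add: b(1) lookup_add lookup_indicator_exp monomial_degree_add)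
    qed
    then show "a \<in> stratum s {}"
      by (auto simp: stratum_def symbolic_exponents_iff b(1) lookup_add lookup_indicator_exp)
  qed
  then show ?thesis by (simp add: koszul_hdim_translate)
qed

section \<open>Exponents on a coordinate hyperplane and modules killed by one variable\<close>

definition extend_exp :: "('m::finite \<Rightarrow> 'n) \<Rightarrow> ('m \<Rightarrow>\<^sub>0 nat) \<Rightarrow> 'n::finite \<Rightarrow>\<^sub>0 nat" where
  "extend_exp e a = (\<Sum>i\<in>UNIV. single (e i) (lookup a i))"

context
  fixes e :: "'m::finite \<Rightarrow> 'n::finite" and q :: 'n
  assumes e: "inj e" "range e = - {q}"
begin

lemma lookup_extend_exp: "lookup (extend_exp e a) (e i) = lookup a i" "lookup (extend_exp e a) q = 0"
proof -
  show "lookup (extend_exp e a) (e i) = lookup a i"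
    using e(1) by (simp add: extend_exp_def lookup_sum lookup_single when_def inj_eq)
  have "e i \<noteq> q" for i using e(2) by auto
  then show "lookup (extend_exp e a) q = 0" by (simp add: extend_exp_def lookup_sum lookup_single when_def)
qed

lemma index_cases: "(\<exists>i. l = e i) \<or> l = q"
  using e(2) by auto

lemma exponent_eqI: "(\<And>i. lookup a (e i) = lookup b (e i)) \<Longrightarrow> lookup a q = lookup b q \<Longrightarrow> a = b"
  using index_cases by (intro poly_mapping_eqI) metis

lemma extend_exp_add: "extend_exp e (a + b) = extend_exp e a + extend_exp e b"
  by (rule exponent_eqI) (simp_all add: lookup_add lookup_extend_exp)

lemma extend_exp_inj: "extend_exp e a = extend_exp e b \<longleftrightarrow> a = b"
proof
  assume "extend_exp e a = extend_exp e b"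
  then have "lookup a i = lookup b i" for i using lookup_extend_exp(1) by metis
  then show "a = b" by (rule poly_mapping_eqI)
qed simp

lemma e_neq_q [simp]: "e i \<noteq> q" "q \<noteq> e i"
  using e(2) by auto

lemma q_notin_image [simp]: "q \<notin> e ` T"
  using e(2) by auto

lemma e_in_image [simp]: "e i \<in> e ` T \<longleftrightarrow> i \<in> T"
  using e(1) by (simp add: inj_image_mem_iff)

lemma extend_indicator_exp: "extend_exp e (indicator_exp T) = indicator_exp (e ` T)"
  by (rule exponent_eqI) (simp_all add: lookup_extend_exp lookup_indicator_exp)

lemma monomial_degree_extend_exp: "monomial_degree (extend_exp e a) = monomial_degree a"
proof -
  have "monomial_degree (extend_exp e a) = (\<Sum>l\<in>range e. lookup (extend_exp e a) l)"
    using monomial_degree_remove[of "extend_exp e a" q] e(2) by (simp add: lookup_extend_exp)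
  also have "\<dots> = monomial_degree a"
    using e(1) by (simp add: sum.reindex lookup_extend_exp monomial_degree_def)
  finally show ?thesis .
qed

lemma image_decomp: "T = (if q \<in> T then insert q (e ` (e -` T)) else e ` (e -` T))"
  using index_cases by (auto simp: image_iff)

lemma card_image_e: "card (e ` T) = card T"
  using e(1) by (simp add: card_image inj_on_subset)

lemma Compl_image_e: "- insert q (e ` T) = e ` (- T)"
  using index_cases e(1) by (auto simp: inj_eq)

lemma koszul_sign_image: "koszul_sign r (e i) (e ` T) = koszul_sign (r \<circ> e) i T"
proof -
  have "{u \<in> e ` T. r u < r (e i)} = e ` {u \<in> T. (r \<circ> e) u < (r \<circ> e) i}" by auto
  then show ?thesis by (simp add: koszul_sign_def card_image_e del: o_apply)
qed

text \<open>A module killed by \<open>x\<^sub>q\<close>: its Koszul complex is that over the remaining variables, tensored with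
  the complex \<open>k(-1) \<rightarrow> k\<close> with zero differential.\<close>

lemma koszul_hdim_extend:
  fixes S :: "('m \<Rightarrow>\<^sub>0 nat) set"
  shows "koszul_hdim TYPE('k::field) r (extend_exp e ` S) n j =
    koszul_hdim TYPE('k) (r \<circ> e) S n j + (if n = 0 then 0 else koszul_hdim TYPE('k) (r \<circ> e) S (n - 1) (j - 1))"
proof -
  let ?X0 = "koszul_basis S j" and ?X1 = "koszul_basis S (j - 1)"
  let ?f0 = "\<lambda>(p, T). (extend_exp e p, e ` T)"
  \<comment> \<open>Adjoining q to T also raises the multidegree, since e_q has the degree of x_q.
    This accounts for the degree j - 1 in \<open>?X1\<close>.\<close>
  let ?f1 = "\<lambda>(p, T). (extend_exp e p + single q 1, insert q (e ` T))"
  let ?Y0 = "?f0 ` ?X0" and ?Y1 = "?f1 ` ?X1"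
  have im_inj: "e ` T = e ` U \<longleftrightarrow> T = U" for T U using e(1) by (rule inj_image_eq_iff)
  have ins_inj: "insert q (e ` T) = insert q (e ` U) \<longleftrightarrow> T = U" for T U
    using im_inj[of T U] by (metis insert_ident q_notin_image)
  have Y: "koszul_basis (extend_exp e ` S) j = ?Y0 \<union> ?Y1"
  proof (intro equalityI subsetI)
    fix y assume "y \<in> koszul_basis (extend_exp e ` S) j"
    then obtain a T where a: "a \<in> S" "y = (extend_exp e a + indicator_exp T, T)"
      "int (monomial_degree (extend_exp e a + indicator_exp T)) = j"
      by (auto simp: koszul_basis_def)
    define U where "U = e -` T"
    let ?p = "a + indicator_exp U"
    show "y \<in> ?Y0 \<union> ?Y1"
    proof (cases "q \<in> T")
      case True
      then have T: "T = insert q (e ` U)" using image_decomp[of T] unfolding U_def[symmetric] by simp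
      have ind: "indicator_exp T = indicator_exp (e ` U) + single q 1"
        by (subst T) (rule indicator_exp_insert[OF q_notin_image])
      have "(?p, U) \<in> ?X1"
        using a ind by (auto simp: koszul_basis_iff monomial_degree_add monomial_degree_extend_exp card_image_e)
      moreover have "y = ?f1 (?p, U)"
        using T by (simp add: a(2) indicator_exp_insert extend_exp_add extend_indicator_exp ac_simps)
      ultimately show ?thesis by blast
    next
      case False
      then have T: "T = e ` U" using image_decomp[of T] unfolding U_def[symmetric] by simp
      have "indicator_exp T = indicator_exp (e ` U)" by (subst T) simp
      then have "y = ?f0 (?p, U)"
        using T by (simp add: a(2) extend_exp_add extend_indicator_exp)
      moreover have "(?p, U) \<in> ?X0"
        using a T card_image_e[of U] by (auto simp: koszul_basis_iff monomial_degree_add monomial_degree_extend_exp)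
      ultimately show ?thesis by blast
    qed
  next
    fix y assume "y \<in> ?Y0 \<union> ?Y1"
    then show "y \<in> koszul_basis (extend_exp e ` S) j"
      by (auto simp: koszul_basis_def extend_exp_add extend_indicator_exp indicator_exp_insert monomial_degree_add
          monomial_degree_extend_exp card_image_e ac_simps)
  qed
  \<comment> \<open>The multidegree has exponent 0 at q on one part and 1 on the other, so no
    differential connects them.\<close>
  have disj: "fst ` ?Y0 \<inter> fst ` ?Y1 = {}"
  proof -
    have "extend_exp e p \<noteq> extend_exp e p' + single q 1" for p p'
    proof
      assume "extend_exp e p = extend_exp e p' + single q 1"
      from arg_cong[OF this, of "\<lambda>x. lookup x q"] show False by (simp add: lookup_add lookup_extend_exp)
    qed
    then show ?thesis by force
  qed
  have inj0: "inj ?f0" by (auto simp: inj_on_def extend_exp_inj im_inj)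
  have inj1: "inj ?f1" by (auto simp: inj_on_def extend_exp_inj ins_inj)
  have bij0: "bij_betw ?f0 ?X0 ?Y0"
    by (intro bij_betw_imageI inj_on_subset[OF inj0]) auto
  have bij1: "bij_betw ?f1 ?X1 ?Y1"
    by (intro bij_betw_imageI inj_on_subset[OF inj1]) auto
  have mem0: "(extend_exp e p, e ` T) \<in> ?Y0 \<longleftrightarrow> (p, T) \<in> ?X0" for p T
    using inj_image_mem_iff[OF inj0, of "(p, T)" ?X0] by simp
  have mem1: "(extend_exp e p + single q 1, insert q (e ` T)) \<in> ?Y1 \<longleftrightarrow> (p, T) \<in> ?X1" for p T
    using inj_image_mem_iff[OF inj1, of "(p, T)" ?X1] by simp
  \<comment> \<open>The sign of moving e_q past the elements numbered after it; it compensates the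
    changes of sign that q causes in the differential.\<close>
  let ?sg = "\<lambda>(p :: 'm \<Rightarrow>\<^sub>0 nat, T). (- 1 :: 'k) ^ card {u \<in> T. r q < r (e u)}"
  have bd0: "koszul_boundary (r \<circ> e) (\<lambda>y. if y \<in> ?X0 then 1 * g (?f0 y) else 0) x = 1 * koszul_boundary r g (?f0 x)"
    if g: "\<And>y. y \<notin> ?Y0 \<Longrightarrow> g y = 0" for g :: "_ \<Rightarrow> 'k" and x
  proof (cases x)
    case (Pair p T)
    have g0: "g (extend_exp e p, insert q (e ` T)) = 0"
    proof (rule g)
      have "insert q (e ` T) \<noteq> e ` U" for U using q_notin_image[of U] by blast
      then show "(extend_exp e p, insert q (e ` T)) \<notin> ?Y0" by auto
    qed
    have "koszul_boundary r g (?f0 x) =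
      (\<Sum>t\<in>insert q (e ` (- T)). koszul_sign r t (e ` T) * g (extend_exp e p, insert t (e ` T)))"
    proof -
      have "- e ` T = insert q (e ` (- T))" using Compl_image_e[of T] by auto
      then show ?thesis by (simp add: Pair koszul_boundary_apply)
    qed
    also have "\<dots> = (\<Sum>i\<in>- T. koszul_sign (r \<circ> e) i T * g (extend_exp e p, e ` insert i T))"
      using e(1) by (simp add: g0 sum.reindex inj_on_subset koszul_sign_image)
    also have "\<dots> = koszul_boundary (r \<circ> e) (\<lambda>y. if y \<in> ?X0 then 1 * g (?f0 y) else 0) x"
      using g mem0[of p "insert _ T"] by (simp add: Pair koszul_boundary_apply) (intro sum.cong; auto)
    finally show ?thesis by simp
  qed
  have bd1: "koszul_boundary (r \<circ> e) (\<lambda>y. if y \<in> ?X1 then ?sg y * g (?f1 y) else 0) x =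
      ?sg x * koszul_boundary r g (?f1 x)"
    if g: "\<And>y. y \<notin> ?Y1 \<Longrightarrow> g y = 0" for g :: "_ \<Rightarrow> 'k" and x
  proof (cases x)
    case (Pair p T)
    let ?p = "extend_exp e p + single q 1"
    have "?sg x * koszul_boundary r g (?f1 x) =
      (\<Sum>i\<in>- T. ?sg x * (koszul_sign r (e i) (insert q (e ` T)) * g (?p, insert q (e ` insert i T))))"
      using e(1) by (simp add: Pair koszul_boundary_apply Compl_image_e sum.reindex inj_on_subset
          sum_distrib_left insert_commute)
    also have "\<dots> = (\<Sum>i\<in>- T. koszul_sign (r \<circ> e) i T * (?sg (p, insert i T) * g (?p, insert q (e ` insert i T))))"
    proof (rule sum.cong[OF refl])
      fix i assume "i \<in> - T"
      then have "{u \<in> insert i T. r q < r (e u)} =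
          (if r q < r (e i) then insert i {u \<in> T. r q < r (e u)} else {u \<in> T. r q < r (e u)})"
        and i: "i \<notin> {u \<in> T. r q < r (e u)}" by auto
      then have "?sg (p, insert i T) = (if r q < r (e i) then - ?sg (p, T) else ?sg (p, T))"
        by (simp only: split_conv card_insert_disjoint[OF finite i] power_Suc mult_minus1 split: if_split) simp
      then show "?sg x * (koszul_sign r (e i) (insert q (e ` T)) * g (?p, insert q (e ` insert i T))) =
        koszul_sign (r \<circ> e) i T * (?sg (p, insert i T) * g (?p, insert q (e ` insert i T)))"
        unfolding Pair koszul_sign_insert[OF q_notin_image] koszul_sign_image by (simp del: image_insert)
    qed
    also have "\<dots> = koszul_boundary (r \<circ> e) (\<lambda>y. if y \<in> ?X1 then ?sg y * g (?f1 y) else 0) x"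
      unfolding Pair koszul_boundary_apply
    proof (rule sum.cong[OF refl])
      fix i
      show "koszul_sign (r \<circ> e) i T * (?sg (p, insert i T) * g (?p, insert q (e ` insert i T))) =
        koszul_sign (r \<circ> e) i T *
          (if (p, insert i T) \<in> ?X1 then ?sg (p, insert i T) * g (?f1 (p, insert i T)) else 0)"
        using g[of "(?p, insert q (e ` insert i T))"] mem1[of p "insert i T"] by auto
    qed
    finally show ?thesis by simp
  qed
  have card0: "card (snd x) + 0 = card (snd (?f0 x)) + 0" for x by (cases x) (simp add: card_image_e)
  have card1: "card (snd x) + 1 = card (snd (?f1 x)) + 0" for x by (cases x) (simp add: card_image_e)
  have sg: "?sg x \<noteq> 0" for x by (cases x) simp
  note R0 = nullity_reindex[where sg = "\<lambda>_. 1", OF finite_koszul_basis bij0 _ card0 bd0]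
  note R1 = nullity_reindex[where sg = ?sg, OF finite_koszul_basis bij1 sg card1 bd1]
  have n0: "nullity TYPE('k) (r \<circ> e) ?X0 m = nullity TYPE('k) r ?Y0 m" "card (level ?X0 m) = card (level ?Y0 m)" for m
    using R0(1)[of m] R0(2)[of m] by (simp_all add: comp_def)
  have n1: "nullity TYPE('k) (r \<circ> e) ?X1 m = nullity TYPE('k) r ?Y1 (Suc m)"
    "card (level ?X1 m) = card (level ?Y1 (Suc m))" for m
    using R1(1)[of m] R1(2)[of m] by (simp_all add: comp_def)
  have fin: "finite ?Y0" "finite ?Y1" by (intro finite_imageI finite_koszul_basis)+
  have nY: "nullity TYPE('k) r (?Y0 \<union> ?Y1) m = nullity TYPE('k) r ?Y0 m + nullity TYPE('k) r ?Y1 m" for m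
    by (rule nullity_disjoint[OF fin disj])
  have cY: "card (level (?Y0 \<union> ?Y1) m) = card (level ?Y0 m) + card (level ?Y1 m)" for m
    by (rule card_level_Un[OF fin]) (use disj in blast)
  have "level ?Y1 0 = {}" by (auto simp: level_def)
  then have z: "nullity TYPE('k) r ?Y1 0 = 0"
    using nullity_discrete[OF fin(2), of 0 r, where 'k = 'k] by simp
  \<comment> \<open>At level 0 every chain is a cycle, so the part containing q contributes nothing
    for n = 0. This is the default value in the statement.\<close>
  have z': "nullity TYPE('k) (r \<circ> e) ?X1 0 = card (level ?X1 0)"
    by (rule nullity_discrete[OF finite_koszul_basis]) (auto simp: level_def)
  define Y0 Y1 where "Y0 = ?Y0" and "Y1 = ?Y1"
  note folded = Y[folded Y0_def Y1_def] nY[folded Y0_def Y1_def] cY[folded Y0_def Y1_def]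
  note folded_n = n0[folded Y0_def] n1[folded Y1_def] z[folded Y1_def]
  show ?thesis
  proof (cases n)
    case 0
    then show ?thesis
      using folded_n(3,4)[of 0] folded_n(5) z' by (simp add: koszul_hdim_def hdim_def folded folded_n(1,2))
  next
    case (Suc m)
    then show ?thesis
      by (simp add: koszul_hdim_def hdim_def folded folded_n)
  qed
qed

lemma stratum_singleton:
  assumes s: "1 \<le> CARD('m)" "CARD('m) \<le> s + 1"
  shows "stratum s {q} = (\<lambda>a. a + indicator_exp (- {q})) ` (extend_exp e ` symbolic_exponents (s + 1 - CARD('m)))"
proof (intro equalityI subsetI)
  let ?q = "indicator_exp (- {q})"
  have q: "card (- {q}) = CARD('m)" using card_image_e[of UNIV] e(2) by simp
  have lq: "lookup (extend_exp e c + ?q) (e i) = lookup c i + 1" "lookup (extend_exp e c + ?q) q = 0" for c i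
    using q_notin_image e(2) by (auto simp: lookup_add lookup_extend_exp lookup_indicator_exp)
  have dq: "monomial_degree (extend_exp e c + ?q) = monomial_degree c + CARD('m)" for c
    by (simp add: monomial_degree_add monomial_degree_extend_exp q)
  {
    fix a assume a: "a \<in> stratum s {q}"
    then have z: "lookup a l = 0 \<longleftrightarrow> l = q" for l by (auto simp: stratum_def set_eq_iff)
    define c where "c = Poly_Mapping.Abs_poly_mapping (\<lambda>i. lookup a (e i) - 1)"
    have c: "lookup c i = lookup a (e i) - 1" for i by (simp add: c_def)
    have ac: "a = extend_exp e c + ?q"
    proof (rule exponent_eqI)
      show "lookup a (e i) = lookup (extend_exp e c + ?q) (e i)" for i
        using z[of "e i"] e(2) by (auto simp: lq c)
      show "lookup a q = lookup (extend_exp e c + ?q) q" using z by (simp add: lq)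
    qed
    have "s + 1 - CARD('m) + lookup c i \<le> monomial_degree c" for i
    proof -
      have "s + lookup a (e i) \<le> monomial_degree a" using a by (simp add: stratum_def symbolic_exponents_iff)
      then show ?thesis unfolding ac lq dq using s by simp
    qed
    then have "c \<in> symbolic_exponents (s + 1 - CARD('m))" by (simp add: symbolic_exponents_iff)
    then show "a \<in> (\<lambda>a. a + ?q) ` (extend_exp e ` symbolic_exponents (s + 1 - CARD('m)))" using ac by blast
  next
    fix a assume "a \<in> (\<lambda>a. a + ?q) ` (extend_exp e ` symbolic_exponents (s + 1 - CARD('m)))"
    then obtain c where c: "c \<in> symbolic_exponents (s + 1 - CARD('m))" "a = extend_exp e c + ?q" by blast
    have i: "s + lookup a (e i) \<le> monomial_degree a" for i
    proof -
      have "s + 1 - CARD('m) + lookup c i \<le> monomial_degree c" using c(1) by (simp add: symbolic_exponents_iff)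
      then show ?thesis unfolding c(2) lq dq using s by simp
    qed
    \<comment> \<open>The exponent at q is zero, so the bound at any other index implies this one;
      \<open>undefined\<close> merely names an index.\<close>
    have "s + lookup a q \<le> monomial_degree a" using i[of undefined] lq(2)[of c] c(2) by simp
    then have "s + lookup a l \<le> monomial_degree a" for l using i index_cases[of l] by auto
    then have as: "a \<in> symbolic_exponents s" by (simp add: symbolic_exponents_iff)
    have "l \<in> zero_set a \<longleftrightarrow> l = q" for l
    proof (cases "l = q")
      case True
      then show ?thesis using lq(2)[of c] c(2) by simp
    next
      case False
      then obtain i where "l = e i" using index_cases[of l] by blast
      then have "lookup a l = lookup c i + 1" unfolding c(2) using lq(1) by simp
      then show ?thesis using False by simp
    qed
    then have "zero_set a = {q}" by blast
    then show "a \<in> stratum s {q}" unfolding stratum_def using as by blast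
  }
qed

text \<open>With three remaining variables, the division gives the shift by 3 and the passage s to s
  - 2; the killed variable adds the copy one position and one degree higher.\<close>

lemma koszul_hdim_stratum_singleton:
  assumes "CARD('m) \<le> s + 1"
  shows "koszul_hdim TYPE('k::field) r (stratum s {q}) n j =
    koszul_hdim TYPE('k) (r \<circ> e) (symbolic_exponents (s + 1 - CARD('m))) n (j - int CARD('m)) +
    (if n = 0 then 0 else
      koszul_hdim TYPE('k) (r \<circ> e) (symbolic_exponents (s + 1 - CARD('m))) (n - 1) (j - int CARD('m) - 1))"
proof -
  have "card (- {q}) = CARD('m)" using card_image_e[of UNIV] e(2) by simp
  moreover have "1 \<le> CARD('m)" by (simp add: Suc_le_eq)
  ultimately show ?thesis
    using stratum_singleton[OF _ assms] by (simp add: koszul_hdim_translate koszul_hdim_extend)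
qed

end

text \<open>In these degrees the coefficient satisfies |a| > 2s, and for i outside T the largest
  exponent of p is also the largest of a. For l other than i, 2 a_l <= a_l + a_i <= |a|, so |a| -
  a_l >= |a|/2 > s leaves room to lower a_i by one. At l = i both sides of the bound drop
  together.\<close>

lemma koszul_hdim_symbolic_exponents_eq_zero:
  fixes r :: "'n::finite \<Rightarrow> nat"
  assumes r: "inj r" and j: "j > 2 * int s + int n"
  shows "koszul_hdim TYPE('k::field) r (symbolic_exponents s) n j = 0"
  unfolding koszul_hdim_def
proof (rule hdim_acyclic[OF r finite_koszul_basis, where a = argmax_exp])
  note down = downclosed_koszul_basis[OF up_closed_symbolic_exponents, of s j]
  fix p :: "'n \<Rightarrow>\<^sub>0 nat" and T :: "'n set"
  let ?i = "argmax_exp p"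
  {
    assume X: "(p, T) \<in> level (koszul_basis (symbolic_exponents s) j) n" and i: "?i \<notin> T"
    then obtain a where a: "a \<in> symbolic_exponents s" "p = a + indicator_exp T"
      "int (monomial_degree p) = j" "card T = n"
      by (auto simp: level_def koszul_basis_iff)
    have deg: "monomial_degree a > 2 * s" using a j by (simp add: monomial_degree_add)
    have le: "lookup a l \<le> lookup a ?i" for l
    proof -
      have "lookup a l \<le> lookup p l" by (simp add: a(2) lookup_add)
      also have "\<dots> \<le> lookup p ?i" by (rule lookup_argmax_exp)
      also have "\<dots> = lookup a ?i" using i by (simp add: a(2) lookup_add lookup_indicator_exp)
      finally show ?thesis .
    qed
    have "lookup a ?i > 0"
    proof (rule ccontr)
      assume "\<not> ?thesis"
      then have "lookup a l = 0" for l using le[of l] by simp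
      then show False using deg by (simp add: monomial_degree_def)
    qed
    then obtain c where c: "a = c + single ?i 1" using exponent_split_single[of a ?i] by auto
    have dc: "monomial_degree a = monomial_degree c + 1" by (subst c) (simp add: monomial_degree_add)
    have lc: "lookup a l = lookup c l + (if l = ?i then 1 else 0)" for l
      by (subst c) (simp add: lookup_add lookup_single when_def)
    have "s + lookup c l \<le> monomial_degree c" for l
    proof (cases "l = ?i")
      case True
      then show ?thesis using a(1) lc[of l] dc by (auto simp: symbolic_exponents_iff dest!: spec[of _ l])
    next
      case False
      have "lookup a l + lookup a ?i \<le> monomial_degree a"
      proof -
        have "lookup a ?i \<le> (\<Sum>m\<in>-{l}. lookup a m)" using False by (intro member_le_sum) auto
        then show ?thesis using monomial_degree_remove[of a l] by simp
      qed
      then show ?thesis using le[of l] deg dc lc[of l] False by simp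
    qed
    then have "c \<in> symbolic_exponents s" by (simp add: symbolic_exponents_iff)
    moreover have "p = c + single ?i 1 + indicator_exp T" using a(2) c by simp
    ultimately show "(p, insert ?i T) \<in> koszul_basis (symbolic_exponents s) j"
      unfolding koszul_basis_insert_iff[OF i] using a(3) by blast
  next
    assume "(p, T) \<in> level (koszul_basis (symbolic_exponents s) j) n" "?i \<in> T"
    then show "(p, T - {?i}) \<in> koszul_basis (symbolic_exponents s) j"
      using down by (auto simp: level_def downclosed_def)
  next
    fix t u assume "(p, insert u (insert t T)) \<in> koszul_basis (symbolic_exponents s) j"
    then show "(p, insert t T) \<in> koszul_basis (symbolic_exponents s) j"
      using downclosed_insert[OF down, of p u "insert t T"] by (cases "u \<in> insert t T") (auto simp: insert_absorb)
  }
qed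

section \<open>Strata supported on at most two variables\<close>

lemma monomial_degree_two:
  assumes "x \<noteq> y" "\<And>l. l \<noteq> x \<Longrightarrow> l \<noteq> y \<Longrightarrow> lookup a l = 0"
  shows "monomial_degree a = lookup a x + lookup a y"
proof -
  have "monomial_degree a = (\<Sum>l\<in>{x, y}. lookup a l)"
    unfolding monomial_degree_def using assms(2) by (intro sum.mono_neutral_right) auto
  then show ?thesis using assms(1) by simp
qed

text \<open>Here |a| = a_x + a_y, so the bound at x speaks about a_y and conversely: the stratum is
  x^s y^s k[x,y]. Positivity of s keeps x and y out of the zero set.\<close>

lemma stratum_two_iff:
  assumes "x \<noteq> y" "1 \<le> s"
  shows "a \<in> stratum s (- {x, y}) \<longleftrightarrow> s \<le> lookup a x \<and> s \<le> lookup a y \<and> (\<forall>l. l \<noteq> x \<longrightarrow> l \<noteq> y \<longrightarrow> lookup a l = 0)"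
proof
  assume a: "a \<in> stratum s (- {x, y})"
  then have z: "\<forall>l. l \<noteq> x \<longrightarrow> l \<noteq> y \<longrightarrow> lookup a l = 0" by (auto simp: stratum_def set_eq_iff)
  then have "monomial_degree a = lookup a x + lookup a y" using assms(1) by (intro monomial_degree_two) auto
  moreover have "s + lookup a x \<le> monomial_degree a" "s + lookup a y \<le> monomial_degree a"
    using a by (simp_all add: stratum_def symbolic_exponents_iff)
  ultimately show "s \<le> lookup a x \<and> s \<le> lookup a y \<and> (\<forall>l. l \<noteq> x \<longrightarrow> l \<noteq> y \<longrightarrow> lookup a l = 0)" using z by simp
next
  assume a: "s \<le> lookup a x \<and> s \<le> lookup a y \<and> (\<forall>l. l \<noteq> x \<longrightarrow> l \<noteq> y \<longrightarrow> lookup a l = 0)"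
  then have d: "monomial_degree a = lookup a x + lookup a y" using assms(1) by (intro monomial_degree_two) auto
  have "s + lookup a l \<le> monomial_degree a" for l using a d by (cases "l = x"; cases "l = y") auto
  moreover have "zero_set a = - {x, y}" using a assms(2) by (auto simp: set_eq_iff)
  ultimately show "a \<in> stratum s (- {x, y})" by (simp add: stratum_def symbolic_exponents_iff)
qed

text \<open>Away from the multidegrees whose exponents at \<open>x\<close> and \<open>y\<close> are both \<open>s\<close> the complex is acyclic;
  in those multidegrees it has zero differential.\<close>

lemma koszul_hdim_stratum_two:
  fixes x y :: "'n::finite"
  assumes r: "inj r" and xy: "x \<noteq> y" and s: "2 \<le> s"
  shows "koszul_hdim TYPE('k::field) r (stratum s (- {x, y})) n j =
    (if j = 2 * int s + int n then int ((CARD('n) - 2) choose n) else 0)"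
proof -
  let ?W = "- {x, y}"
  let ?X = "koszul_basis (stratum s ?W) j"
  define A where "A = {(p, T) \<in> ?X. lookup p x = s \<and> lookup p y = s}"
  define B where "B = {(p, T) \<in> ?X. \<not> (lookup p x = s \<and> lookup p y = s)}"
  have X: "?X = A \<union> B" by (auto simp: A_def B_def)
  have fin: "finite A" "finite B" using finite_koszul_basis[of "stratum s ?W" j] unfolding X by simp_all
  have disj: "fst ` A \<inter> fst ` B = {}" by (auto simp: A_def B_def)
  have memX: "(p, T) \<in> ?X \<longleftrightarrow> int (monomial_degree p) = j \<and>
    (\<exists>a. p = a + indicator_exp T \<and> s \<le> lookup a x \<and> s \<le> lookup a y \<and> (\<forall>l. l \<noteq> x \<longrightarrow> l \<noteq> y \<longrightarrow> lookup a l = 0))" for p T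
    using s by (auto simp: koszul_basis_iff stratum_two_iff[OF xy])
  \<comment> \<open>Eliminating the coefficient: away from x and y the multidegree is the indicator
    of T, so p determines T except for x and y themselves.\<close>
  have mem: "(p, T) \<in> ?X \<longleftrightarrow> int (monomial_degree p) = j \<and>
    (\<forall>l. l \<noteq> x \<longrightarrow> l \<noteq> y \<longrightarrow> lookup p l = (if l \<in> T then 1 else 0)) \<and>
    s + (if x \<in> T then 1 else 0) \<le> lookup p x \<and> s + (if y \<in> T then 1 else 0) \<le> lookup p y" (is "_ \<longleftrightarrow> ?R p T") for p T
  proof
    assume "(p, T) \<in> ?X"
    then show "?R p T" unfolding memX by (auto simp: lookup_add lookup_indicator_exp)
  next
    assume R: "?R p T"
    have "lookup p t > 0" if "t \<in> T" for t using R that s by (cases "t = x"; cases "t = y") auto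
    then obtain a where a: "p = a + indicator_exp T" using exponent_split_indicator[of p T] by auto
    have l: "lookup p l = lookup a l + (if l \<in> T then 1 else 0)" for l by (simp add: a lookup_add lookup_indicator_exp)
    have "s \<le> lookup a x" "s \<le> lookup a y" using R l[of x] l[of y] by simp_all
    moreover have "lookup a l = 0" if "l \<noteq> x" "l \<noteq> y" for l using R l[of l] that by simp
    ultimately have "s \<le> lookup a x \<and> s \<le> lookup a y \<and> (\<forall>l. l \<noteq> x \<longrightarrow> l \<noteq> y \<longrightarrow> lookup a l = 0)" by blast
    then show "(p, T) \<in> ?X" unfolding memX using R a by blast
  qed
  \<comment> \<open>One of the exponents at x and y exceeds s, while all others are at most 1. The
    largest exponent therefore sits at x or y with room to spare, and adjoining or removing it stays
    in B.\<close>
  have B0: "hdim TYPE('k) r B n = 0"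
  proof (rule hdim_acyclic[OF r fin(2), where a = argmax_exp])
    fix p :: "'n \<Rightarrow>\<^sub>0 nat" and T :: "'n set"
    let ?i = "argmax_exp p"
    have i: "(?i = x \<or> ?i = y) \<and> lookup p ?i \<ge> s + 1" if pB: "(p, T) \<in> B"
    proof -
      have R: "?R p T" and nb: "\<not> (lookup p x = s \<and> lookup p y = s)" using pB mem by (auto simp: B_def)
      have big: "lookup p ?i \<ge> s + 1"
        using R nb lookup_argmax_exp[of p x] lookup_argmax_exp[of p y] by (auto split: if_splits)
      have "?i = x \<or> ?i = y"
      proof (rule ccontr)
        assume "\<not> ?thesis"
        then have "lookup p ?i \<le> 1" using R by (auto dest!: spec[of _ ?i])
        then show False using big s by simp
      qed
      then show ?thesis using big by blast
    qed
    {
      assume "(p, T) \<in> level B n" "?i \<notin> T"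
      then have pB: "(p, T) \<in> B" by (simp add: level_def)
      then have "?R p T" using mem by (auto simp: B_def)
      then have "?R p (insert ?i T)" using i[OF pB] by (auto split: if_splits)
      then show "(p, insert ?i T) \<in> B" using pB mem by (auto simp: B_def)
    next
      assume "(p, T) \<in> level B n" "?i \<in> T"
      then have pB: "(p, T) \<in> B" by (simp add: level_def)
      then have "?R p T" using mem by (auto simp: B_def)
      then have "?R p (T - {?i})" using i[OF pB] by (auto split: if_splits)
      then show "(p, T - {?i}) \<in> B" using pB mem by (auto simp: B_def)
    next
      fix t u assume "(p, T) \<in> B" and pB: "(p, insert u (insert t T)) \<in> B"
      then have "?R p T" "?R p (insert u (insert t T))" using mem by (auto simp: B_def)
      then have "?R p (insert t T)" by (auto split: if_splits)
      then show "(p, insert t T) \<in> B" using pB mem by (auto simp: B_def)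
    }
  qed
  let ?b = "single x s + single y s"
  have memA: "(p, T) \<in> A \<longleftrightarrow> T \<subseteq> ?W \<and> p = ?b + indicator_exp T \<and> int (monomial_degree p) = j" for p T
  proof
    assume "(p, T) \<in> A"
    then have R: "?R p T" "lookup p x = s" "lookup p y = s" using mem by (auto simp: A_def)
    then have "T \<subseteq> ?W" by (auto split: if_splits)
    moreover have "p = ?b + indicator_exp T"
      using R xy calculation
      by (intro poly_mapping_eqI) (auto simp: lookup_add lookup_single when_def lookup_indicator_exp)
    ultimately show "T \<subseteq> ?W \<and> p = ?b + indicator_exp T \<and> int (monomial_degree p) = j" using R by blast
  next
    assume T: "T \<subseteq> ?W \<and> p = ?b + indicator_exp T \<and> int (monomial_degree p) = j"
    then have "lookup p l = (if l = x \<or> l = y then s else if l \<in> T then 1 else 0)" for l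
      using xy by (auto simp: lookup_add lookup_single when_def lookup_indicator_exp)
    then have "?R p T" "lookup p x = s" "lookup p y = s" using T by auto
    then show "(p, T) \<in> A" using mem by (simp add: A_def)
  qed
  \<comment> \<open>In A the multidegree determines T completely, so no two elements differ by one
    insertion and the differential is zero.\<close>
  have "(p, insert t T) \<notin> A" if "(p, T) \<in> A" "t \<notin> T" for p T t
  proof -
    have "single t (1::nat) \<noteq> 0"
      using lookup_single_eq[of t "1::nat"] by (metis lookup_zero one_neq_zero)
    then show ?thesis using that unfolding memA by (auto simp: indicator_exp_insert)
  qed
  then have nA: "nullity TYPE('k) r A m = card (level A m)" for m
    by (intro nullity_discrete fin(1)) (auto simp: level_def)
  have lA: "level A n = (if j = 2 * int s + int n then (\<lambda>T. (?b + indicator_exp T, T)) ` {T. T \<subseteq> ?W \<and> card T = n} else {})"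
  proof -
    have "(p, T) \<in> level A n \<longleftrightarrow> T \<subseteq> ?W \<and> p = ?b + indicator_exp T \<and> card T = n \<and> j = 2 * int s + int n" for p T
      by (auto simp: level_def memA monomial_degree_add)
    then show ?thesis by auto
  qed
  have "card ((\<lambda>T. (?b + indicator_exp T, T)) ` {T. T \<subseteq> ?W \<and> card T = n}) = (CARD('n) - 2) choose n"
  proof -
    have "card ?W = CARD('n) - 2" using xy by (simp add: Compl_eq_Diff_UNIV card_Diff_subset)
    then show ?thesis using n_subsets[of ?W n] by (simp add: card_image inj_on_def)
  qed
  then have cA: "int (card (level A n)) = (if j = 2 * int s + int n then int ((CARD('n) - 2) choose n) else 0)"
    by (simp add: lA)
  have "card (level (A \<union> B) m) = card (level A m) + card (level B m)" for m
    by (rule card_level_Un[OF fin]) (use disj in blast)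
  then have "koszul_hdim TYPE('k) r (stratum s ?W) n j = hdim TYPE('k) r A n + hdim TYPE('k) r B n"
    by (simp add: koszul_hdim_def X hdim_def nullity_disjoint[OF fin disj])
  then show ?thesis using B0 cA nA by (simp add: hdim_def)
qed

text \<open>With at most one nonzero exponent, at x say, |a| - a_x = 0 falls short of s.\<close>

lemma stratum_large:
  assumes "card (- W) \<le> 1" "1 \<le> s"
  shows "stratum s W = {}"
proof -
  obtain x where x: "- W \<subseteq> {x}"
  proof (cases "- W = {}")
    case False
    then obtain x where "x \<in> - W" by blast
    then have "- W \<subseteq> {x}" using assms(1) card_le_Suc0_iff_eq[of "- W"] by auto
    then show ?thesis by (rule that)
  qed (use that in blast)
  have False if a: "a \<in> stratum s W" for a
  proof -
    have "lookup a l = 0" if "l \<noteq> x" for l using a x that by (auto simp: stratum_def)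
    then have "monomial_degree a = lookup a x" using monomial_degree_remove[of a x] by simp
    moreover have "s + lookup a x \<le> monomial_degree a" using a by (simp add: stratum_def symbolic_exponents_iff)
    ultimately show False using assms(2) by simp
  qed
  then show ?thesis by blast
qed

section \<open>The complete graph on four vertices\<close>

text \<open>Only the right side mentions \<open>r\<close>, so all injective numberings give the same
  value. This identifies the contributions of the four vertices, which arise with different
  \<open>r o e\<close>.\<close>

lemma tor_dim_symbolic_power:
  fixes r :: "'n::finite \<Rightarrow> nat"
  assumes "inj r"
  shows "int (tor_dim n (symbolic_power complete_edge_ideal s :: ('n, 'k::field) mpoly set) j) =
    koszul_hdim TYPE('k) r (symbolic_exponents s) n j"
  unfolding symbolic_power_complete_edge_ideal koszul_hdim_def
  by (rule tor_dim_monomial_ideal[OF assms up_closed_symbolic_exponents])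

lemma ex_inj_nat: "\<exists>r :: 'n::finite \<Rightarrow> nat. inj r"
  using finite_imp_inj_to_nat_seg[of "UNIV :: 'n set"] by auto

lemma tor_dim_symbolic_power_eq_zero:
  assumes "j > 2 * int s + int n"
  shows "tor_dim n (symbolic_power complete_edge_ideal s :: ('n::finite, 'k::field) mpoly set) j = 0"
proof -
  obtain r :: "'n \<Rightarrow> nat" where r: "inj r" using ex_inj_nat by blast
  show ?thesis
    using tor_dim_symbolic_power[OF r, of n s j, where 'k = 'k]
      koszul_hdim_symbolic_exponents_eq_zero[OF r assms, where 'k = 'k] by simp
qed

lemma sum_subsets_by_card:
  "(\<Sum>W\<in>(UNIV :: 'n::finite set set). f (card W)) = (\<Sum>k\<le>CARD('n). int (CARD('n) choose k) * f k)"
proof -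
  have "(\<Sum>W\<in>(UNIV :: 'n set set). f (card W)) =
    (\<Sum>k\<le>CARD('n). \<Sum>W\<in>{W \<in> (UNIV :: 'n set set). card W = k}. f (card W))"
    by (rule sum.group[symmetric]) (auto simp: card_mono)
  also have "\<dots> = (\<Sum>k\<le>CARD('n). int (card {W :: 'n set. card W = k}) * f k)"
    by (intro sum.cong) auto
  also have "\<dots> = (\<Sum>k\<le>CARD('n). int (CARD('n) choose k) * f k)"
    using n_subsets[of "UNIV :: 'n set"] by simp
  finally show ?thesis .
qed

lemma sum_subsets_four:
  fixes f :: "nat \<Rightarrow> int"
  shows "(\<Sum>W\<in>(UNIV :: 4 set set). f (card W)) = f 0 + 4 * f 1 + 6 * f 2 + 4 * f 3 + f 4"
  unfolding sum_subsets_by_card by (simp add: numeral_eq_Suc)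

text \<open>The recursion with its correction term, uniform in n and j. The coefficients 1, 4, 6
  count the sets W of size 0, 1, 2.\<close>

lemma tor_dim_symbolic_power_K4:
  assumes s: "3 \<le> s"
  shows "int (tor_dim n (symbolic_power complete_edge_ideal s :: (4, 'k::field) mpoly set) j) =
    int (tor_dim n (symbolic_power complete_edge_ideal (s - 3) :: (4, 'k) mpoly set) (j - 4)) +
    4 * (int (tor_dim n (symbolic_power complete_edge_ideal (s - 2) :: (3, 'k) mpoly set) (j - 3)) +
      (if n = 0 then 0
       else int (tor_dim (n - 1) (symbolic_power complete_edge_ideal (s - 2) :: (3, 'k) mpoly set) (j - 4)))) +
    6 * (if j = 2 * int s + int n then int (2 choose n) else 0)"
    (is "_ = ?a + 4 * ?b + 6 * ?c")
proof -
  obtain r :: "4 \<Rightarrow> nat" where r: "inj r" using ex_inj_nat by blast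
  \<comment> \<open>Summation over subsets uses the cardinality only; sizes 3 and 4 get 0 because
    those strata are empty.\<close>
  let ?f = "\<lambda>k :: nat. if k = 0 then ?a else if k = 1 then ?b else if k = 2 then ?c else 0"
  have "koszul_hdim TYPE('k) r (stratum s W) n j = ?f (card W)" for W :: "4 set"
  proof -
    have cW: "card W + card (- W) = 4" using card_Un_disjoint[of W "- W"] by simp
    consider "card W = 0" | "card W = 1" | "card W = 2" | "card W > 2" by linarith
    then show ?thesis
    proof cases
      case 1
      then have "W = {}" by simp
      then show ?thesis
        using koszul_hdim_stratum_empty[where 'n = 4 and 'k = 'k, of s r n j] s
          tor_dim_symbolic_power[OF r, of n "s - 3" "j - 4", where 'k = 'k] by simp
    next
      case 2
      then obtain q where W: "W = {q}" by (auto simp: card_1_singleton_iff)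
      have "card (UNIV :: 3 set) = card (- {q})" using cW 2 W by simp
      then obtain e :: "3 \<Rightarrow> 4" where "bij_betw e UNIV (- {q})"
        using finite_same_card_bij[of "UNIV :: 3 set" "- {q}"] by auto
      then have e: "inj e" "range e = - {q}" by (auto simp: bij_betw_def)
      have re: "inj (r \<circ> e)" using r e(1) by (simp add: inj_compose)
      have "koszul_hdim TYPE('k) r (stratum s {q}) n j = ?b"
        using koszul_hdim_stratum_singleton[OF e, of s r n j, where 'k = 'k] s
          tor_dim_symbolic_power[OF re, where 'k = 'k] by simp
      then show ?thesis using W 2 by simp
    next
      case 3
      then have "card (- W) = 2" using cW by simp
      then obtain x y where xy: "- W = {x, y}" "x \<noteq> y" by (auto simp: card_2_iff)
      then have "W = - {x, y}" by blast
      then show ?thesis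
        using koszul_hdim_stratum_two[OF r xy(2), of s n j, where 'k = 'k] s 3 by simp
    next
      case 4
      then have "card (- W) \<le> 1" "W \<noteq> {}" using cW by auto
      then show ?thesis using stratum_large[of W s] s 4 by simp
    qed
  qed
  then have "koszul_hdim TYPE('k) r (symbolic_exponents s) n j = (\<Sum>W\<in>(UNIV :: 4 set set). ?f (card W))"
    using koszul_hdim_symbolic_exponents[OF r, of s n j, where 'k = 'k] s by simp
  also have "\<dots> = ?f 0 + 4 * ?f 1 + 6 * ?f 2 + 4 * ?f 3 + ?f 4"
    by (rule sum_subsets_four)
  also have "\<dots> = ?a + 4 * ?b + 6 * ?c" by simp
  finally show ?thesis using tor_dim_symbolic_power[OF r, of n s j, where 'k = 'k] by simp
qed

theorem theorem3p13:
  fixes s i :: nat and j :: int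
    and IK4 :: "(4, 'k::field) mpoly set"
    and IK3 :: "(3, 'k) mpoly set"
  defines "IK4 \<equiv> complete_edge_ideal" and "IK3 \<equiv> complete_edge_ideal"
  assumes "s \<ge> 4" and "i > 0" and "j > 0"
  shows "((i, j) = (1, 2 * int s) \<or> (i, j) = (3, 2 * int s + 2) \<longrightarrow>
            betti i j (symbolic_power IK4 s) = 6) \<and>
         betti 2 (2 * int s + 1) (symbolic_power IK4 s) = 12 \<and>
         ((i, j) \<notin> {(1, 2 * int s), (3, 2 * int s + 2), (2, 2 * int s + 1)} \<longrightarrow>
            betti i j (symbolic_power IK4 s) =
              betti i (j - 4) (symbolic_power IK4 (s - 3))
              + 4 * betti (i - 1) (j - 4) (symbolic_power IK3 (s - 2))
              + 4 * betti i (j - 3) (symbolic_power IK3 (s - 2)))"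
proof -
  \<comment> \<open>In degree 2s + n every recursive term vanishes: 2s + n - 4 > 2(s - 3) + n, 2s +
    n - 3 > 2(s - 2) + n, and for n > 0 also 2s + n - 4 > 2(s - 2) + n - 1. Only the correction
    remains, 6, 12, 6 for n = 0, 1, 2; \<open>Suc n\<close> is the index shift between Tor and
    \<open>betti\<close>.\<close>
  have corner: "betti (Suc n) (2 * int s + int n) (symbolic_power IK4 s) = 6 * (2 choose n)" for n
  proof -
    have "int (tor_dim n (symbolic_power IK4 s) (2 * int s + int n)) = 6 * int (2 choose n)"
      using tor_dim_symbolic_power_K4[of s n "2 * int s + int n", where 'k = 'k] \<open>s \<ge> 4\<close>
        tor_dim_symbolic_power_eq_zero[of "s - 3" n "2 * int s + int n - 4", where 'n = 4 and 'k = 'k]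
        tor_dim_symbolic_power_eq_zero[of "s - 2" n "2 * int s + int n - 3", where 'n = 3 and 'k = 'k]
        tor_dim_symbolic_power_eq_zero[of "s - 2" "n - 1" "2 * int s + int n - 4", where 'n = 3 and 'k = 'k]
      unfolding IK4_def by (simp add: of_nat_diff split: if_splits)
    then show ?thesis by (simp add: betti_def)
  qed
  obtain n where i: "i = Suc n" using \<open>i > 0\<close> by (cases i) auto
  have "betti i j (symbolic_power IK4 s) =
      betti i (j - 4) (symbolic_power IK4 (s - 3))
      + 4 * betti (i - 1) (j - 4) (symbolic_power IK3 (s - 2))
      + 4 * betti i (j - 3) (symbolic_power IK3 (s - 2))"
    if "(i, j) \<notin> {(1, 2 * int s), (3, 2 * int s + 2), (2, 2 * int s + 1)}"
  proof -
    \<comment> \<open>For n <= 2 the correction lives exactly in the excluded positions; for larger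
      n the binomial coefficient is zero.\<close>
    have "(if j = 2 * int s + int n then int (2 choose n) else 0) = 0"
    proof (cases "n \<le> 2")
      case True
      then have "n = 0 \<or> n = 1 \<or> n = 2" by auto
      then show ?thesis using that i by auto
    qed (simp add: binomial_eq_0)
    then have "int (betti i j (symbolic_power IK4 s)) =
      int (betti i (j - 4) (symbolic_power IK4 (s - 3))
      + 4 * betti (i - 1) (j - 4) (symbolic_power IK3 (s - 2))
      + 4 * betti i (j - 3) (symbolic_power IK3 (s - 2)))"
      using tor_dim_symbolic_power_K4[of s n j, where 'k = 'k] \<open>s \<ge> 4\<close>
      unfolding IK4_def IK3_def by (simp add: betti_def i)
    then show ?thesis by (simp only: of_nat_eq_iff)
  qed
  then show ?thesis
    using corner[of 0] corner[of 1] corner[of 2] by (auto simp: numeral_eq_Suc)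
qed

end
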